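(* Let $R$ be a right noetherian ring, and let $P$ and $Q$ be prime ideals of $R$. Let $E_Q$ be the tame indecomposable injective right $R$-module with assassinator $Q$. Then $\mathrm{Ext}^1_R(R/P,\mathrm{ann}_{E_Q}(Q))$ has a nonzero torsionfree $R/P$-submodule if there exists an ideal $A$ such that $PQ\subseteq A\subsetneq P\cap Q$ with $(P\cap Q)/A$ faithful as a left $R/P$-module and torsionfree as a right $R/Q$-module.
   Context: Modules are right modules unless stated otherwise. $E_Q$ is the injective hull, as a right $R$-module, of any uniform right ideal of $R/Q$ (unique up to isomorphism); $\mathrm{ann}_{E_Q}(Q)=\{x\in E_Q:xQ=0\}$. $\mathrm{Ext}^1_R(R/P,M)$ is a right $R/P$-module via the left action of $R$ on $R/P$. Torsionfree is with respect to regular elements of the prime ring in question. *)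

theory Defs
  imports "HOL-Algebra.QuotRing" "HOL-Algebra.Ideal_Product"
begin

section \<open>Right modules over noncommutative rings\<close>

text \<open>
  HOL-Algebra's modules are modules over commutative rings, so right modules over arbitrary
  unital rings are set up here. As for the library's \<open>module\<close> record, the
  additive structure is that of a ring record whose \<open>mult\<close> and \<open>one\<close> are never used.
\<close>

record ('a, 'b) rmodule = "'b ring" +
  rsmult :: "'b \<Rightarrow> 'a \<Rightarrow> 'b" (infixl "\<star>\<index>" 70)

locale right_module = R?: ring R + M?: abelian_group M
  for R (structure) and M :: "('a, 'b, 'c) rmodule_scheme" (structure) +
  assumes rsmult_closed: "x \<in> carrier M \<Longrightarrow> r \<in> carrier R \<Longrightarrow> x \<star>\<^bsub>M\<^esub> r \<in> carrier M"
    and rsmult_l_distr: "x \<in> carrier M \<Longrightarrow> y \<in> carrier M \<Longrightarrow> r \<in> carrier R \<Longrightarrow>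
      (x \<oplus>\<^bsub>M\<^esub> y) \<star>\<^bsub>M\<^esub> r = x \<star>\<^bsub>M\<^esub> r \<oplus>\<^bsub>M\<^esub> y \<star>\<^bsub>M\<^esub> r"
    and rsmult_r_distr: "x \<in> carrier M \<Longrightarrow> r \<in> carrier R \<Longrightarrow> s \<in> carrier R \<Longrightarrow>
      x \<star>\<^bsub>M\<^esub> (r \<oplus>\<^bsub>R\<^esub> s) = x \<star>\<^bsub>M\<^esub> r \<oplus>\<^bsub>M\<^esub> x \<star>\<^bsub>M\<^esub> s"
    and rsmult_assoc: "x \<in> carrier M \<Longrightarrow> r \<in> carrier R \<Longrightarrow> s \<in> carrier R \<Longrightarrow>
      x \<star>\<^bsub>M\<^esub> (r \<otimes>\<^bsub>R\<^esub> s) = (x \<star>\<^bsub>M\<^esub> r) \<star>\<^bsub>M\<^esub> s"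
    and rsmult_one: "x \<in> carrier M \<Longrightarrow> x \<star>\<^bsub>M\<^esub> \<one>\<^bsub>R\<^esub> = x"

text \<open>The submodule \<open>N\<close> is a subset; as a module in its own right it is
  \<open>M\<lparr>carrier := N\<rparr>\<close>.\<close>

locale rsubmodule = right_module R M + additive_subgroup N M
  for R (structure) and N and M :: "('a, 'b, 'c) rmodule_scheme" (structure) +
  assumes rsmult_sub_closed: "x \<in> N \<Longrightarrow> r \<in> carrier R \<Longrightarrow> x \<star>\<^bsub>M\<^esub> r \<in> N"

definition rmod_hom ::
  "('a, 'm) ring_scheme \<Rightarrow> ('a, 'b, 'c) rmodule_scheme \<Rightarrow> ('a, 'd, 'e) rmodule_scheme \<Rightarrow> ('b \<Rightarrow> 'd) set"
  where "rmod_hom R M N = {f \<in> carrier M \<rightarrow>\<^sub>E carrier N.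
    (\<forall>x \<in> carrier M. \<forall>y \<in> carrier M. f (x \<oplus>\<^bsub>M\<^esub> y) = f x \<oplus>\<^bsub>N\<^esub> f y) \<and>
    (\<forall>x \<in> carrier M. \<forall>r \<in> carrier R. f (x \<star>\<^bsub>M\<^esub> r) = f x \<star>\<^bsub>N\<^esub> r)}"

definition regular_rmod :: "('a, 'm) ring_scheme \<Rightarrow> ('a, 'a) rmodule"
  where "regular_rmod R = \<lparr>carrier = carrier R, mult = mult R, one = one R,
    zero = zero R, add = add R, rsmult = mult R\<rparr>"

text \<open>In the action on \<open>M/N\<close> all sets in the union coincide when \<open>X\<close> is a coset of
  the submodule \<open>N\<close>.\<close>

definition quot_rmod :: "('a, 'b, 'c) rmodule_scheme \<Rightarrow> 'b set \<Rightarrow> ('a, 'b set) rmodule"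
  where "quot_rmod M N = \<lparr>carrier = a_rcosets\<^bsub>M\<^esub> N, mult = undefined, one = undefined,
    zero = N, add = set_add M, rsmult = (\<lambda>X r. \<Union>x\<in>X. N +>\<^bsub>M\<^esub> (x \<star>\<^bsub>M\<^esub> r))\<rparr>"

text \<open>A right \<open>R\<close>-module \<open>M\<close> with \<open>MJ = 0\<close>, regarded as a right \<open>R/J\<close>-module: a coset
  \<open>C\<close> acts as any of its representatives, which all act alike.\<close>

definition factor_rmod :: "('a, 'b, 'c) rmodule_scheme \<Rightarrow> ('a set, 'b) rmodule"
  where "factor_rmod M = \<lparr>carrier = carrier M, mult = mult M, one = one M, zero = zero M,
    add = add M, rsmult = (\<lambda>x C. the_elem ((\<lambda>r. x \<star>\<^bsub>M\<^esub> r) ` C))\<rparr>"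

definition opp_ring :: "('a, 'm) ring_scheme \<Rightarrow> ('a, 'm) ring_scheme"
  where "opp_ring R = R\<lparr>mult := (\<lambda>x y. y \<otimes>\<^bsub>R\<^esub> x)\<rparr>"

text \<open>For ideals \<open>A \<subseteq> I\<close> of \<open>R\<close>: the right \<open>R\<close>-module \<open>I/A\<close>. The left \<open>R\<close>-module
  \<open>I/A\<close> is \<open>ideal_quot (opp_ring R) I A\<close>, left modules being right modules over the
  opposite ring.\<close>

definition ideal_quot :: "('a, 'm) ring_scheme \<Rightarrow> 'a set \<Rightarrow> 'a set \<Rightarrow> ('a, 'a set) rmodule"
  where "ideal_quot R I A = quot_rmod ((regular_rmod R)\<lparr>carrier := I\<rparr>) A"


section \<open>Chain condition, primes, regularity\<close>

definition right_noetherian :: "('a, 'm) ring_scheme \<Rightarrow> bool"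
  where "right_noetherian R \<longleftrightarrow> ring R \<and>
    (\<forall>I :: nat \<Rightarrow> 'a set. (\<forall>n. rsubmodule R (I n) (regular_rmod R)) \<and> (\<forall>n. I n \<subseteq> I (Suc n)) \<longrightarrow>
      (\<exists>n. \<forall>m\<ge>n. I m = I n))"

text \<open>The library's \<open>primeideal\<close> is for commutative rings only (on a noncommutative ring its
  condition would define completely prime ideals).\<close>

definition nc_prime_ideal :: "('a, 'm) ring_scheme \<Rightarrow> 'a set \<Rightarrow> bool"
  where "nc_prime_ideal R P \<longleftrightarrow> ideal P R \<and> P \<noteq> carrier R \<and>
    (\<forall>I J. ideal I R \<and> ideal J R \<and> ideal_prod R I J \<subseteq> P \<longrightarrow> I \<subseteq> P \<or> J \<subseteq> P)"

definition regular_elem :: "('a, 'm) ring_scheme \<Rightarrow> 'a \<Rightarrow> bool"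
  where "regular_elem S c \<longleftrightarrow> c \<in> carrier S \<and>
    (\<forall>s \<in> carrier S. c \<otimes>\<^bsub>S\<^esub> s = \<zero>\<^bsub>S\<^esub> \<longrightarrow> s = \<zero>\<^bsub>S\<^esub>) \<and>
    (\<forall>s \<in> carrier S. s \<otimes>\<^bsub>S\<^esub> c = \<zero>\<^bsub>S\<^esub> \<longrightarrow> s = \<zero>\<^bsub>S\<^esub>)"

definition torsionfree :: "('s, 'm) ring_scheme \<Rightarrow> ('s, 'b, 'c) rmodule_scheme \<Rightarrow> bool"
  where "torsionfree S M \<longleftrightarrow>
    (\<forall>x \<in> carrier M. \<forall>c. regular_elem S c \<and> x \<star>\<^bsub>M\<^esub> c = \<zero>\<^bsub>M\<^esub> \<longrightarrow> x = \<zero>\<^bsub>M\<^esub>)"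

definition faithful :: "('s, 'm) ring_scheme \<Rightarrow> ('s, 'b, 'c) rmodule_scheme \<Rightarrow> bool"
  where "faithful S M \<longleftrightarrow>
    (\<forall>s \<in> carrier S. (\<forall>x \<in> carrier M. x \<star>\<^bsub>M\<^esub> s = \<zero>\<^bsub>M\<^esub>) \<longrightarrow> s = \<zero>\<^bsub>S\<^esub>)"


section \<open>Uniform modules and injective hulls\<close>

definition uniform_rmod :: "('a, 'm) ring_scheme \<Rightarrow> ('a, 'b, 'c) rmodule_scheme \<Rightarrow> bool"
  where "uniform_rmod R M \<longleftrightarrow> right_module R M \<and> carrier M \<noteq> {\<zero>\<^bsub>M\<^esub>} \<and>
    (\<forall>K L. rsubmodule R K M \<and> rsubmodule R L M \<and> K \<noteq> {\<zero>\<^bsub>M\<^esub>} \<and> L \<noteq> {\<zero>\<^bsub>M\<^esub>} \<longrightarrow> K \<inter> L \<noteq> {\<zero>\<^bsub>M\<^esub>})"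

definition essential_sub ::
  "('a, 'm) ring_scheme \<Rightarrow> 'b set \<Rightarrow> ('a, 'b, 'c) rmodule_scheme \<Rightarrow> bool"
  where "essential_sub R N M \<longleftrightarrow> rsubmodule R N M \<and>
    (\<forall>K. rsubmodule R K M \<and> K \<noteq> {\<zero>\<^bsub>M\<^esub>} \<longrightarrow> K \<inter> N \<noteq> {\<zero>\<^bsub>M\<^esub>})"

text \<open>The test modules \<open>B\<close> live in the element type of \<open>R\<close>, since one cannot quantify over
  types. They include \<open>R\<close> itself with its right ideals, so by Baer's criterion this is
  injectivity with respect to all right \<open>R\<close>-modules.\<close>

definition injective_rmod :: "('a, 'm) ring_scheme \<Rightarrow> ('a, 'b, 'c) rmodule_scheme \<Rightarrow> bool"
  where "injective_rmod R E \<longleftrightarrow> right_module R E \<and>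
    (\<forall>(B :: ('a, 'a) rmodule) A f. rsubmodule R A B \<and> f \<in> rmod_hom R (B\<lparr>carrier := A\<rparr>) E \<longrightarrow>
      (\<exists>g \<in> rmod_hom R B E. \<forall>x \<in> A. g x = f x))"

definition injective_hull ::
  "('a, 'm) ring_scheme \<Rightarrow> ('a, 'b, 'c) rmodule_scheme \<Rightarrow> ('a, 'd, 'e) rmodule_scheme \<Rightarrow> ('b \<Rightarrow> 'd) \<Rightarrow> bool"
  where "injective_hull R M E j \<longleftrightarrow> right_module R M \<and> injective_rmod R E \<and>
    j \<in> rmod_hom R M E \<and> inj_on j (carrier M) \<and> essential_sub R (j ` carrier M) E"

definition ann_in :: "('a, 'b, 'c) rmodule_scheme \<Rightarrow> 'a set \<Rightarrow> 'b set"
  where "ann_in M I = {x \<in> carrier M. \<forall>r \<in> I. x \<star>\<^bsub>M\<^esub> r = \<zero>\<^bsub>M\<^esub>}"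


section \<open>\<open>Ext\<close> in degree one\<close>

text \<open>
  \<open>Ext\<^sup>1(N, M)\<close> is computed from the canonical free presentation
  \<open>0 \<rightarrow> K \<rightarrow> F \<rightarrow> N \<rightarrow> 0\<close>, with \<open>F\<close> the free right \<open>R\<close>-module on the set underlying
  \<open>N\<close> (finitely supported functions), as the cokernel of the restriction map
  \<open>Hom(F, M) \<rightarrow> Hom(K, M)\<close>; any other projective presentation of \<open>N\<close> gives an
  isomorphic result. This presentation is functorial in \<open>N\<close>: an endomorphism \<open>\<phi>\<close> of \<open>N\<close> induces
  \<open>free_map R N \<phi>\<close> on \<open>F\<close>, sending the basis element at \<open>x\<close> to the one at \<open>\<phi> x\<close> and preserving
  \<open>K\<close>. Hence a left action of a ring \<open>S\<close> on \<open>N\<close> by \<open>R\<close>-endomorphisms makes \<open>Ext\<^sup>1(N, M)\<close> a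
  right \<open>S\<close>-module, the class of \<open>f\<close> times \<open>s\<close> being the class of \<open>f\<close> composed with the map
  induced by \<open>s\<close>.
\<close>

definition free_rmod ::
  "('a, 'm) ring_scheme \<Rightarrow> ('a, 'b, 'c) rmodule_scheme \<Rightarrow> ('a, 'b \<Rightarrow> 'a) rmodule"
  where "free_rmod R N = \<lparr>
    carrier = {u. (\<forall>x. u x \<in> carrier R) \<and> (\<forall>x. x \<notin> carrier N \<longrightarrow> u x = \<zero>\<^bsub>R\<^esub>) \<and> finite {x. u x \<noteq> \<zero>\<^bsub>R\<^esub>}},
    mult = undefined, one = undefined,
    zero = (\<lambda>x. \<zero>\<^bsub>R\<^esub>), add = (\<lambda>u v x. u x \<oplus>\<^bsub>R\<^esub> v x), rsmult = (\<lambda>u r x. u x \<otimes>\<^bsub>R\<^esub> r)\<rparr>"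

definition free_eval ::
  "('a, 'm) ring_scheme \<Rightarrow> ('a, 'b, 'c) rmodule_scheme \<Rightarrow> ('b \<Rightarrow> 'a) \<Rightarrow> 'b"
  where "free_eval R N u = (\<Oplus>\<^bsub>N\<^esub>x\<in>{x. u x \<noteq> \<zero>\<^bsub>R\<^esub>}. x \<star>\<^bsub>N\<^esub> u x)"

definition syzygy ::
  "('a, 'm) ring_scheme \<Rightarrow> ('a, 'b, 'c) rmodule_scheme \<Rightarrow> ('a, 'b \<Rightarrow> 'a) rmodule"
  where "syzygy R N = (free_rmod R N)\<lparr>carrier := {u \<in> carrier (free_rmod R N). free_eval R N u = \<zero>\<^bsub>N\<^esub>}\<rparr>"

definition free_map ::
  "('a, 'm) ring_scheme \<Rightarrow> ('b \<Rightarrow> 'b) \<Rightarrow> ('b \<Rightarrow> 'a) \<Rightarrow> ('b \<Rightarrow> 'a)"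
  where "free_map R \<phi> u = (\<lambda>y. \<Oplus>\<^bsub>R\<^esub>x\<in>{x. u x \<noteq> \<zero>\<^bsub>R\<^esub> \<and> \<phi> x = y}. u x)"

definition hom_rmod ::
  "('a, 'm) ring_scheme \<Rightarrow> ('s \<Rightarrow> 'k \<Rightarrow> 'k) \<Rightarrow> ('a, 'k, 'c) rmodule_scheme \<Rightarrow> ('a, 'd, 'e) rmodule_scheme
    \<Rightarrow> ('s, 'k \<Rightarrow> 'd) rmodule"
  where "hom_rmod R act K M = \<lparr>carrier = rmod_hom R K M, mult = undefined, one = undefined,
    zero = (\<lambda>x \<in> carrier K. \<zero>\<^bsub>M\<^esub>), add = (\<lambda>f g. \<lambda>x \<in> carrier K. f x \<oplus>\<^bsub>M\<^esub> g x),
    rsmult = (\<lambda>f s. \<lambda>x \<in> carrier K. f (act s x))\<rparr>"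

text \<open>The parameter \<open>lact\<close> is the left action of the ring \<open>S\<close> on \<open>N\<close>.\<close>

definition ext1 ::
  "('a, 'm) ring_scheme \<Rightarrow> ('s \<Rightarrow> 'b \<Rightarrow> 'b) \<Rightarrow> ('a, 'b, 'c) rmodule_scheme \<Rightarrow> ('a, 'd, 'e) rmodule_scheme
    \<Rightarrow> ('s, (('b \<Rightarrow> 'a) \<Rightarrow> 'd) set) rmodule"
  where "ext1 R lact N M =
    quot_rmod (hom_rmod R (\<lambda>s. free_map R (lact s)) (syzygy R N) M)
      ((\<lambda>f. restrict f (carrier (syzygy R N))) ` rmod_hom R (free_rmod R N) M)"

end

theory Submission
  imports Defs
begin

text \<open>
  Write \<open>M\<close> for \<open>ann\<^bsub>E\<^esub>(Q)\<close> and \<open>I\<close> for \<open>P \<inter> Q\<close>. An element \<open>e\<close> of \<open>E\<close> with \<open>eP \<subseteq> M\<close> gives the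
  homomorphism \<open>p \<mapsto> ep\<close> from \<open>P\<close> to \<open>M\<close>, hence a class \<open>[e]\<close> in
  \<open>Ext\<^sup>1(R/P, M) = Hom(P, M) / Hom(R, M)\<close>. These classes satisfy \<open>[e]s = [es]\<close>, and \<open>[m] = 0\<close> for
  \<open>m \<in> M\<close>. Conversely, if \<open>[e] = 0\<close>, then \<open>e\<close> acts on \<open>P\<close> like some \<open>m \<in> M\<close>, so that \<open>eI = 0\<close>
  because \<open>MQ = 0\<close>. Every \<open>e\<close> with \<open>eA = 0\<close> has such a class, as \<open>ePQ \<subseteq> eA = 0\<close>.

  Suppose that \<open>eA = 0\<close> and that \<open>V\<close> is a right ideal not contained in \<open>P\<close> such that \<open>v \<in> V\<close> and
  \<open>evI = 0\<close> together imply \<open>v \<in> P\<close>. Then the classes \<open>[ev]\<close> with \<open>v \<in> V\<close> form the required submodule: if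
  \<open>[ev]c = [evc] = 0\<close> with \<open>c\<close> regular modulo \<open>P\<close>, then \<open>vc \<in> P\<close>, hence \<open>v \<in> P\<close>, hence \<open>ev \<in> M\<close>
  and \<open>[ev] = 0\<close> (\<open>quotient_ext.torsionfree_classes\<close>).

  It remains to find \<open>e\<close> and \<open>V\<close>. If there are none, then for every \<open>e\<close> in \<open>ann\<^bsub>E\<^esub>(A)\<close> the right ideal
  \<open>{r. erI = 0}\<close> is essential modulo \<open>P\<close>, and so is every finite intersection of such right ideals.
  But some finite subset of \<open>ann\<^bsub>E\<^esub>(A)\<close> has the common annihilator \<open>A\<close> in \<open>I\<close>. For \<open>r\<close> in the
  corresponding intersection this means \<open>rI \<subseteq> A\<close>, and then \<open>r \<in> P\<close> because \<open>I/A\<close> is faithful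
  (\<open>exists_nonessential_annihilator\<close>).

  The finite subset is obtained from the ascending chain condition (\<open>finite_separating_set\<close>) once
  every \<open>x \<in> I - A\<close> admits an \<open>e\<close> in \<open>ann\<^bsub>E\<^esub>(A)\<close> which is injective modulo \<open>A\<close> on some right ideal
  contained in \<open>xR + A\<close> but not in \<open>A\<close>. As \<open>I/A\<close> is torsionfree, the annihilator of \<open>x + A\<close> in \<open>R/Q\<close>
  contains no regular element. By Goldie's theorem it is not essential
  (\<open>essential_contains_regular\<close>), and in a prime ring this yields \<open>v\<close> such that \<open>u \<mapsto> xvu + A\<close> is
  injective on the uniform right ideal \<open>U\<close> (\<open>uniform_right_ideal_translate\<close>). Now \<open>xvu + a \<mapsto> j(u)\<close>
  is a well defined homomorphism from a right ideal of \<open>R\<close> to \<open>E\<close>. By injectivity of \<open>E\<close> it is left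
  multiplication by an element \<open>e\<close> (\<open>exists_functional\<close>).

  Since \<open>Ext\<^sup>1\<close> is computed from the free module on the set \<open>R/P\<close>, the class of \<open>e\<close> is represented
  by \<open>u \<mapsto> e \<Sum> c(C)u(C)\<close> on the syzygy, where \<open>c(C)\<close> is a representative of the coset \<open>C\<close>.
\<close>

section \<open>Right modules and right ideals\<close>

context right_module
begin

lemma rsmult_zero: "x \<in> carrier M \<Longrightarrow> x \<star>\<^bsub>M\<^esub> \<zero>\<^bsub>R\<^esub> = \<zero>\<^bsub>M\<^esub>"
  using rsmult_r_distr[of x "\<zero>\<^bsub>R\<^esub>" "\<zero>\<^bsub>R\<^esub>"] rsmult_closed[of x "\<zero>\<^bsub>R\<^esub>"]
  by (metis M.add.l_cancel_one R.zero_closed R.l_zero)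

lemma zero_rsmult: "r \<in> carrier R \<Longrightarrow> \<zero>\<^bsub>M\<^esub> \<star>\<^bsub>M\<^esub> r = \<zero>\<^bsub>M\<^esub>"
  using rsmult_l_distr[of "\<zero>\<^bsub>M\<^esub>" "\<zero>\<^bsub>M\<^esub>" r] rsmult_closed[of "\<zero>\<^bsub>M\<^esub>" r]
  by (metis M.add.l_cancel_one M.zero_closed M.l_zero)

lemma rsmult_minus:
  assumes "x \<in> carrier M" "r \<in> carrier R"
  shows "x \<star>\<^bsub>M\<^esub> (\<ominus>\<^bsub>R\<^esub> r) = \<ominus>\<^bsub>M\<^esub> (x \<star>\<^bsub>M\<^esub> r)"
  using rsmult_r_distr[of x "\<ominus>\<^bsub>R\<^esub> r" r] rsmult_closed assms rsmult_zero
  by (metis M.minus_equality R.a_inv_closed R.l_neg)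

lemma rsmult_minus_one: "x \<in> carrier M \<Longrightarrow> x \<star>\<^bsub>M\<^esub> (\<ominus>\<^bsub>R\<^esub> \<one>\<^bsub>R\<^esub>) = \<ominus>\<^bsub>M\<^esub> x"
  by (simp add: rsmult_minus rsmult_one)

lemma rsubmoduleI:
  assumes "N \<subseteq> carrier M" "\<zero>\<^bsub>M\<^esub> \<in> N"
    and "\<And>x y. x \<in> N \<Longrightarrow> y \<in> N \<Longrightarrow> x \<oplus>\<^bsub>M\<^esub> y \<in> N"
    and "\<And>x r. x \<in> N \<Longrightarrow> r \<in> carrier R \<Longrightarrow> x \<star>\<^bsub>M\<^esub> r \<in> N"
  shows "rsubmodule R N M"
proof (intro rsubmodule.intro right_module_axioms additive_subgroup.intro rsubmodule_axioms.intro)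
  show "subgroup N (add_monoid M)"
  proof (rule M.add.subgroupI)
    fix x assume "x \<in> N"
    then show "\<ominus>\<^bsub>M\<^esub> x \<in> N"
      using assms(1) assms(4)[of x "\<ominus>\<^bsub>R\<^esub> \<one>\<^bsub>R\<^esub>"] rsmult_minus_one by auto
  qed (use assms in auto)
qed (use assms in auto)

end

lemma (in rsubmodule) right_module_restrict: "right_module R (M\<lparr>carrier := N\<rparr>)"
proof (intro right_module.intro R.ring_axioms right_module_axioms.intro)
  show "abelian_group (M\<lparr>carrier := N\<rparr>)"
  proof (rule abelian_groupI)
    fix x assume "x \<in> carrier (M\<lparr>carrier := N\<rparr>)"
    then show "\<exists>y\<in>carrier (M\<lparr>carrier := N\<rparr>). y \<oplus>\<^bsub>M\<lparr>carrier := N\<rparr>\<^esub> x = \<zero>\<^bsub>M\<lparr>carrier := N\<rparr>\<^esub>"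
      by (intro bexI[of _ "\<ominus>\<^bsub>M\<^esub> x"]) (auto simp: M.l_neg)
  qed (auto simp: M.a_ac)
qed (auto simp: rsmult_sub_closed rsmult_l_distr rsmult_r_distr rsmult_assoc rsmult_one)

abbreviation right_ideal :: "('a, 'm) ring_scheme \<Rightarrow> 'a set \<Rightarrow> bool"
  where "right_ideal R I \<equiv> rsubmodule R I (regular_rmod R)"

abbreviation essential_right_ideal :: "('a, 'm) ring_scheme \<Rightarrow> 'a set \<Rightarrow> bool"
  where "essential_right_ideal R I \<equiv> essential_sub R I (regular_rmod R)"

lemma regular_rmod_simps [simp]:
  "carrier (regular_rmod R) = carrier R" "zero (regular_rmod R) = zero R"
  "add (regular_rmod R) = add R" "rsmult (regular_rmod R) = mult R"
  by (simp_all add: regular_rmod_def)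

lemma (in abelian_group) minus_eq_zero_iff:
  assumes "x \<in> carrier G" "y \<in> carrier G"
  shows "x \<ominus> y = \<zero> \<longleftrightarrow> x = y"
proof
  assume "x \<ominus> y = \<zero>"
  then have "\<ominus> (\<ominus> y) = x" using assms by (intro minus_equality) (auto simp: minus_eq)
  then show "x = y" using assms by simp
qed (use assms in \<open>simp add: minus_eq r_neg\<close>)

context ring
begin

lemma right_module_regular: "right_module R (regular_rmod R)"
proof (intro right_module.intro ring_axioms right_module_axioms.intro)
  show "abelian_group (regular_rmod R)"
    by (rule abelian_groupI) (auto simp: a_ac intro: l_neg)
qed (auto simp: l_distr r_distr m_assoc)

lemma right_idealI:
  assumes "I \<subseteq> carrier R" "\<zero> \<in> I"
    and "\<And>x y. x \<in> I \<Longrightarrow> y \<in> I \<Longrightarrow> x \<oplus> y \<in> I"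
    and "\<And>x r. x \<in> I \<Longrightarrow> r \<in> carrier R \<Longrightarrow> x \<otimes> r \<in> I"
  shows "right_ideal R I"
  using right_module.rsubmoduleI[OF right_module_regular] assms by simp

lemma right_idealD:
  assumes "right_ideal R I"
  shows "I \<subseteq> carrier R" and "\<zero> \<in> I"
    and "\<And>x y. x \<in> I \<Longrightarrow> y \<in> I \<Longrightarrow> x \<oplus> y \<in> I"
    and "\<And>x r. x \<in> I \<Longrightarrow> r \<in> carrier R \<Longrightarrow> x \<otimes> r \<in> I"
    and "\<And>x. x \<in> I \<Longrightarrow> \<ominus> x \<in> I"
proof -
  interpret rsubmodule R I "regular_rmod R" by fact
  show sub: "I \<subseteq> carrier R" and "\<zero> \<in> I"
    and "\<And>x y. x \<in> I \<Longrightarrow> y \<in> I \<Longrightarrow> x \<oplus> y \<in> I"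
    and cl: "\<And>x r. x \<in> I \<Longrightarrow> r \<in> carrier R \<Longrightarrow> x \<otimes> r \<in> I"
    using a_subset zero_closed a_closed rsmult_sub_closed by simp_all
  show "\<ominus> x \<in> I" if "x \<in> I" for x
    using cl[OF that, of "\<ominus> \<one>"] subsetD[OF sub that] by (simp add: r_minus)
qed

lemma right_ideal_zero: "right_ideal R {\<zero>}"
  by (rule right_idealI) auto

lemma right_ideal_carrier: "right_ideal R (carrier R)"
  by (rule right_idealI) auto

lemma right_ideal_Int:
  assumes I: "right_ideal R I" and J: "right_ideal R J"
  shows "right_ideal R (I \<inter> J)"
proof (rule right_idealI)
  show "I \<inter> J \<subseteq> carrier R" using right_idealD(1)[OF I] by blast
qed (simp_all add: right_idealD(2-4)[OF I] right_idealD(2-4)[OF J])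

lemma right_ideal_sum:
  assumes I: "right_ideal R I" and J: "right_ideal R J"
  shows "right_ideal R (I <+>\<^bsub>R\<^esub> J)"
proof (rule right_idealI)
  note sub = right_idealD(1)[OF I, THEN subsetD] right_idealD(1)[OF J, THEN subsetD]
  show "I <+>\<^bsub>R\<^esub> J \<subseteq> carrier R"
    using sub by (auto simp: set_add_def')
  show "\<zero> \<in> I <+>\<^bsub>R\<^esub> J"
    unfolding set_add_def' using right_idealD(2)[OF I] right_idealD(2)[OF J] r_zero[OF zero_closed]
    by fastforce
  show "x \<otimes> r \<in> I <+>\<^bsub>R\<^esub> J" if x: "x \<in> I <+>\<^bsub>R\<^esub> J" and r: "r \<in> carrier R" for x r
  proof -
    from x obtain a b where ab: "a \<in> I" "b \<in> J" "x = a \<oplus> b" by (auto simp: set_add_def')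
    then have "x \<otimes> r = a \<otimes> r \<oplus> b \<otimes> r" using r sub by (simp add: l_distr)
    with ab r show ?thesis using right_idealD(4)[OF I, of a r] right_idealD(4)[OF J, of b r]
      by (auto simp: set_add_def')
  qed
  show "x \<oplus> y \<in> I <+>\<^bsub>R\<^esub> J" if x: "x \<in> I <+>\<^bsub>R\<^esub> J" and y: "y \<in> I <+>\<^bsub>R\<^esub> J" for x y
  proof -
    from x obtain a b where ab: "a \<in> I" "b \<in> J" "x = a \<oplus> b" by (auto simp: set_add_def')
    from y obtain c d where cd: "c \<in> I" "d \<in> J" "y = c \<oplus> d" by (auto simp: set_add_def')
    have "x \<oplus> y = (a \<oplus> c) \<oplus> (b \<oplus> d)" using ab cd sub by (simp add: a_ac)
    with ab cd show ?thesis using right_idealD(3)[OF I, of a c] right_idealD(3)[OF J, of b d]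
      by (auto simp: set_add_def')
  qed
qed

lemma right_ideal_lmult:
  assumes I: "right_ideal R I" and a: "a \<in> carrier R"
  shows "right_ideal R ((\<lambda>x. a \<otimes> x) ` I)"
proof (rule right_idealI)
  note sub = right_idealD(1)[OF I, THEN subsetD]
  show "(\<lambda>x. a \<otimes> x) ` I \<subseteq> carrier R" using sub a by auto
  show "\<zero> \<in> (\<lambda>x. a \<otimes> x) ` I" 
    using right_idealD(2)[OF I] r_null[OF a] by (metis image_eqI)
  show "x \<oplus> y \<in> (\<lambda>x. a \<otimes> x) ` I" if "x \<in> (\<lambda>x. a \<otimes> x) ` I" "y \<in> (\<lambda>x. a \<otimes> x) ` I" for x y
  proof -
    from that obtain u v where "u \<in> I" "v \<in> I" "x = a \<otimes> u" "y = a \<otimes> v" by auto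
    then show ?thesis using right_idealD(3)[OF I] a sub
      by (intro image_eqI[of _ _ "u \<oplus> v"]) (auto simp: r_distr)
  qed
  show "x \<otimes> r \<in> (\<lambda>x. a \<otimes> x) ` I" if "x \<in> (\<lambda>x. a \<otimes> x) ` I" "r \<in> carrier R" for x r
  proof -
    from that obtain u where "u \<in> I" "x = a \<otimes> u" by auto
    then show ?thesis using right_idealD(4)[OF I] a sub that
      by (intro image_eqI[of _ _ "u \<otimes> r"]) (auto simp: m_assoc)
  qed
qed

lemma right_ideal_preimage:
  assumes I: "right_ideal R I" and a: "a \<in> carrier R"
  shows "right_ideal R {s \<in> carrier R. a \<otimes> s \<in> I}"
proof (rule right_idealI)
  show "x \<otimes> r \<in> {s \<in> carrier R. a \<otimes> s \<in> I}"
    if "x \<in> {s \<in> carrier R. a \<otimes> s \<in> I}" "r \<in> carrier R" for x r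
    using that a right_idealD(4)[OF I, of "a \<otimes> x" r] by (simp add: m_assoc)
qed (use a right_idealD[OF I] in \<open>auto simp: r_distr\<close>)

lemma essential_right_idealD:
  assumes "essential_right_ideal R I" "right_ideal R V" "V \<noteq> {\<zero>}"
  shows "\<exists>v\<in>V. v \<in> I \<and> v \<noteq> \<zero>"
proof -
  have "V \<inter> I \<noteq> {\<zero>}" "right_ideal R I" using assms by (auto simp: essential_sub_def)
  then show ?thesis using right_idealD(2)[of I] right_idealD(2)[OF assms(2)] by blast
qed

lemma essential_right_idealI:
  assumes "right_ideal R I"
    and "\<And>V. right_ideal R V \<Longrightarrow> V \<noteq> {\<zero>} \<Longrightarrow> \<exists>v\<in>V. v \<in> I \<and> v \<noteq> \<zero>"
  shows "essential_right_ideal R I"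
  using assms unfolding essential_sub_def by fastforce

lemma right_ideal_nonzeroD:
  assumes "right_ideal R V" "V \<noteq> {\<zero>}"
  obtains v where "v \<in> V" "v \<noteq> \<zero>"
  using assms right_idealD(2)[OF assms(1)] by blast

text \<open>
  For a right ideal \<open>V\<close> with \<open>aV \<noteq> 0\<close>, essentiality gives a nonzero element \<open>av\<close> of \<open>aV \<inter> I\<close>; if
  \<open>aV = 0\<close>, then all of \<open>V\<close> lies in the preimage.
\<close>

lemma essential_preimage:
  assumes I: "essential_right_ideal R I" and a: "a \<in> carrier R"
  shows "essential_right_ideal R {s \<in> carrier R. a \<otimes> s \<in> I}"
proof (rule essential_right_idealI)
  have rI: "right_ideal R I" using I by (simp add: essential_sub_def)
  then show "right_ideal R {s \<in> carrier R. a \<otimes> s \<in> I}" using a by (rule right_ideal_preimage)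
  fix V assume V: "right_ideal R V" "V \<noteq> {\<zero>}"
  note sub = right_idealD(1)[OF V(1), THEN subsetD]
  show "\<exists>v\<in>V. v \<in> {s \<in> carrier R. a \<otimes> s \<in> I} \<and> v \<noteq> \<zero>"
  proof (cases "(\<lambda>x. a \<otimes> x) ` V = {\<zero>}")
    case True
    obtain v where "v \<in> V" "v \<noteq> \<zero>" using V by (rule right_ideal_nonzeroD)
    moreover have "a \<otimes> v = \<zero>" using True \<open>v \<in> V\<close> by blast
    ultimately show ?thesis using right_idealD(2)[OF rI] sub by (intro bexI[of _ v]) auto
  next
    case False
    show ?thesis
      using essential_right_idealD[OF I right_ideal_lmult[OF V(1) a] False] sub a by auto
  qed
qed

lemma essential_mono:
  "essential_right_ideal R I \<Longrightarrow> I \<subseteq> J \<Longrightarrow> right_ideal R J \<Longrightarrow> essential_right_ideal R J"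
  by (rule essential_right_idealI) (use essential_right_idealD in blast)+

definition right_ann :: "'a \<Rightarrow> 'a set"
  where "right_ann a = {s \<in> carrier R. a \<otimes> s = \<zero>}"

lemma right_ideal_right_ann: "a \<in> carrier R \<Longrightarrow> right_ideal R (right_ann a)"
  using right_ideal_preimage[OF right_ideal_zero] by (simp add: right_ann_def)

end

lemma right_noetherian_maximal:
  assumes noeth: "right_noetherian R" and "right_ideal R I\<^sub>0" "\<Phi> I\<^sub>0"
  shows "\<exists>I. right_ideal R I \<and> \<Phi> I \<and> (\<forall>J. right_ideal R J \<and> \<Phi> J \<and> I \<subseteq> J \<longrightarrow> J = I)"
proof (rule ccontr)
  assume "\<not> ?thesis"
  then have step: "\<exists>J. (right_ideal R J \<and> \<Phi> J) \<and> I \<subset> J" if "right_ideal R I \<and> \<Phi> I" for I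
    using that by (auto simp: psubset_eq)
  have "\<exists>f. \<forall>n::nat. (right_ideal R (f n) \<and> \<Phi> (f n)) \<and> f n \<subset> f (Suc n)"
    by (rule dependent_nat_choice) (use assms(2,3) step in blast)+
  then obtain f :: "nat \<Rightarrow> _"
    where f: "\<And>n. right_ideal R (f n)" "\<And>n. f n \<subset> f (Suc n)"
    by blast
  have "\<exists>n. \<forall>m\<ge>n. f m = f n"
    using noeth f unfolding right_noetherian_def by (simp add: psubset_imp_subset)
  then obtain n where "f (Suc n) = f n" by (meson le_SucI order_refl)
  then show False using f(2)[of n] by auto
qed

section \<open>Regular elements in prime right noetherian rings\<close>

locale prime_right_noetherian_ring = ring +
  assumes noetherian: "right_noetherian R"
    and prime: "a \<in> carrier R \<Longrightarrow> b \<in> carrier R \<Longrightarrow>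
      (\<And>s. s \<in> carrier R \<Longrightarrow> a \<otimes> s \<otimes> b = \<zero>) \<Longrightarrow> a = \<zero> \<or> b = \<zero>"
begin

lemma right_ann_mult_subset:
  "a \<in> carrier R \<Longrightarrow> b \<in> carrier R \<Longrightarrow> right_ann a \<subseteq> right_ann (b \<otimes> a)"
  by (auto simp: right_ann_def m_assoc)

text \<open>
  Multiplication on the left can only enlarge a right annihilator. A maximal one therefore does not
  change as long as the product stays in \<open>S\<close>, and this is how maximality is exploited.
\<close>

lemma exists_maximal_right_ann:
  assumes "a \<in> S" and sub: "S \<subseteq> carrier R"
  shows "\<exists>z\<in>S. \<forall>y\<in>S. right_ann z \<subseteq> right_ann y \<longrightarrow> right_ann y = right_ann z"
proof -
  let ?\<Phi> = "\<lambda>I. \<exists>z\<in>S. I = right_ann z"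
  have ri: "right_ideal R (right_ann y)" if "y \<in> S" for y
    using right_ideal_right_ann sub that by blast
  obtain I where I: "?\<Phi> I" and max: "\<forall>J. right_ideal R J \<and> ?\<Phi> J \<and> I \<subseteq> J \<longrightarrow> J = I"
    using right_noetherian_maximal[OF noetherian ri[OF assms(1)], of ?\<Phi>] assms(1) by blast
  from I obtain z where z: "z \<in> S" "I = right_ann z" by blast
  show ?thesis
  proof (intro bexI[OF _ z(1)] ballI impI)
    fix y assume "y \<in> S" "right_ann z \<subseteq> right_ann y"
    then show "right_ann y = right_ann z"
      using max[rule_format, of "right_ann y"] ri z(2) by blast
  qed
qed

text \<open>
  The elements \<open>y\<close> in question form the right singular ideal. Among its nonzero elements take \<open>z\<close>
  with a maximal annihilator. Each \<open>zsz\<close> lies in it too. The essential right ideal of all \<open>w\<close> with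
  \<open>zsw = 0\<close> contains some \<open>zt \<noteq> 0\<close>, so the annihilator of \<open>zsz\<close> is strictly larger than that of
  \<open>z\<close>, and \<open>zsz = 0\<close> by maximality. Hence \<open>zRz = 0\<close>, against primeness.
\<close>

lemma essential_right_ann_imp_zero:
  assumes y: "y \<in> carrier R" "essential_right_ideal R (right_ann y)"
  shows "y = \<zero>"
proof (rule ccontr)
  assume "y \<noteq> \<zero>"
  define S where "S = {z \<in> carrier R. z \<noteq> \<zero> \<and> essential_right_ideal R (right_ann z)}"
  have "y \<in> S" and "S \<subseteq> carrier R" using y \<open>y \<noteq> \<zero>\<close> by (auto simp: S_def)
  then obtain z where z: "z \<in> S"
    and max: "\<forall>x\<in>S. right_ann z \<subseteq> right_ann x \<longrightarrow> right_ann x = right_ann z"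
    using exists_maximal_right_ann by blast
  have zc: "z \<in> carrier R" "z \<noteq> \<zero>" and ess: "essential_right_ideal R (right_ann z)"
    using z by (auto simp: S_def)
  have "z \<otimes> s \<otimes> z = \<zero>" if s: "s \<in> carrier R" for s
  proof (rule ccontr)
    assume nz: "z \<otimes> s \<otimes> z \<noteq> \<zero>"
    have sub: "right_ann z \<subseteq> right_ann (z \<otimes> s \<otimes> z)"
      using zc s by (intro right_ann_mult_subset) auto
    have "z \<otimes> s \<otimes> z \<in> S"
      using nz zc s essential_mono[OF ess sub right_ideal_right_ann] by (simp add: S_def)
    with max sub have eq: "right_ann (z \<otimes> s \<otimes> z) = right_ann z" by blast
    have ess': "essential_right_ideal R {t \<in> carrier R. s \<otimes> t \<in> right_ann z}"
      by (rule essential_preimage[OF ess s])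
    have "right_ideal R ((\<lambda>x. z \<otimes> x) ` carrier R)"
      by (rule right_ideal_lmult[OF right_ideal_carrier zc(1)])
    moreover have "z \<in> (\<lambda>x. z \<otimes> x) ` carrier R"
      by (rule image_eqI[of _ _ \<one>]) (use zc in auto)
    then have "(\<lambda>x. z \<otimes> x) ` carrier R \<noteq> {\<zero>}" using zc by auto
    ultimately obtain w where w: "w \<in> (\<lambda>x. z \<otimes> x) ` carrier R" "s \<otimes> w \<in> right_ann z" "w \<noteq> \<zero>"
      using essential_right_idealD[OF ess', of "(\<lambda>x. z \<otimes> x) ` carrier R"] by auto
    then obtain t where t: "t \<in> carrier R" "w = z \<otimes> t" by blast
    with w(2) zc s have "t \<in> right_ann (z \<otimes> s \<otimes> z)" by (simp add: right_ann_def m_assoc)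
    with eq w(3) t show False by (simp add: right_ann_def)
  qed
  with prime[of z z] zc show False by blast
qed

text \<open>
  This is the form in which it is used that a nonzero one-sided ideal is not nil. If \<open>z \<in> I\<close> has a
  maximal annihilator among the nonzero elements and \<open>zsz \<noteq> 0\<close>, then \<open>zsz\<close> and \<open>z\<close> have the same
  annihilator, and \<open>a = zs\<close> works.
\<close>

lemma exists_right_ann_square_eq:
  assumes I: "right_ideal R I" "I \<noteq> {\<zero>}"
  obtains a where "a \<in> I" "a \<noteq> \<zero>" "right_ann (a \<otimes> a) = right_ann a"
proof -
  note sub = right_idealD(1)[OF I(1), THEN subsetD]
  obtain x where "x \<in> I - {\<zero>}" using right_ideal_nonzeroD[OF I] by blast
  then obtain z where z: "z \<in> I - {\<zero>}"
    and max: "\<forall>y\<in>I - {\<zero>}. right_ann z \<subseteq> right_ann y \<longrightarrow> right_ann y = right_ann z"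
    using exists_maximal_right_ann[of x "I - {\<zero>}"] right_idealD(1)[OF I(1)] by blast
  have zc: "z \<in> carrier R" "z \<noteq> \<zero>" using z sub by auto
  then obtain s where s: "s \<in> carrier R" "z \<otimes> s \<otimes> z \<noteq> \<zero>" using prime[of z z] by blast
  have "z \<otimes> s \<otimes> z \<in> I - {\<zero>}"
    using s z zc right_idealD(4)[OF I(1), of z "s \<otimes> z"] by (simp add: m_assoc)
  moreover have "right_ann z \<subseteq> right_ann (z \<otimes> s \<otimes> z)"
    using zc s by (intro right_ann_mult_subset) auto
  ultimately have eq: "right_ann (z \<otimes> s \<otimes> z) = right_ann z" using max by blast
  show thesis
  proof
    show "z \<otimes> s \<in> I" using right_idealD(4)[OF I(1)] z s by blast
    show "z \<otimes> s \<noteq> \<zero>" using s zc by auto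
    show "right_ann (z \<otimes> s \<otimes> (z \<otimes> s)) = right_ann (z \<otimes> s)"
    proof
      show "right_ann (z \<otimes> s \<otimes> (z \<otimes> s)) \<subseteq> right_ann (z \<otimes> s)"
      proof
        fix y assume y: "y \<in> right_ann (z \<otimes> s \<otimes> (z \<otimes> s))"
        then have yc: "y \<in> carrier R" by (simp add: right_ann_def)
        then have "s \<otimes> y \<in> right_ann (z \<otimes> s \<otimes> z)"
          using y zc s by (simp add: right_ann_def m_assoc)
        with eq yc zc s show "y \<in> right_ann (z \<otimes> s)" by (simp add: right_ann_def m_assoc)
      qed
    qed (use zc s in \<open>intro right_ann_mult_subset; simp\<close>)
  qed
qed

text \<open>
  If \<open>V \<inter> cR = 0\<close>, then the sum \<open>V + cV + c\<^sup>2V + \<dots>\<close> is direct. Its partial sums arise by iterating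
  \<open>N \<mapsto> V + cN\<close>; since \<open>c\<close> can be cancelled, stationarity at one stage is inherited by the stage
  before, down to \<open>V = 0\<close>.
\<close>

lemma essential_of_right_cancel:
  assumes c: "c \<in> carrier R" "right_ann c = {\<zero>}"
  shows "essential_right_ideal R ((\<lambda>x. c \<otimes> x) ` carrier R)"
proof (rule essential_right_idealI)
  show "right_ideal R ((\<lambda>x. c \<otimes> x) ` carrier R)"
    by (rule right_ideal_lmult[OF right_ideal_carrier c(1)])
  fix V assume V: "right_ideal R V" "V \<noteq> {\<zero>}"
  note sub = right_idealD(1)[OF V(1), THEN subsetD]
  have cancel: "x = y" if "x \<in> carrier R" "y \<in> carrier R" "c \<otimes> x = c \<otimes> y" for x y
  proof -
    have "c \<otimes> (x \<ominus> y) = \<zero>" using that c(1) by (simp add: minus_eq r_distr r_minus r_neg)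
    then have "x \<ominus> y \<in> right_ann c" using that by (simp add: right_ann_def)
    with that c(2) show ?thesis by (simp add: minus_eq_zero_iff)
  qed
  define N where "N = rec_nat {\<zero>} (\<lambda>_ K. V <+>\<^bsub>R\<^esub> (\<lambda>x. c \<otimes> x) ` K)"
  have N0: "N 0 = {\<zero>}" and NS: "\<And>n. N (Suc n) = V <+>\<^bsub>R\<^esub> (\<lambda>x. c \<otimes> x) ` N n"
    by (simp_all add: N_def)
  have ri: "right_ideal R (N n)" for n
    by (induction n) (simp_all add: N0 NS right_ideal_zero right_ideal_sum right_ideal_lmult V c)
  have mono: "N n \<subseteq> N (Suc n)" for n
  proof (induction n)
    case 0
    then show ?case using right_idealD(2)[OF ri[of 1]] by (simp add: N0)
  next
    case (Suc n)
    then have "V <+>\<^bsub>R\<^esub> (\<lambda>x. c \<otimes> x) ` N n \<subseteq> V <+>\<^bsub>R\<^esub> (\<lambda>x. c \<otimes> x) ` N (Suc n)"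
      unfolding set_add_def' by blast
    then show ?case by (simp only: NS[symmetric])
  qed
  show "\<exists>v\<in>V. v \<in> (\<lambda>x. c \<otimes> x) ` carrier R \<and> v \<noteq> \<zero>"
  proof (rule ccontr)
    assume "\<not> ?thesis"
    then have indep: "v = \<zero>" if "v \<in> V" "v = c \<otimes> x" "x \<in> carrier R" for v x
      using that by blast
    have descend: "N (Suc n) \<subseteq> N n" if le: "N (Suc (Suc n)) \<subseteq> N (Suc n)" for n
    proof
      fix x assume x: "x \<in> N (Suc n)"
      have xc: "x \<in> carrier R" using x right_idealD(1)[OF ri] by blast
      have "\<zero> \<oplus> c \<otimes> x \<in> N (Suc (Suc n))"
        unfolding NS[of "Suc n"] set_add_def' using x right_idealD(2)[OF V(1)] by blast
      then have "c \<otimes> x \<in> N (Suc (Suc n))" using c xc by simp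
      with le have "c \<otimes> x \<in> V <+>\<^bsub>R\<^esub> (\<lambda>x. c \<otimes> x) ` N n" by (auto simp: NS)
      then obtain v y where vy: "v \<in> V" "y \<in> N n" "c \<otimes> x = v \<oplus> c \<otimes> y" by (auto simp: set_add_def')
      have yc: "y \<in> carrier R" "v \<in> carrier R" 
        using subsetD[OF right_idealD(1)[OF ri] vy(2)] sub[OF vy(1)] by simp_all
      have "v = c \<otimes> x \<ominus> c \<otimes> y" 
        unfolding vy(3) using yc c(1) by (simp add: minus_eq a_assoc r_neg)
      also have "\<dots> = c \<otimes> (x \<ominus> y)" using xc yc c(1) by (simp add: minus_eq r_distr r_minus)
      finally have "v = \<zero>" by (rule indep[OF vy(1)]) (use xc yc in simp)
      then have "c \<otimes> x = c \<otimes> y" using vy(3) yc c(1) by simp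
      then have "x = y" by (rule cancel[OF xc yc(1)])
      with vy(2) show "x \<in> N n" by simp
    qed
    have "\<exists>n. \<forall>m\<ge>n. N m = N n"
      using noetherian ri mono unfolding right_noetherian_def by blast
    then obtain n where n: "N (Suc n) \<subseteq> N n" by (metis le_SucI order_refl)
    have "N 1 \<subseteq> N 0" using n by (induction n) (simp_all add: descend)
    moreover have "V \<subseteq> N 1"
    proof
      fix v assume "v \<in> V"
      then show "v \<in> N 1" using c sub by (simp add: NS N0 set_add_def')
    qed
    ultimately have "V \<subseteq> {\<zero>}" by (simp add: N0)
    then show False using V right_ideal_nonzeroD by blast
  qed
qed

text \<open>
  Regularity on the other side comes for free: if \<open>sc = 0\<close>, then \<open>s\<close> kills the essential right
  ideal \<open>cR\<close>.
\<close>

lemma regular_elem_iff_right_ann: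
  "regular_elem R c \<longleftrightarrow> c \<in> carrier R \<and> right_ann c = {\<zero>}"
proof
  assume "regular_elem R c"
  then show "c \<in> carrier R \<and> right_ann c = {\<zero>}"
    by (auto simp: regular_elem_def right_ann_def)
next
  assume c: "c \<in> carrier R \<and> right_ann c = {\<zero>}"
  have "s = \<zero>" if s: "s \<in> carrier R" "s \<otimes> c = \<zero>" for s
  proof -
    have "s \<otimes> (c \<otimes> x) = \<zero>" if "x \<in> carrier R" for x
      using c s that m_assoc[of s c x] by simp
    then have "(\<lambda>x. c \<otimes> x) ` carrier R \<subseteq> right_ann s"
      using c by (auto simp: right_ann_def)
    then show ?thesis
      using essential_right_ann_imp_zero[OF s(1)] essential_of_right_cancel c s(1)
        essential_mono right_ideal_right_ann by blast
  qed
  then show "regular_elem R c"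
    using c by (auto simp: regular_elem_def right_ann_def)
qed

text \<open>
  One half of Goldie's theorem. Elements \<open>c\<close> of \<open>L\<close> whose annihilator agrees with that of \<open>c\<^sup>2\<close> are
  improved step by step: as long as \<open>ann(c) \<noteq> 0\<close>, pick \<open>a \<noteq> 0\<close> of the same kind in \<open>L \<inter> ann(c)\<close>.
  Then \<open>ca = 0\<close>, so that \<open>c + a\<close> is again of this kind and has annihilator \<open>ann(c) \<inter> ann(a)\<close>. The
  process ends because a right ideal \<open>N\<close> independent of \<open>ann(c)\<close> can be enlarged to \<open>N + aR\<close>, which
  is independent of \<open>ann(c + a)\<close>.
\<close>

theorem essential_contains_regular:
  assumes L: "essential_right_ideal R L"
  obtains c where "c \<in> L" "regular_elem R c"
proof -
  have rL: "right_ideal R L" using L by (simp add: essential_sub_def)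
  note Lsub = right_idealD(1)[OF rL, THEN subsetD]
  define \<Phi> where "\<Phi> N \<longleftrightarrow> (\<exists>c\<in>L. right_ann (c \<otimes> c) = right_ann c \<and> right_ann c \<inter> N = {\<zero>})" for N
  have "\<Phi> {\<zero>}"
    unfolding \<Phi>_def using right_idealD(2)[OF rL] by (intro bexI[of _ \<zero>]) (auto simp: right_ann_def)
  then obtain N where N: "right_ideal R N" "\<Phi> N"
    and max: "\<forall>J. right_ideal R J \<and> \<Phi> J \<and> N \<subseteq> J \<longrightarrow> J = N"
    using right_noetherian_maximal[OF noetherian right_ideal_zero, of \<Phi>] by blast
  note Nsub = right_idealD(1)[OF N(1), THEN subsetD]
  from N(2) obtain c where c: "c \<in> L" "right_ann (c \<otimes> c) = right_ann c" "right_ann c \<inter> N = {\<zero>}"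
    by (auto simp: \<Phi>_def)
  have cc: "c \<in> carrier R" using c(1) Lsub by simp
  have csq: "c \<otimes> y = \<zero>" if "y \<in> carrier R" "c \<otimes> (c \<otimes> y) = \<zero>" for y
  proof -
    have "y \<in> right_ann (c \<otimes> c)" using that cc by (simp add: right_ann_def m_assoc)
    then show ?thesis unfolding c(2) by (simp add: right_ann_def)
  qed
  have "right_ann c = {\<zero>}"
  proof (rule ccontr)
    assume nz: "right_ann c \<noteq> {\<zero>}"
    have "right_ann c \<inter> L \<noteq> {\<zero>}"
      using L right_ideal_right_ann[OF cc] nz by (simp add: essential_sub_def)
    then obtain a where a: "a \<in> right_ann c" "a \<in> L" "a \<noteq> \<zero>" "right_ann (a \<otimes> a) = right_ann a"
      using exists_right_ann_square_eq[OF right_ideal_Int[OF right_ideal_right_ann[OF cc] rL]] by blast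
    have ac: "a \<in> carrier R" "c \<otimes> a = \<zero>" using a(1) by (auto simp: right_ann_def)
    have asq: "a \<otimes> y = \<zero>" if "y \<in> carrier R" "a \<otimes> (a \<otimes> y) = \<zero>" for y
    proof -
      have "y \<in> right_ann (a \<otimes> a)" using that ac by (simp add: right_ann_def m_assoc)
      then show ?thesis unfolding a(4) by (simp add: right_ann_def)
    qed
    have caz: "c \<otimes> (a \<otimes> y) = \<zero>" if "y \<in> carrier R" for y
      using that ac cc by (simp add: m_assoc[symmetric])
    have ann: "right_ann (c \<oplus> a) = right_ann c \<inter> right_ann a"
    proof
      show "right_ann (c \<oplus> a) \<subseteq> right_ann c \<inter> right_ann a"
      proof
        fix y assume "y \<in> right_ann (c \<oplus> a)"
        then have y: "y \<in> carrier R" "c \<otimes> y \<oplus> a \<otimes> y = \<zero>"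
          using cc ac by (auto simp: right_ann_def l_distr)
        have "c \<otimes> (c \<otimes> y) = c \<otimes> (c \<otimes> y \<oplus> a \<otimes> y)" using y(1) cc ac caz by (simp add: r_distr)
        also have "\<dots> = \<zero>" using y cc by simp
        finally have "c \<otimes> y = \<zero>" by (rule csq[OF y(1)])
        with y cc ac show "y \<in> right_ann c \<inter> right_ann a" by (simp add: right_ann_def)
      qed
    qed (use cc ac in \<open>auto simp: right_ann_def l_distr\<close>)
    have sq: "right_ann ((c \<oplus> a) \<otimes> (c \<oplus> a)) = right_ann (c \<oplus> a)"
    proof
      show "right_ann ((c \<oplus> a) \<otimes> (c \<oplus> a)) \<subseteq> right_ann (c \<oplus> a)"
      proof
        fix y assume y: "y \<in> right_ann ((c \<oplus> a) \<otimes> (c \<oplus> a))"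
        then have yc: "y \<in> carrier R" by (simp add: right_ann_def)
        have "(c \<oplus> a) \<otimes> y \<in> right_ann (c \<oplus> a)"
          using y yc cc ac by (simp add: right_ann_def m_assoc)
        then have 1: "c \<otimes> ((c \<oplus> a) \<otimes> y) = \<zero>" and 2: "a \<otimes> ((c \<oplus> a) \<otimes> y) = \<zero>"
          unfolding ann by (auto simp: right_ann_def)
        have "c \<otimes> (c \<otimes> y) = \<zero>" using 1 yc cc ac caz by (simp add: l_distr r_distr)
        then have cy: "c \<otimes> y = \<zero>" by (rule csq[OF yc])
        with 2 yc cc ac have "a \<otimes> (a \<otimes> y) = \<zero>" by (simp add: l_distr)
        then have "a \<otimes> y = \<zero>" by (rule asq[OF yc])
        with cy yc show "y \<in> right_ann (c \<oplus> a)" unfolding ann by (simp add: right_ann_def)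
      qed
    qed (use cc ac in \<open>intro right_ann_mult_subset; simp\<close>)
    let ?J = "N <+>\<^bsub>R\<^esub> (\<lambda>x. a \<otimes> x) ` carrier R"
    have J: "right_ideal R ?J"
      by (intro right_ideal_sum N(1) right_ideal_lmult right_ideal_carrier ac)
    have "right_ann (c \<oplus> a) \<inter> ?J \<subseteq> {\<zero>}"
    proof
      fix x assume x: "x \<in> right_ann (c \<oplus> a) \<inter> ?J"
      then obtain n y where ny: "n \<in> N" "y \<in> carrier R" "x = n \<oplus> a \<otimes> y" by (auto simp: set_add_def')
      have nc: "n \<in> carrier R" using ny Nsub by simp
      have "c \<otimes> x = \<zero>" "a \<otimes> x = \<zero>" using x unfolding ann by (auto simp: right_ann_def)
      then have "c \<otimes> n = \<zero>" using ny nc cc ac caz by (simp add: r_distr)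
      then have n0: "n = \<zero>" using c(3) ny nc by (auto simp: right_ann_def)
      then have "a \<otimes> (a \<otimes> y) = \<zero>" using \<open>a \<otimes> x = \<zero>\<close> ny ac by simp
      then have "a \<otimes> y = \<zero>" using asq ny by blast
      then show "x \<in> {\<zero>}" using ny n0 by simp
    qed
    moreover have "\<zero> \<in> right_ann (c \<oplus> a) \<inter> ?J"
      using right_idealD(2)[OF J] cc ac by (simp add: right_ann_def)
    ultimately have "\<Phi> ?J"
      unfolding \<Phi>_def using right_idealD(3)[OF rL c(1) a(2)] sq by (intro bexI[of _ "c \<oplus> a"]) auto
    moreover have "N \<subseteq> ?J"
    proof
      fix n assume n: "n \<in> N"
      have "a \<otimes> \<zero> \<in> (\<lambda>x. a \<otimes> x) ` carrier R" by blast
      moreover have "n \<oplus> a \<otimes> \<zero> = n" using n Nsub ac by simp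
      ultimately show "n \<in> ?J" unfolding set_add_def' using n by force
    qed
    ultimately have "?J = N" using max J by blast
    moreover have "\<zero> \<oplus> a \<otimes> \<one> \<in> ?J"
      unfolding set_add_def' using right_idealD(2)[OF N(1)] by blast
    then have "a \<in> ?J" using ac by simp
    ultimately have "a \<in> right_ann c \<inter> N" using a(1) by simp
    with c(3) a(3) show False by simp
  qed
  with cc have "regular_elem R c" by (simp add: regular_elem_iff_right_ann)
  with c(1) that show thesis by blast
qed

text \<open>
  \<open>L\<close> is not essential, so some \<open>V \<noteq> 0\<close> has \<open>V \<inter> L = 0\<close>, and primeness gives \<open>v \<in> V\<close> with
  \<open>vU \<noteq> 0\<close>. If \<open>u \<mapsto> vu\<close> had a nonzero kernel, then this kernel would be essential in the uniform
  \<open>U\<close>, and the elements of \<open>vU\<close> would be singular, hence zero. So \<open>vU\<close> is a copy of \<open>U\<close> inside \<open>V\<close>.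
\<close>

lemma uniform_right_ideal_translate:
  assumes L: "right_ideal R L" "\<And>c. c \<in> L \<Longrightarrow> \<not> regular_elem R c"
    and U: "right_ideal R U" "U \<noteq> {\<zero>}"
    and uniform: "\<And>I J. right_ideal R I \<Longrightarrow> right_ideal R J \<Longrightarrow> I \<subseteq> U \<Longrightarrow> J \<subseteq> U \<Longrightarrow>
      I \<noteq> {\<zero>} \<Longrightarrow> J \<noteq> {\<zero>} \<Longrightarrow> I \<inter> J \<noteq> {\<zero>}"
  obtains v where "v \<in> carrier R" "\<And>u. u \<in> U \<Longrightarrow> v \<otimes> u \<in> L \<Longrightarrow> u = \<zero>"
proof -
  note Usub = right_idealD(1)[OF U(1), THEN subsetD]
  have "\<not> essential_right_ideal R L" using essential_contains_regular L(2) by blast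
  then obtain V where V: "right_ideal R V" "V \<noteq> {\<zero>}" and VL: "\<And>v. v \<in> V \<Longrightarrow> v \<in> L \<Longrightarrow> v = \<zero>"
    using essential_right_idealI[OF L(1)] by blast
  note Vsub = right_idealD(1)[OF V(1), THEN subsetD]
  obtain v\<^sub>0 where v0: "v\<^sub>0 \<in> V" "v\<^sub>0 \<noteq> \<zero>" using V by (rule right_ideal_nonzeroD)
  obtain u\<^sub>0 where u0: "u\<^sub>0 \<in> U" "u\<^sub>0 \<noteq> \<zero>" using U by (rule right_ideal_nonzeroD)
  obtain s where s: "s \<in> carrier R" "v\<^sub>0 \<otimes> s \<otimes> u\<^sub>0 \<noteq> \<zero>"
    using prime[of "v\<^sub>0" "u\<^sub>0"] v0 u0 Vsub Usub by blast
  define v where "v = v\<^sub>0 \<otimes> s"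
  have v: "v \<in> V" "v \<otimes> u\<^sub>0 \<noteq> \<zero>" using s v0 right_idealD(4)[OF V(1)] by (auto simp: v_def)
  have vc: "v \<in> carrier R" using v Vsub by simp
  define K where "K = U \<inter> right_ann v"
  have K: "right_ideal R K"
    unfolding K_def by (intro right_ideal_Int U(1) right_ideal_right_ann vc)
  have "K = {\<zero>}"
  proof (rule ccontr)
    assume nz: "K \<noteq> {\<zero>}"
    have u0c: "u\<^sub>0 \<in> carrier R" using u0 Usub by simp
    have "essential_right_ideal R (right_ann (v \<otimes> u\<^sub>0))"
    proof (rule essential_right_idealI)
      show "right_ideal R (right_ann (v \<otimes> u\<^sub>0))" using vc u0c by (simp add: right_ideal_right_ann)
      fix W assume W: "right_ideal R W" "W \<noteq> {\<zero>}"
      note Wsub = right_idealD(1)[OF W(1), THEN subsetD]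
      let ?X = "(\<lambda>x. u\<^sub>0 \<otimes> x) ` W"
      have X: "right_ideal R ?X" "?X \<subseteq> U"
        using right_ideal_lmult[OF W(1) u0c] right_idealD(4)[OF U(1) u0(1)] Wsub by auto
      have KU: "K \<subseteq> U" by (auto simp: K_def)
      show "\<exists>w\<in>W. w \<in> right_ann (v \<otimes> u\<^sub>0) \<and> w \<noteq> \<zero>"
      proof (cases "?X = {\<zero>}")
        case True
        obtain w where w: "w \<in> W" "w \<noteq> \<zero>" using W by (rule right_ideal_nonzeroD)
        then have "u\<^sub>0 \<otimes> w = \<zero>" using True by blast
        with w Wsub vc u0c show ?thesis
          by (intro bexI[of _ w]) (auto simp: right_ann_def m_assoc)
      next
        case False
        have "?X \<inter> K \<noteq> {\<zero>}" by (rule uniform[OF X(1) K X(2) KU False nz])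
        moreover have "\<zero> \<in> ?X \<inter> K" using right_idealD(2)[OF X(1)] right_idealD(2)[OF K] by simp
        ultimately obtain w where w: "w \<in> W" "u\<^sub>0 \<otimes> w \<in> K" "u\<^sub>0 \<otimes> w \<noteq> \<zero>" by blast
        with Wsub vc u0c show ?thesis
          by (intro bexI[of _ w]) (auto simp: K_def right_ann_def m_assoc)
      qed
    qed
    then show False using essential_right_ann_imp_zero vc u0c v by simp
  qed
  show thesis
  proof (rule that[OF vc])
    fix u assume u: "u \<in> U" "v \<otimes> u \<in> L"
    then have "v \<otimes> u = \<zero>" using VL right_idealD(4)[OF V(1) v(1)] Usub by blast
    then have "u \<in> K" using u Usub by (simp add: K_def right_ann_def)
    with \<open>K = {\<zero>}\<close> show "u = \<zero>" by simp
  qed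
qed

end

section \<open>Quotient modules\<close>

lemma (in abelian_subgroup) rcos_eq_iff:
  assumes "x \<in> carrier G" "y \<in> carrier G"
  shows "H +> x = H +> y \<longleftrightarrow> x \<ominus> y \<in> H"
proof -
  have "H +> x = H +> y \<longleftrightarrow> x \<in> H +> y"
    using a_repr_independence' a_repr_independenceD assms by metis
  then show ?thesis using a_rcos_module[OF assms(2,1)] by (simp add: minus_eq)
qed

lemma (in abelian_subgroup) rcos_eq_self_iff: "x \<in> carrier G \<Longrightarrow> H +> x = H \<longleftrightarrow> x \<in> H"
  using a_coset_join1[OF _ _ a_subgroup] a_rcos_const by blast

lemma (in abelian_subgroup) rcos_add_absorb:
  "h \<in> H \<Longrightarrow> x \<in> carrier G \<Longrightarrow> H +> (h \<oplus> x) = H +> x"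
  using a_repr_independence'[of "h \<oplus> x" x] a_rcosI[of h H x] a_subset by simp

lemma quot_rmod_simps [simp]:
  "carrier (quot_rmod M N) = a_rcosets\<^bsub>M\<^esub> N" "zero (quot_rmod M N) = N"
  "add (quot_rmod M N) = set_add M"
  by (simp_all add: quot_rmod_def)

lemma abelian_group_quot_rmod:
  fixes G (structure)
  assumes "abelian_subgroup H G"
  shows "abelian_group (quot_rmod G H)"
proof -
  interpret abelian_subgroup H G by fact
  show ?thesis
  proof (rule abelian_groupI)
    fix X assume "X \<in> carrier (quot_rmod G H)"
    then obtain x where x: "x \<in> carrier G" "X = H +> x" by (auto simp: A_RCOSETS_def')
    then show "\<exists>Y\<in>carrier (quot_rmod G H). Y \<oplus>\<^bsub>quot_rmod G H\<^esub> X = \<zero>\<^bsub>quot_rmod G H\<^esub>"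
      by (intro bexI[of _ "H +> (\<ominus> x)"])
        (auto simp: a_rcos_sum l_neg A_RCOSETS_def' a_rcos_const)
  next
    fix X assume "X \<in> carrier (quot_rmod G H)"
    then show "\<zero>\<^bsub>quot_rmod G H\<^esub> \<oplus>\<^bsub>quot_rmod G H\<^esub> X = X" by (simp add: rcosets_add_eq)
  qed (auto simp: A_RCOSETS_def' a_rcos_sum a_ac a_rcos_const intro: bexI[of _ "\<zero>"])
qed

lemma rsmult_quot_rmod:
  assumes N: "abelian_subgroup N M" and x: "x \<in> carrier M" "x \<star>\<^bsub>M\<^esub> r \<in> carrier M"
    and stable: "\<And>y. y \<in> N \<Longrightarrow> y \<star>\<^bsub>M\<^esub> r \<in> N"
    and distr: "\<And>y. y \<in> N \<Longrightarrow> (y \<oplus>\<^bsub>M\<^esub> x) \<star>\<^bsub>M\<^esub> r = y \<star>\<^bsub>M\<^esub> r \<oplus>\<^bsub>M\<^esub> x \<star>\<^bsub>M\<^esub> r"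
  shows "(N +>\<^bsub>M\<^esub> x) \<star>\<^bsub>quot_rmod M N\<^esub> r = N +>\<^bsub>M\<^esub> (x \<star>\<^bsub>M\<^esub> r)"
proof -
  interpret abelian_subgroup N M by fact
  have "N +>\<^bsub>M\<^esub> (z \<star>\<^bsub>M\<^esub> r) = N +>\<^bsub>M\<^esub> (x \<star>\<^bsub>M\<^esub> r)" if "z \<in> N +>\<^bsub>M\<^esub> x" for z
  proof -
    from that obtain y where y: "y \<in> N" "z = y \<oplus>\<^bsub>M\<^esub> x" by (auto simp: a_r_coset_def')
    then show ?thesis using distr stable x by (simp add: rcos_add_absorb)
  qed
  moreover have "x \<in> N +>\<^bsub>M\<^esub> x" using a_rcos_self x by simp
  ultimately have "(\<Union>z\<in>N +>\<^bsub>M\<^esub> x. N +>\<^bsub>M\<^esub> (z \<star>\<^bsub>M\<^esub> r)) = N +>\<^bsub>M\<^esub> (x \<star>\<^bsub>M\<^esub> r)" by blast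
  then show ?thesis by (simp add: quot_rmod_def)
qed

text \<open>The action on \<open>M\<close> only has to be additive in the scalar up to \<open>N\<close>. This is what happens for
  \<open>Ext\<close>: on homomorphisms defined on the syzygy the ring does not act additively.\<close>

lemma right_module_quot_rmod:
  assumes S: "ring S" and N: "abelian_subgroup N M"
    and closed: "\<And>x s. x \<in> carrier M \<Longrightarrow> s \<in> carrier S \<Longrightarrow> x \<star>\<^bsub>M\<^esub> s \<in> carrier M"
    and stable: "\<And>x s. x \<in> N \<Longrightarrow> s \<in> carrier S \<Longrightarrow> x \<star>\<^bsub>M\<^esub> s \<in> N"
    and l_distr: "\<And>x y s. x \<in> carrier M \<Longrightarrow> y \<in> carrier M \<Longrightarrow> s \<in> carrier S \<Longrightarrow>
      (x \<oplus>\<^bsub>M\<^esub> y) \<star>\<^bsub>M\<^esub> s = x \<star>\<^bsub>M\<^esub> s \<oplus>\<^bsub>M\<^esub> y \<star>\<^bsub>M\<^esub> s"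
    and r_distr: "\<And>x s t. x \<in> carrier M \<Longrightarrow> s \<in> carrier S \<Longrightarrow> t \<in> carrier S \<Longrightarrow>
      \<exists>n\<in>N. x \<star>\<^bsub>M\<^esub> (s \<oplus>\<^bsub>S\<^esub> t) = n \<oplus>\<^bsub>M\<^esub> (x \<star>\<^bsub>M\<^esub> s \<oplus>\<^bsub>M\<^esub> x \<star>\<^bsub>M\<^esub> t)"
    and assoc: "\<And>x s t. x \<in> carrier M \<Longrightarrow> s \<in> carrier S \<Longrightarrow> t \<in> carrier S \<Longrightarrow>
      x \<star>\<^bsub>M\<^esub> (s \<otimes>\<^bsub>S\<^esub> t) = (x \<star>\<^bsub>M\<^esub> s) \<star>\<^bsub>M\<^esub> t"
    and one: "\<And>x. x \<in> carrier M \<Longrightarrow> x \<star>\<^bsub>M\<^esub> \<one>\<^bsub>S\<^esub> = x"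
  shows "right_module S (quot_rmod M N)"
proof -
  interpret S: ring S by fact
  interpret abelian_subgroup N M by fact
  have act: "(N +>\<^bsub>M\<^esub> x) \<star>\<^bsub>quot_rmod M N\<^esub> s = N +>\<^bsub>M\<^esub> (x \<star>\<^bsub>M\<^esub> s)"
    if "x \<in> carrier M" "s \<in> carrier S" for x s
    by (rule rsmult_quot_rmod[OF N]) (use that closed stable l_distr in auto)
  have rep: "\<exists>x\<in>carrier M. X = N +>\<^bsub>M\<^esub> x" if "X \<in> carrier (quot_rmod M N)" for X
    using that by (auto simp: A_RCOSETS_def')
  show ?thesis
  proof (intro right_module.intro S right_module_axioms.intro abelian_group_quot_rmod N)
    fix X s assume X: "X \<in> carrier (quot_rmod M N)" and s: "s \<in> carrier S"
    obtain x where x: "x \<in> carrier M" "X = N +>\<^bsub>M\<^esub> x" using rep[OF X] by blast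
    show "X \<star>\<^bsub>quot_rmod M N\<^esub> s \<in> carrier (quot_rmod M N)"
      using x s closed by (simp add: act a_rcosetsI[OF a_subset])
    show "(X \<oplus>\<^bsub>quot_rmod M N\<^esub> Y) \<star>\<^bsub>quot_rmod M N\<^esub> s =
      X \<star>\<^bsub>quot_rmod M N\<^esub> s \<oplus>\<^bsub>quot_rmod M N\<^esub> Y \<star>\<^bsub>quot_rmod M N\<^esub> s"
      if Y: "Y \<in> carrier (quot_rmod M N)" for Y
    proof -
      obtain y where y: "y \<in> carrier M" "Y = N +>\<^bsub>M\<^esub> y" using rep[OF Y] by blast
      then show ?thesis using x s closed by (simp add: act a_rcos_sum l_distr)
    qed
    show "X \<star>\<^bsub>quot_rmod M N\<^esub> (s \<oplus>\<^bsub>S\<^esub> t) =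
      X \<star>\<^bsub>quot_rmod M N\<^esub> s \<oplus>\<^bsub>quot_rmod M N\<^esub> X \<star>\<^bsub>quot_rmod M N\<^esub> t"
      if t: "t \<in> carrier S" for t
    proof -
      obtain n where n: "n \<in> N" "x \<star>\<^bsub>M\<^esub> (s \<oplus>\<^bsub>S\<^esub> t) = n \<oplus>\<^bsub>M\<^esub> (x \<star>\<^bsub>M\<^esub> s \<oplus>\<^bsub>M\<^esub> x \<star>\<^bsub>M\<^esub> t)"
        using r_distr[OF x(1) s t] by blast
      then show ?thesis using x s t closed by (simp add: act a_rcos_sum rcos_add_absorb)
    qed
    show "X \<star>\<^bsub>quot_rmod M N\<^esub> (s \<otimes>\<^bsub>S\<^esub> t) = X \<star>\<^bsub>quot_rmod M N\<^esub> s \<star>\<^bsub>quot_rmod M N\<^esub> t"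
      if t: "t \<in> carrier S" for t
      using x s t closed by (simp add: act assoc)
  next
    fix X assume X: "X \<in> carrier (quot_rmod M N)"
    obtain x where x: "x \<in> carrier M" "X = N +>\<^bsub>M\<^esub> x" using rep[OF X] by blast
    show "X \<star>\<^bsub>quot_rmod M N\<^esub> \<one>\<^bsub>S\<^esub> = X" using x by (simp add: act one)
  qed
qed

section \<open>Homomorphisms and linear combinations\<close>

lemma rmod_homI:
  assumes M: "right_module R M"
    and "\<And>x. x \<in> carrier M \<Longrightarrow> f x \<in> carrier N"
    and "\<And>x y. x \<in> carrier M \<Longrightarrow> y \<in> carrier M \<Longrightarrow> f (x \<oplus>\<^bsub>M\<^esub> y) = f x \<oplus>\<^bsub>N\<^esub> f y"
    and "\<And>x r. x \<in> carrier M \<Longrightarrow> r \<in> carrier R \<Longrightarrow> f (x \<star>\<^bsub>M\<^esub> r) = f x \<star>\<^bsub>N\<^esub> r"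
  shows "restrict f (carrier M) \<in> rmod_hom R M N"
proof -
  interpret right_module R M by fact
  show ?thesis using assms(2-4) by (auto simp: rmod_hom_def rsmult_closed)
qed

lemma rmod_homD:
  assumes "f \<in> rmod_hom R M N"
  shows "\<And>x. x \<in> carrier M \<Longrightarrow> f x \<in> carrier N"
    and "\<And>x y. x \<in> carrier M \<Longrightarrow> y \<in> carrier M \<Longrightarrow> f (x \<oplus>\<^bsub>M\<^esub> y) = f x \<oplus>\<^bsub>N\<^esub> f y"
    and "\<And>x r. x \<in> carrier M \<Longrightarrow> r \<in> carrier R \<Longrightarrow> f (x \<star>\<^bsub>M\<^esub> r) = f x \<star>\<^bsub>N\<^esub> r"
    and "restrict f (carrier M) = f"
  using assms by (auto simp: rmod_hom_def PiE_restrict)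

lemma hom_rmod_simps [simp]:
  "carrier (hom_rmod R act K M) = rmod_hom R K M"
  "zero (hom_rmod R act K M) = (\<lambda>x\<in>carrier K. \<zero>\<^bsub>M\<^esub>)"
  "add (hom_rmod R act K M) = (\<lambda>f g. \<lambda>x\<in>carrier K. f x \<oplus>\<^bsub>M\<^esub> g x)"
  "rsmult (hom_rmod R act K M) = (\<lambda>f s. \<lambda>x\<in>carrier K. f (act s x))"
  by (simp_all add: hom_rmod_def)

lemma abelian_group_hom_rmod:
  assumes K: "right_module R K" and M: "right_module R M"
  shows "abelian_group (hom_rmod R act K M)"
proof -
  interpret K: right_module R K by fact
  interpret M: right_module R M by fact
  have eqI: "f = g" if "f \<in> rmod_hom R K M" "g \<in> rmod_hom R K M" "\<And>x. x \<in> carrier K \<Longrightarrow> f x = g x" for f g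
    using that by (intro extensionalityI[of _ "carrier K"]) (auto simp: rmod_hom_def PiE_def)
  have sum: "(\<lambda>x\<in>carrier K. f x \<oplus>\<^bsub>M\<^esub> g x) \<in> rmod_hom R K M"
    if "f \<in> rmod_hom R K M" "g \<in> rmod_hom R K M" for f g
    by (rule rmod_homI[OF K]) (simp_all add: rmod_homD[OF that(1)] rmod_homD[OF that(2)] M.M.a_ac M.rsmult_l_distr)
  have zero: "(\<lambda>x\<in>carrier K. \<zero>\<^bsub>M\<^esub>) \<in> rmod_hom R K M"
    by (rule rmod_homI[OF K]) (simp_all add: M.zero_rsmult)
  have neg: "(\<lambda>x\<in>carrier K. f x \<star>\<^bsub>M\<^esub> (\<ominus>\<^bsub>R\<^esub> \<one>\<^bsub>R\<^esub>)) \<in> rmod_hom R K M" if "f \<in> rmod_hom R K M" for f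
    by (rule rmod_homI[OF K]) (simp_all add: rmod_homD[OF that] M.rsmult_l_distr M.rsmult_closed
      M.rsmult_assoc[symmetric] K.R.l_minus K.R.r_minus)
  show ?thesis
  proof (rule abelian_groupI)
    fix f assume f: "f \<in> carrier (hom_rmod R act K M)"
    then show "\<exists>g\<in>carrier (hom_rmod R act K M). g \<oplus>\<^bsub>hom_rmod R act K M\<^esub> f = \<zero>\<^bsub>hom_rmod R act K M\<^esub>"
      using neg[of f] by (intro bexI[of _ "\<lambda>x\<in>carrier K. f x \<star>\<^bsub>M\<^esub> (\<ominus>\<^bsub>R\<^esub> \<one>\<^bsub>R\<^esub>)"])
       (auto simp: fun_eq_iff M.rsmult_minus_one rmod_homD(1)[of f R K M] M.M.l_neg)
    show "\<zero>\<^bsub>hom_rmod R act K M\<^esub> \<oplus>\<^bsub>hom_rmod R act K M\<^esub> f = f"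
      using f sum[OF zero, of f] by (auto intro!: eqI simp: rmod_homD(1)[of f R K M])
  qed (auto simp: sum zero fun_eq_iff rmod_homD(1)[of _ R K M] M.M.a_ac)
qed

text \<open>
  The homomorphism from the free module which sends the basis element at \<open>x\<close> to \<open>y x\<close>. It covers
  \<open>free_eval\<close> and, one coordinate at a time, \<open>free_map\<close>.
\<close>

definition lin_comb ::
  "('a, 'm) ring_scheme \<Rightarrow> ('a, 'd, 'e) rmodule_scheme \<Rightarrow> ('b \<Rightarrow> 'd) \<Rightarrow> ('b \<Rightarrow> 'a) \<Rightarrow> 'd"
  where "lin_comb R M y u = (\<Oplus>\<^bsub>M\<^esub>x\<in>{x. u x \<noteq> \<zero>\<^bsub>R\<^esub>}. y x \<star>\<^bsub>M\<^esub> u x)"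

lemma free_rmod_simps [simp]:
  "zero (free_rmod R N) = (\<lambda>x. \<zero>\<^bsub>R\<^esub>)" "add (free_rmod R N) = (\<lambda>u v x. u x \<oplus>\<^bsub>R\<^esub> v x)"
  "rsmult (free_rmod R N) = (\<lambda>u r x. u x \<otimes>\<^bsub>R\<^esub> r)"
  by (simp_all add: free_rmod_def)

lemma free_rmod_memD:
  assumes "u \<in> carrier (free_rmod R N)"
  shows "u x \<in> carrier R" "finite {x. u x \<noteq> \<zero>\<^bsub>R\<^esub>}" "u x \<noteq> \<zero>\<^bsub>R\<^esub> \<Longrightarrow> x \<in> carrier N"
  using assms by (auto simp: free_rmod_def)

lemma free_rmod_memI:
  assumes "\<And>x. u x \<in> carrier R" "\<And>x. u x \<noteq> \<zero>\<^bsub>R\<^esub> \<Longrightarrow> x \<in> A" "finite A" "A \<subseteq> carrier N"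
  shows "u \<in> carrier (free_rmod R N)"
  using assms by (auto simp: free_rmod_def intro: rev_finite_subset[of A])

lemma (in ring) right_module_free: "right_module R (free_rmod R N)"
proof (intro right_module.intro ring_axioms right_module_axioms.intro abelian_groupI)
  fix u v assume u: "u \<in> carrier (free_rmod R N)" and v: "v \<in> carrier (free_rmod R N)"
  note D = free_rmod_memD[OF u] free_rmod_memD[OF v]
  show "u \<oplus>\<^bsub>free_rmod R N\<^esub> v \<in> carrier (free_rmod R N)"
    by (rule free_rmod_memI[where A = "{x. u x \<noteq> \<zero>} \<union> {x. v x \<noteq> \<zero>}"]) (use D in auto)
next
  fix u r assume u: "u \<in> carrier (free_rmod R N)" and r: "r \<in> carrier R"
  note D = free_rmod_memD[OF u]
  show "u \<star>\<^bsub>free_rmod R N\<^esub> r \<in> carrier (free_rmod R N)"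
    by (rule free_rmod_memI[where A = "{x. u x \<noteq> \<zero>}"]) (use D r in auto)
next
  fix u assume u: "u \<in> carrier (free_rmod R N)"
  note D = free_rmod_memD[OF u]
  have "(\<lambda>x. \<ominus> u x) \<in> carrier (free_rmod R N)"
    by (rule free_rmod_memI[where A = "{x. u x \<noteq> \<zero>}"]) (use D in auto)
  then show "\<exists>v\<in>carrier (free_rmod R N). v \<oplus>\<^bsub>free_rmod R N\<^esub> u = \<zero>\<^bsub>free_rmod R N\<^esub>"
    using D by (auto intro!: bexI[of _ "\<lambda>x. \<ominus> u x"] simp: l_neg)
qed (auto simp: free_rmod_memD[of _ R N] a_ac l_distr r_distr m_assoc intro: free_rmod_memI[where A = "{}"])

definition single :: "('a, 'm) ring_scheme \<Rightarrow> 'b \<Rightarrow> 'a \<Rightarrow> 'b \<Rightarrow> 'a"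
  where "single R x a = (\<lambda>z. if z = x then a else \<zero>\<^bsub>R\<^esub>)"

lemma (in ring) single_closed:
  "x \<in> carrier N \<Longrightarrow> a \<in> carrier R \<Longrightarrow> single R x a \<in> carrier (free_rmod R N)"
  by (rule free_rmod_memI[where A = "{x}"]) (auto simp: single_def split: if_splits)

text \<open>
  Identities between maps built from sums over finite supports are reduced to elements with
  one-element support. It saves comparing the supports on the two sides, which differ in general.
\<close>

lemma (in ring) free_rmod_additive_eq:
  assumes G: "abelian_group G"
    and u: "u \<in> carrier (free_rmod R N)"
    and f: "\<And>u. u \<in> carrier (free_rmod R N) \<Longrightarrow> f u \<in> carrier G"
      "\<And>u v. u \<in> carrier (free_rmod R N) \<Longrightarrow> v \<in> carrier (free_rmod R N) \<Longrightarrow>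
        f (\<lambda>x. u x \<oplus> v x) = f u \<oplus>\<^bsub>G\<^esub> f v"
    and g: "\<And>u. u \<in> carrier (free_rmod R N) \<Longrightarrow> g u \<in> carrier G"
      "\<And>u v. u \<in> carrier (free_rmod R N) \<Longrightarrow> v \<in> carrier (free_rmod R N) \<Longrightarrow>
        g (\<lambda>x. u x \<oplus> v x) = g u \<oplus>\<^bsub>G\<^esub> g v"
    and eq: "\<And>x a. x \<in> carrier N \<Longrightarrow> a \<in> carrier R \<Longrightarrow> f (single R x a) = g (single R x a)"
  shows "f u = g u"
proof -
  interpret G: abelian_group G by fact
  let ?F = "carrier (free_rmod R N)"
  have z: "(\<lambda>x. \<zero>) \<in> ?F" by (rule free_rmod_memI[where A = "{}"]) auto
  have z0: "h (\<lambda>x. \<zero>) = \<zero>\<^bsub>G\<^esub>"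
    if "h (\<lambda>x. \<zero>) \<in> carrier G" "h (\<lambda>x. \<zero> \<oplus> \<zero>) = h (\<lambda>x. \<zero>) \<oplus>\<^bsub>G\<^esub> h (\<lambda>x. \<zero>)" for h
    using that by (simp add: G.add.l_cancel_one')
  have "finite A \<Longrightarrow> u \<in> ?F \<Longrightarrow> {x. u x \<noteq> \<zero>} = A \<Longrightarrow> f u = g u" for A u
  proof (induction A arbitrary: u rule: finite_induct)
    case empty
    then have "u = (\<lambda>x. \<zero>)" by auto
    then show ?case using z0[of f] z0[of g] f[OF z] g[OF z] f(2)[OF z z] g(2)[OF z z] by simp
  next
    case (insert x A)
    note D = free_rmod_memD[OF insert.prems(1)]
    define v where "v = u(x := \<zero>)"
    have v: "v \<in> ?F"
      by (rule free_rmod_memI[where A = "{x. u x \<noteq> \<zero>}"]) (use D in \<open>auto simp: v_def split: if_splits\<close>)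
    have "{x. v x \<noteq> \<zero>} = A" using insert.prems(2) insert.hyps(2) by (auto simp: v_def)
    then have "f v = g v" using insert.IH v by blast
    moreover have x: "x \<in> carrier N" "u x \<in> carrier R" using insert.prems D by auto
    moreover have "u = (\<lambda>z. single R x (u x) z \<oplus> v z)"
      using D by (auto simp: single_def v_def fun_eq_iff)
    ultimately show ?case
      using f(2)[OF single_closed[OF x] v] g(2)[OF single_closed[OF x] v] eq by metis
  qed
  then show ?thesis using u free_rmod_memD(2)[OF u] by blast
qed

context right_module
begin

lemma lin_comb_superset:
  assumes u: "u \<in> carrier (free_rmod R N)" and y: "y \<in> carrier N \<rightarrow> carrier M"
    and B: "finite B" "{x. u x \<noteq> \<zero>\<^bsub>R\<^esub>} \<subseteq> B" "B \<subseteq> carrier N"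
  shows "lin_comb R M y u = (\<Oplus>\<^bsub>M\<^esub>x\<in>B. y x \<star>\<^bsub>M\<^esub> u x)"
  unfolding lin_comb_def
proof (rule M.add.finprod_mono_neutral_cong_left)
  show "y x \<star>\<^bsub>M\<^esub> u x = \<zero>\<^bsub>M\<^esub>" if "x \<in> B - {x. u x \<noteq> \<zero>\<^bsub>R\<^esub>}" for x
    using that B y by (auto intro!: rsmult_zero)
  show "(\<lambda>x. y x \<star>\<^bsub>M\<^esub> u x) \<in> B \<rightarrow> carrier M"
    using B y free_rmod_memD(1)[OF u] by (auto intro!: rsmult_closed)
qed (use B in auto)

lemma lin_comb_closed:
  assumes u: "u \<in> carrier (free_rmod R N)" and y: "y \<in> carrier N \<rightarrow> carrier M"
  shows "lin_comb R M y u \<in> carrier M"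
  unfolding lin_comb_def
  using y free_rmod_memD[OF u] by (intro M.finsum_closed) (auto intro!: rsmult_closed)

lemma lin_comb_add:
  assumes u: "u \<in> carrier (free_rmod R N)" and v: "v \<in> carrier (free_rmod R N)"
    and y: "y \<in> carrier N \<rightarrow> carrier M"
  shows "lin_comb R M y (\<lambda>x. u x \<oplus>\<^bsub>R\<^esub> v x) = lin_comb R M y u \<oplus>\<^bsub>M\<^esub> lin_comb R M y v"
proof -
  note D = free_rmod_memD[OF u] free_rmod_memD[OF v]
  let ?B = "{x. u x \<noteq> \<zero>\<^bsub>R\<^esub>} \<union> {x. v x \<noteq> \<zero>\<^bsub>R\<^esub>}"
  have B: "finite ?B" "?B \<subseteq> carrier N" using D by auto
  have uv: "(\<lambda>x. u x \<oplus>\<^bsub>R\<^esub> v x) \<in> carrier (free_rmod R N)"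
    by (rule free_rmod_memI[where A = ?B]) (use D in auto)
  have "lin_comb R M y (\<lambda>x. u x \<oplus>\<^bsub>R\<^esub> v x) = (\<Oplus>\<^bsub>M\<^esub>x\<in>?B. y x \<star>\<^bsub>M\<^esub> (u x \<oplus>\<^bsub>R\<^esub> v x))"
    by (rule lin_comb_superset[OF uv y B(1) _ B(2)]) (use D in auto)
  also have "\<dots> = (\<Oplus>\<^bsub>M\<^esub>x\<in>?B. y x \<star>\<^bsub>M\<^esub> u x \<oplus>\<^bsub>M\<^esub> y x \<star>\<^bsub>M\<^esub> v x)"
    using B y D by (intro M.finsum_cong') (auto intro!: rsmult_r_distr rsmult_closed M.a_closed)
  also have "\<dots> = (\<Oplus>\<^bsub>M\<^esub>x\<in>?B. y x \<star>\<^bsub>M\<^esub> u x) \<oplus>\<^bsub>M\<^esub> (\<Oplus>\<^bsub>M\<^esub>x\<in>?B. y x \<star>\<^bsub>M\<^esub> v x)"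
    using B y D by (intro M.finsum_addf) (auto intro!: rsmult_closed)
  also have "\<dots> = lin_comb R M y u \<oplus>\<^bsub>M\<^esub> lin_comb R M y v"
    using lin_comb_superset[OF u y B(1) _ B(2)] lin_comb_superset[OF v y B(1) _ B(2)] by auto
  finally show ?thesis .
qed

lemma lin_comb_single:
  assumes "y x \<in> carrier M" "a \<in> carrier R"
  shows "lin_comb R M y (single R x a) = y x \<star>\<^bsub>M\<^esub> a"
proof -
  let ?N = "\<lparr>carrier = {x}, mult = undefined, one = undefined, zero = undefined, add = undefined,
    rsmult = undefined\<rparr>"
  have "single R x a \<in> carrier (free_rmod R ?N)" using assms by (intro R.single_closed) auto
  then have "lin_comb R M y (single R x a) = (\<Oplus>\<^bsub>M\<^esub>z\<in>{x}. y z \<star>\<^bsub>M\<^esub> single R x a z)"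
    by (rule lin_comb_superset) (use assms in \<open>auto simp: single_def\<close>)
  also have "\<dots> = y x \<star>\<^bsub>M\<^esub> a"
    using assms rsmult_closed by (simp add: M.finsum_insert single_def)
  finally show ?thesis .
qed

lemma lin_comb_rsmult:
  assumes u: "u \<in> carrier (free_rmod R N)" and y: "y \<in> carrier N \<rightarrow> carrier M" and r: "r \<in> carrier R"
  shows "lin_comb R M y (\<lambda>x. u x \<otimes>\<^bsub>R\<^esub> r) = lin_comb R M y u \<star>\<^bsub>M\<^esub> r"
proof (rule R.free_rmod_additive_eq[OF M.abelian_group_axioms u])
  interpret F: right_module R "free_rmod R N" by (rule R.right_module_free)
  fix u assume u: "u \<in> carrier (free_rmod R N)"
  have ur: "(\<lambda>x. u x \<otimes>\<^bsub>R\<^esub> r) \<in> carrier (free_rmod R N)" using F.rsmult_closed[OF u r] by simp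
  show "lin_comb R M y (\<lambda>x. u x \<otimes>\<^bsub>R\<^esub> r) \<in> carrier M" by (rule lin_comb_closed[OF ur y])
  show "lin_comb R M y u \<star>\<^bsub>M\<^esub> r \<in> carrier M" by (intro rsmult_closed lin_comb_closed[OF u y] r)
  fix v assume v: "v \<in> carrier (free_rmod R N)"
  have vr: "(\<lambda>x. v x \<otimes>\<^bsub>R\<^esub> r) \<in> carrier (free_rmod R N)" using F.rsmult_closed[OF v r] by simp
  have "(\<lambda>x. (u x \<oplus>\<^bsub>R\<^esub> v x) \<otimes>\<^bsub>R\<^esub> r) = (\<lambda>x. u x \<otimes>\<^bsub>R\<^esub> r \<oplus>\<^bsub>R\<^esub> v x \<otimes>\<^bsub>R\<^esub> r)"
    using free_rmod_memD(1)[OF u] free_rmod_memD(1)[OF v] r by (auto simp: R.l_distr)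
  then show "lin_comb R M y (\<lambda>x. (u x \<oplus>\<^bsub>R\<^esub> v x) \<otimes>\<^bsub>R\<^esub> r) =
      lin_comb R M y (\<lambda>x. u x \<otimes>\<^bsub>R\<^esub> r) \<oplus>\<^bsub>M\<^esub> lin_comb R M y (\<lambda>x. v x \<otimes>\<^bsub>R\<^esub> r)"
    using lin_comb_add[OF ur vr y] by simp
  show "lin_comb R M y (\<lambda>x. u x \<oplus>\<^bsub>R\<^esub> v x) \<star>\<^bsub>M\<^esub> r =
      lin_comb R M y u \<star>\<^bsub>M\<^esub> r \<oplus>\<^bsub>M\<^esub> lin_comb R M y v \<star>\<^bsub>M\<^esub> r"
    using lin_comb_add[OF u v y] lin_comb_closed[OF u y] lin_comb_closed[OF v y] r
    by (simp add: rsmult_l_distr)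
next
  fix x a assume x: "x \<in> carrier N" and a: "a \<in> carrier R"
  have yx: "y x \<in> carrier M" using y x by auto
  have "(\<lambda>z. single R x a z \<otimes>\<^bsub>R\<^esub> r) = single R x (a \<otimes>\<^bsub>R\<^esub> r)" using r by (auto simp: single_def)
  then show "lin_comb R M y (\<lambda>z. single R x a z \<otimes>\<^bsub>R\<^esub> r) = lin_comb R M y (single R x a) \<star>\<^bsub>M\<^esub> r"
    using lin_comb_single[of y x, OF yx] a r yx by (simp add: rsmult_assoc)
qed

lemma lin_comb_cong:
  assumes u: "u \<in> carrier (free_rmod R N)" and y: "y \<in> carrier N \<rightarrow> carrier M"
    and "\<And>x. x \<in> carrier N \<Longrightarrow> y x = z x"
  shows "lin_comb R M y u = lin_comb R M z u"
proof -
  have "z x \<in> carrier M" if "x \<in> carrier N" for x using funcset_mem[OF y that] assms(3)[OF that] by simp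
  then show ?thesis
    unfolding lin_comb_def using assms(3) free_rmod_memD[OF u]
    by (intro M.finsum_cong') (auto intro!: rsmult_closed)
qed

lemma hom_lin_comb:
  assumes L: "right_module R L"
    and h: "\<And>x. x \<in> carrier M \<Longrightarrow> h x \<in> carrier L"
      "\<And>x x'. x \<in> carrier M \<Longrightarrow> x' \<in> carrier M \<Longrightarrow> h (x \<oplus>\<^bsub>M\<^esub> x') = h x \<oplus>\<^bsub>L\<^esub> h x'"
      "\<And>x r. x \<in> carrier M \<Longrightarrow> r \<in> carrier R \<Longrightarrow> h (x \<star>\<^bsub>M\<^esub> r) = h x \<star>\<^bsub>L\<^esub> r"
    and u: "u \<in> carrier (free_rmod R N)" and y: "y \<in> carrier N \<rightarrow> carrier M"
  shows "h (lin_comb R M y u) = lin_comb R L (\<lambda>x. h (y x)) u"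
proof -
  interpret L: right_module R L by fact
  have hy: "(\<lambda>x. h (y x)) \<in> carrier N \<rightarrow> carrier L" using h(1) y by auto
  show ?thesis
  proof (rule R.free_rmod_additive_eq[OF L.M.abelian_group_axioms u])
    fix x a assume x: "x \<in> carrier N" "a \<in> carrier R"
    then have "y x \<in> carrier M" using y by auto
    then show "h (lin_comb R M y (single R x a)) = lin_comb R L (\<lambda>x. h (y x)) (single R x a)"
      using x h by (simp add: lin_comb_single L.lin_comb_single)
  qed (simp_all add: h lin_comb_closed[OF _ y] L.lin_comb_closed[OF _ hy]
      lin_comb_add[OF _ _ y] L.lin_comb_add[OF _ _ hy])
qed

end

section \<open>The module structure on \<open>Ext\<close>\<close>

lemma free_eval_eq_lin_comb: "free_eval R N u = lin_comb R N (\<lambda>x. x) u"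
  by (simp add: free_eval_def lin_comb_def)

lemma syzygy_simps [simp]:
  "carrier (syzygy R N) = {u \<in> carrier (free_rmod R N). free_eval R N u = \<zero>\<^bsub>N\<^esub>}"
  "zero (syzygy R N) = zero (free_rmod R N)" "add (syzygy R N) = add (free_rmod R N)"
  "rsmult (syzygy R N) = rsmult (free_rmod R N)"
  by (simp_all add: syzygy_def)

context right_module
begin

lemmas free_eval_closed = lin_comb_closed[where N = M and y = "\<lambda>x. x", simplified, folded free_eval_eq_lin_comb]
lemmas free_eval_add = lin_comb_add[where N = M and y = "\<lambda>x. x", simplified, folded free_eval_eq_lin_comb]
lemmas free_eval_rsmult = lin_comb_rsmult[where N = M and y = "\<lambda>x. x", simplified, folded free_eval_eq_lin_comb]

lemma right_module_syzygy: "right_module R (syzygy R M)"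
proof -
  interpret F: right_module R "free_rmod R M" by (rule R.right_module_free)
  have "rsubmodule R (carrier (syzygy R M)) (free_rmod R M)"
  proof (rule F.rsubmoduleI)
    show "\<zero>\<^bsub>free_rmod R M\<^esub> \<in> carrier (syzygy R M)"
      using F.M.zero_closed by (simp add: free_eval_def)
    show "u \<oplus>\<^bsub>free_rmod R M\<^esub> v \<in> carrier (syzygy R M)"
      if "u \<in> carrier (syzygy R M)" "v \<in> carrier (syzygy R M)" for u v
      using that F.M.a_closed[of u v] by (simp add: free_eval_add)
    show "u \<star>\<^bsub>free_rmod R M\<^esub> r \<in> carrier (syzygy R M)"
      if "u \<in> carrier (syzygy R M)" "r \<in> carrier R" for u r
      using that F.rsmult_closed[of u r] by (simp add: free_eval_rsmult zero_rsmult)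
  qed auto
  from rsubmodule.right_module_restrict[OF this] show ?thesis by (simp add: syzygy_def)
qed

end

context ring
begin

lemma finsum_regular_rmod: "finsum (regular_rmod R) f A = finsum R f A"
  by (simp add: finsum_def finprod_def)

lemma free_map_eq_lin_comb:
  assumes u: "u \<in> carrier (free_rmod R N)"
  shows "free_map R \<phi> u y = lin_comb R (regular_rmod R) (\<lambda>x. if \<phi> x = y then \<one> else \<zero>) u"
proof -
  note D = free_rmod_memD[OF u]
  have "(\<Oplus>x\<in>{x. u x \<noteq> \<zero> \<and> \<phi> x = y}. u x) =
      (\<Oplus>x\<in>{x. u x \<noteq> \<zero>}. (if \<phi> x = y then \<one> else \<zero>) \<otimes> u x)"
    by (rule add.finprod_mono_neutral_cong_left) (use D in auto)
  then show ?thesis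
    by (simp add: free_map_def lin_comb_def finsum_regular_rmod)
qed

lemma free_map_closed:
  assumes u: "u \<in> carrier (free_rmod R N)" and \<phi>: "\<phi> \<in> carrier N \<rightarrow> carrier N"
  shows "free_map R \<phi> u \<in> carrier (free_rmod R N)"
proof -
  note D = free_rmod_memD[OF u]
  have "x \<in> \<phi> ` {x. u x \<noteq> \<zero>}" if "free_map R \<phi> u x \<noteq> \<zero>" for x
  proof (rule ccontr)
    assume "x \<notin> \<phi> ` {x. u x \<noteq> \<zero>}"
    then have "{z. u z \<noteq> \<zero> \<and> \<phi> z = x} = {}" by auto
    then have "free_map R \<phi> u x = \<zero>" by (simp only: free_map_def finsum_empty)
    with that show False by simp
  qed
  then show ?thesis
    by (rule free_rmod_memI[where A = "\<phi> ` {x. u x \<noteq> \<zero>}", rotated])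
      (use D \<phi> in \<open>auto simp: free_map_def intro!: finsum_closed\<close>)
qed

lemma free_map_add:
  assumes u: "u \<in> carrier (free_rmod R N)" and v: "v \<in> carrier (free_rmod R N)"
  shows "free_map R \<phi> (\<lambda>x. u x \<oplus> v x) = (\<lambda>x. free_map R \<phi> u x \<oplus> free_map R \<phi> v x)"
proof
  interpret A: right_module R "regular_rmod R" by (rule right_module_regular)
  have uv: "(\<lambda>x. u x \<oplus> v x) \<in> carrier (free_rmod R N)"
    using abelian_groupE(1)[OF right_module.axioms(2)[OF right_module_free] u v] by simp
  fix z
  show "free_map R \<phi> (\<lambda>x. u x \<oplus> v x) z = free_map R \<phi> u z \<oplus> free_map R \<phi> v z"
    unfolding free_map_eq_lin_comb[OF u] free_map_eq_lin_comb[OF v] free_map_eq_lin_comb[OF uv]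
    by (subst A.lin_comb_add[OF u v]) auto
qed

lemma free_map_rsmult:
  assumes u: "u \<in> carrier (free_rmod R N)" and r: "r \<in> carrier R"
  shows "free_map R \<phi> (\<lambda>x. u x \<otimes> r) = (\<lambda>x. free_map R \<phi> u x \<otimes> r)"
proof
  interpret A: right_module R "regular_rmod R" by (rule right_module_regular)
  have ur: "(\<lambda>x. u x \<otimes> r) \<in> carrier (free_rmod R N)"
    using right_module.rsmult_closed[OF right_module_free u r] by simp
  fix z
  show "free_map R \<phi> (\<lambda>x. u x \<otimes> r) z = free_map R \<phi> u z \<otimes> r"
    unfolding free_map_eq_lin_comb[OF u] free_map_eq_lin_comb[OF ur]
    by (subst A.lin_comb_rsmult[OF u _ r]) auto
qed

lemma free_map_single:
  fixes N :: "('a, 'n, 'x) rmodule_scheme"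
  assumes "x \<in> carrier N" "a \<in> carrier R"
  shows "free_map R \<phi> (single R x a) = single R (\<phi> x) a"
proof
  interpret A: right_module R "regular_rmod R" by (rule right_module_regular)
  fix z
  show "free_map R \<phi> (single R x a) z = single R (\<phi> x) a z"
    unfolding free_map_eq_lin_comb[OF single_closed[OF assms]]
    by (subst A.lin_comb_single) (use assms(2) in \<open>auto simp: single_def\<close>)
qed

lemma free_map_additive_eq:
  assumes u: "u \<in> carrier (free_rmod R N)"
    and f: "\<And>u. u \<in> carrier (free_rmod R N) \<Longrightarrow> f u \<in> carrier (free_rmod R N)"
      "\<And>u v. u \<in> carrier (free_rmod R N) \<Longrightarrow> v \<in> carrier (free_rmod R N) \<Longrightarrow>
        f (\<lambda>x. u x \<oplus> v x) = (\<lambda>x. f u x \<oplus> f v x)"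
    and g: "\<And>u. u \<in> carrier (free_rmod R N) \<Longrightarrow> g u \<in> carrier (free_rmod R N)"
      "\<And>u v. u \<in> carrier (free_rmod R N) \<Longrightarrow> v \<in> carrier (free_rmod R N) \<Longrightarrow>
        g (\<lambda>x. u x \<oplus> v x) = (\<lambda>x. g u x \<oplus> g v x)"
    and eq: "\<And>x a. x \<in> carrier N \<Longrightarrow> a \<in> carrier R \<Longrightarrow> f (single R x a) = g (single R x a)"
  shows "f u = g u"
  by (rule free_rmod_additive_eq[OF right_module.axioms(2)[OF right_module_free[of N]] u])
    (use f g eq in simp_all)

lemma free_map_comp:
  assumes u: "u \<in> carrier (free_rmod R N)"
    and \<phi>: "\<phi> \<in> carrier N \<rightarrow> carrier N" and \<psi>: "\<psi> \<in> carrier N \<rightarrow> carrier N"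
    and \<chi>: "\<And>x. x \<in> carrier N \<Longrightarrow> \<chi> x = \<phi> (\<psi> x)"
  shows "free_map R \<chi> u = free_map R \<phi> (free_map R \<psi> u)"
proof (rule free_map_additive_eq[OF u])
  have "\<chi> \<in> carrier N \<rightarrow> carrier N" using \<phi> \<psi> \<chi> by auto
  then show "free_map R \<chi> v \<in> carrier (free_rmod R N)" if "v \<in> carrier (free_rmod R N)" for v
    using that by (rule free_map_closed[rotated])
qed (use \<psi> in \<open>auto simp: free_map_closed[OF _ \<phi>] free_map_closed[OF _ \<psi>] free_map_add[where N = N]
      free_map_single[where N = N] free_map_single[OF funcset_mem[OF \<psi>]] \<chi>\<close>)

lemma free_map_id:
  assumes u: "u \<in> carrier (free_rmod R N)" and \<phi>: "\<And>x. x \<in> carrier N \<Longrightarrow> \<phi> x = x"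
  shows "free_map R \<phi> u = u"
proof (rule free_map_additive_eq[OF u])
  have "\<phi> \<in> carrier N \<rightarrow> carrier N" using \<phi> by auto
  then show "free_map R \<phi> v \<in> carrier (free_rmod R N)" if "v \<in> carrier (free_rmod R N)" for v
    using that by (rule free_map_closed[rotated])
qed (auto simp: free_map_add[where N = N] free_map_single[where N = N] \<phi>)

end

lemma (in right_module) lin_comb_free_map:
  assumes u: "u \<in> carrier (free_rmod R N)" and \<phi>: "\<phi> \<in> carrier N \<rightarrow> carrier N"
    and y: "y \<in> carrier N \<rightarrow> carrier M"
  shows "lin_comb R M y (free_map R \<phi> u) = lin_comb R M (\<lambda>x. y (\<phi> x)) u"
proof -
  have y\<phi>: "(\<lambda>x. y (\<phi> x)) \<in> carrier N \<rightarrow> carrier M" using y \<phi> by auto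
  show ?thesis
  proof (rule R.free_rmod_additive_eq[OF M.abelian_group_axioms u])
    fix x a assume x: "x \<in> carrier N" "a \<in> carrier R"
    then have "y (\<phi> x) \<in> carrier M" using y \<phi> by auto
    then show "lin_comb R M y (free_map R \<phi> (single R x a)) = lin_comb R M (\<lambda>x. y (\<phi> x)) (single R x a)"
      using x by (simp add: R.free_map_single[where N = N] lin_comb_single)
  qed (simp_all add: lin_comb_closed[OF _ y\<phi>] lin_comb_closed[OF _ y] R.free_map_closed[OF _ \<phi>]
      R.free_map_add[where N = N] lin_comb_add[OF _ _ y] lin_comb_add[OF _ _ y\<phi>])
qed

locale bimodule = N?: right_module R N + S: ring S
  for R (structure) and S :: "('s, 't) ring_scheme" and N :: "('a, 'b, 'c) rmodule_scheme" (structure) +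
  fixes lact :: "'s \<Rightarrow> 'b \<Rightarrow> 'b"
  assumes lact_closed: "s \<in> carrier S \<Longrightarrow> x \<in> carrier N \<Longrightarrow> lact s x \<in> carrier N"
    and lact_add: "s \<in> carrier S \<Longrightarrow> x \<in> carrier N \<Longrightarrow> y \<in> carrier N \<Longrightarrow>
      lact s (x \<oplus>\<^bsub>N\<^esub> y) = lact s x \<oplus>\<^bsub>N\<^esub> lact s y"
    and lact_rsmult: "s \<in> carrier S \<Longrightarrow> x \<in> carrier N \<Longrightarrow> r \<in> carrier R \<Longrightarrow>
      lact s (x \<star>\<^bsub>N\<^esub> r) = lact s x \<star>\<^bsub>N\<^esub> r"
    and add_lact: "s \<in> carrier S \<Longrightarrow> t \<in> carrier S \<Longrightarrow> x \<in> carrier N \<Longrightarrow>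
      lact (s \<oplus>\<^bsub>S\<^esub> t) x = lact s x \<oplus>\<^bsub>N\<^esub> lact t x"
    and mult_lact: "s \<in> carrier S \<Longrightarrow> t \<in> carrier S \<Longrightarrow> x \<in> carrier N \<Longrightarrow>
      lact (s \<otimes>\<^bsub>S\<^esub> t) x = lact s (lact t x)"
    and one_lact: "x \<in> carrier N \<Longrightarrow> lact \<one>\<^bsub>S\<^esub> x = x"
begin

abbreviation F where "F \<equiv> free_rmod R N"
abbreviation K where "K \<equiv> syzygy R N"

lemma free_eval_free_map:
  assumes "s \<in> carrier S" "u \<in> carrier F"
  shows "free_eval R N (free_map R (lact s) u) = lact s (free_eval R N u)"
proof -
  have "lin_comb R N (\<lambda>x. x) (free_map R (lact s) u) = lin_comb R N (lact s) u"
    by (rule lin_comb_free_map[OF assms(2)]) (use assms lact_closed in auto)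
  also have "\<dots> = lact s (lin_comb R N (\<lambda>x. x) u)"
    by (rule hom_lin_comb[symmetric, OF right_module_axioms _ _ _ assms(2)])
      (use assms lact_closed lact_add lact_rsmult in auto)
  finally show ?thesis by (simp add: free_eval_eq_lin_comb)
qed

lemma lact_zero: "s \<in> carrier S \<Longrightarrow> lact s \<zero>\<^bsub>N\<^esub> = \<zero>\<^bsub>N\<^esub>"
  using lact_add[of s "\<zero>\<^bsub>N\<^esub>" "\<zero>\<^bsub>N\<^esub>"] lact_closed[of s "\<zero>\<^bsub>N\<^esub>"]
  by (metis M.add.l_cancel_one M.zero_closed M.l_zero)

lemma lact_free_closed:
  "s \<in> carrier S \<Longrightarrow> u \<in> carrier F \<Longrightarrow> free_map R (lact s) u \<in> carrier F"
  by (rule R.free_map_closed) (auto simp: lact_closed)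

lemma lact_syzygy_closed:
  "s \<in> carrier S \<Longrightarrow> u \<in> carrier K \<Longrightarrow> free_map R (lact s) u \<in> carrier K"
  by (simp add: lact_free_closed free_eval_free_map lact_zero)

end

locale ext_setting = bimodule R S N lact + M: right_module R M
  for R (structure) and S :: "('s, 't) ring_scheme" and N :: "('a, 'b, 'c) rmodule_scheme" (structure)
    and lact and M :: "('a, 'd, 'e) rmodule_scheme"
begin

abbreviation H where "H \<equiv> hom_rmod R (\<lambda>s. free_map R (lact s)) K M"

definition extendable :: "(('b \<Rightarrow> 'a) \<Rightarrow> 'd) set"
  where "extendable = (\<lambda>f. restrict f (carrier K)) ` rmod_hom R F M"

lemma ext1_eq: "ext1 R lact N M = quot_rmod H extendable"
  by (simp add: ext1_def extendable_def)

lemma extendableI: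
  assumes "\<And>u. u \<in> carrier F \<Longrightarrow> f u \<in> carrier M"
    and "\<And>u v. u \<in> carrier F \<Longrightarrow> v \<in> carrier F \<Longrightarrow> f (\<lambda>x. u x \<oplus> v x) = f u \<oplus>\<^bsub>M\<^esub> f v"
    and "\<And>u r. u \<in> carrier F \<Longrightarrow> r \<in> carrier R \<Longrightarrow> f (\<lambda>x. u x \<otimes> r) = f u \<star>\<^bsub>M\<^esub> r"
  shows "(\<lambda>u\<in>carrier K. f u) \<in> extendable"
proof -
  have "restrict f (carrier F) \<in> rmod_hom R F M"
    by (rule rmod_homI[OF R.right_module_free]) (use assms in simp_all)
  moreover have "(\<lambda>u\<in>carrier K. f u) = restrict (restrict f (carrier F)) (carrier K)"
    by (auto simp: restrict_def)
  ultimately show ?thesis unfolding extendable_def by blast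
qed

lemma extendableE:
  assumes "h \<in> extendable"
  obtains f where "h = (\<lambda>u\<in>carrier K. f u)" "f \<in> rmod_hom R F M"
  using assms by (auto simp: extendable_def)

lemma free_homD:
  assumes "f \<in> rmod_hom R F M"
  shows "\<And>u. u \<in> carrier F \<Longrightarrow> f u \<in> carrier M"
    "\<And>u v. u \<in> carrier F \<Longrightarrow> v \<in> carrier F \<Longrightarrow> f (\<lambda>x. u x \<oplus> v x) = f u \<oplus>\<^bsub>M\<^esub> f v"
    "\<And>u r. u \<in> carrier F \<Longrightarrow> r \<in> carrier R \<Longrightarrow> f (\<lambda>x. u x \<otimes> r) = f u \<star>\<^bsub>M\<^esub> r"
  using rmod_homD[OF assms] by simp_all

lemma hom_syzygyI:
  assumes "\<And>u. u \<in> carrier K \<Longrightarrow> f u \<in> carrier M"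
    and "\<And>u v. u \<in> carrier K \<Longrightarrow> v \<in> carrier K \<Longrightarrow> f (\<lambda>x. u x \<oplus> v x) = f u \<oplus>\<^bsub>M\<^esub> f v"
    and "\<And>u r. u \<in> carrier K \<Longrightarrow> r \<in> carrier R \<Longrightarrow> f (\<lambda>x. u x \<otimes> r) = f u \<star>\<^bsub>M\<^esub> r"
  shows "(\<lambda>u\<in>carrier K. f u) \<in> carrier H"
  using rmod_homI[OF right_module_syzygy, of f M] assms by simp

lemma hom_syzygyD:
  assumes "f \<in> carrier H"
  shows "\<And>u. u \<in> carrier K \<Longrightarrow> f u \<in> carrier M"
    and "\<And>u v. u \<in> carrier K \<Longrightarrow> v \<in> carrier K \<Longrightarrow> f (\<lambda>x. u x \<oplus> v x) = f u \<oplus>\<^bsub>M\<^esub> f v"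
    and "\<And>u r. u \<in> carrier K \<Longrightarrow> r \<in> carrier R \<Longrightarrow> f (\<lambda>x. u x \<otimes> r) = f u \<star>\<^bsub>M\<^esub> r"
    and "(\<lambda>u\<in>carrier K. f u) = f"
  using rmod_homD[of f R K M] assms by simp_all

lemma abelian_subgroup_extendable: "abelian_subgroup extendable H"
proof (rule abelian_subgroupI3)
  interpret F: right_module R F by (rule R.right_module_free)
  show H: "abelian_group H"
    by (rule abelian_group_hom_rmod[OF right_module_syzygy M.right_module_axioms])
  interpret H: abelian_group H by (rule H)
  show "additive_subgroup extendable H"
  proof (intro additive_subgroup.intro H.add.subgroupI)
    show "extendable \<subseteq> carrier H"
    proof
      fix h assume "h \<in> extendable"
      then obtain f where h: "h = (\<lambda>u\<in>carrier K. f u)" and f_hom: "f \<in> rmod_hom R F M"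
      by (rule extendableE)
    note f = free_homD[OF f_hom]
      show "h \<in> carrier H" unfolding h by (rule hom_syzygyI) (use f in simp_all)
    qed
    have "(\<lambda>u\<in>carrier K. \<zero>\<^bsub>M\<^esub>) \<in> extendable"
      by (rule extendableI) (simp_all add: M.zero_rsmult)
    then show "extendable \<noteq> {}" by blast
    fix h assume "h \<in> extendable"
    then obtain f where h: "h = (\<lambda>u\<in>carrier K. f u)" and f_hom: "f \<in> rmod_hom R F M"
      by (rule extendableE)
    note f = free_homD[OF f_hom]
    have neg: "(\<lambda>u\<in>carrier K. f u \<star>\<^bsub>M\<^esub> (\<ominus> \<one>)) \<in> extendable"
      by (rule extendableI) (simp_all add: f M.rsmult_l_distr M.rsmult_closed
          M.rsmult_assoc[symmetric] R.l_minus R.r_minus)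
    have hH: "h \<in> carrier H" unfolding h by (rule hom_syzygyI) (use f in simp_all)
    have nH: "(\<lambda>u\<in>carrier K. f u \<star>\<^bsub>M\<^esub> (\<ominus> \<one>)) \<in> carrier H"
      by (rule hom_syzygyI) (simp_all add: f M.rsmult_l_distr M.rsmult_closed
          M.rsmult_assoc[symmetric] R.l_minus R.r_minus)
    have "(\<lambda>u\<in>carrier K. f u \<star>\<^bsub>M\<^esub> (\<ominus> \<one>)) \<oplus>\<^bsub>H\<^esub> h = \<zero>\<^bsub>H\<^esub>"
      by (auto simp: h f M.rsmult_minus_one M.M.l_neg)
    from H.minus_equality[OF this hH nH] show "\<ominus>\<^bsub>H\<^esub> h \<in> extendable" using neg by simp
    fix h' assume "h' \<in> extendable"
    then obtain f' where h': "h' = (\<lambda>u\<in>carrier K. f' u)" and f'_hom: "f' \<in> rmod_hom R F M"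
      by (rule extendableE)
    note f' = free_homD[OF f'_hom]
    have "(\<lambda>u\<in>carrier K. f u \<oplus>\<^bsub>M\<^esub> f' u) \<in> extendable"
      by (rule extendableI) (simp_all add: f f' M.M.a_ac M.rsmult_l_distr M.rsmult_closed)
    moreover have "h \<oplus>\<^bsub>H\<^esub> h' = (\<lambda>u\<in>carrier K. f u \<oplus>\<^bsub>M\<^esub> f' u)"
      by (auto simp: h h')
    ultimately show "h \<oplus>\<^bsub>H\<^esub> h' \<in> extendable" by simp
  qed
qed

lemma rsmult_closed_hom:
  assumes f: "f \<in> carrier H" and s: "s \<in> carrier S"
  shows "f \<star>\<^bsub>H\<^esub> s \<in> carrier H"
proof -
  note D = hom_syzygyD[OF f]
  have "(\<lambda>u\<in>carrier K. f (free_map R (lact s) u)) \<in> carrier H"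
  proof (rule hom_syzygyI)
    fix u assume u: "u \<in> carrier K"
    show "f (free_map R (lact s) u) \<in> carrier M" by (rule D(1)[OF lact_syzygy_closed[OF s u]])
    show "f (free_map R (lact s) (\<lambda>x. u x \<oplus> v x)) =
      f (free_map R (lact s) u) \<oplus>\<^bsub>M\<^esub> f (free_map R (lact s) v)" if v: "v \<in> carrier K" for v
      using u v D(2)[OF lact_syzygy_closed[OF s u] lact_syzygy_closed[OF s v]]
      by (simp add: R.free_map_add[where N = N])
    show "f (free_map R (lact s) (\<lambda>x. u x \<otimes> r)) = f (free_map R (lact s) u) \<star>\<^bsub>M\<^esub> r"
      if r: "r \<in> carrier R" for r
      using u D(3)[OF lact_syzygy_closed[OF s u] r] r by (simp add: R.free_map_rsmult[where N = N])
  qed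
  then show ?thesis by simp
qed

lemma extendable_rsmult:
  assumes h: "h \<in> extendable" and s: "s \<in> carrier S"
  shows "h \<star>\<^bsub>H\<^esub> s \<in> extendable"
proof -
  from h obtain f where h: "h = (\<lambda>u\<in>carrier K. f u)" and f_hom: "f \<in> rmod_hom R F M"
      by (rule extendableE)
    note f = free_homD[OF f_hom]
  have "(\<lambda>u\<in>carrier K. f (free_map R (lact s) u)) \<in> extendable"
    by (rule extendableI)
      (simp_all add: f lact_free_closed s R.free_map_add[where N = N] R.free_map_rsmult[where N = N])
  moreover have "h \<star>\<^bsub>H\<^esub> s = (\<lambda>u\<in>carrier K. f (free_map R (lact s) u))"
    using lact_syzygy_closed[OF s] by (auto simp: h)
  ultimately show ?thesis by simp
qed

text \<open>
  On \<open>F\<close> the map induced by \<open>s + t\<close> differs from the sum of those induced by \<open>s\<close> and \<open>t\<close>, since the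
  basis elements at \<open>sx\<close> and \<open>tx\<close> do not add up to the one at \<open>sx + tx\<close>. The difference \<open>\<delta>\<close> has
  values in the syzygy \<open>K\<close> on all of \<open>F\<close>. So for \<open>f\<close> defined on \<open>K\<close> only, \<open>f \<circ> \<delta>\<close> is defined on \<open>F\<close>, and additivity in the scalar
  holds modulo maps which extend to \<open>F\<close>.
\<close>

theorem right_module_ext1: "right_module S (ext1 R lact N M)"
  unfolding ext1_eq
proof (rule right_module_quot_rmod[OF S.ring_axioms abelian_subgroup_extendable])
  interpret F: right_module R F by (rule R.right_module_free)
  fix f s assume f: "f \<in> carrier H" and s: "s \<in> carrier S"
  note D = hom_syzygyD[OF f]
  show "f \<star>\<^bsub>H\<^esub> s \<in> carrier H" by (rule rsmult_closed_hom[OF f s])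
  show "(f \<oplus>\<^bsub>H\<^esub> g) \<star>\<^bsub>H\<^esub> s = f \<star>\<^bsub>H\<^esub> s \<oplus>\<^bsub>H\<^esub> g \<star>\<^bsub>H\<^esub> s" if "g \<in> carrier H" for g
    using lact_syzygy_closed[OF s] by (auto simp: fun_eq_iff)
  fix t assume t: "t \<in> carrier S"
  have "free_map R (lact (s \<otimes>\<^bsub>S\<^esub> t)) u = free_map R (lact s) (free_map R (lact t) u)"
    if "u \<in> carrier F" for u
    by (rule R.free_map_comp[OF that]) (use s t lact_closed mult_lact in auto)
  then show "f \<star>\<^bsub>H\<^esub> (s \<otimes>\<^bsub>S\<^esub> t) = f \<star>\<^bsub>H\<^esub> s \<star>\<^bsub>H\<^esub> t"
    using lact_syzygy_closed[OF t] by (auto intro!: restrict_ext)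
  define \<delta> where "\<delta> u = free_map R (lact (s \<oplus>\<^bsub>S\<^esub> t)) u \<oplus>\<^bsub>F\<^esub>
    (free_map R (lact s) u \<oplus>\<^bsub>F\<^esub> free_map R (lact t) u) \<star>\<^bsub>F\<^esub> (\<ominus> \<one>)" for u
  let ?m = "\<lambda>s. free_map R (lact s)"
  note cl = lact_free_closed[OF s] lact_free_closed[OF t] lact_free_closed[OF S.a_closed[OF s t]]
  have \<delta>K: "\<delta> u \<in> carrier K" if u: "u \<in> carrier F" for u
  proof -
    let ?e = "free_eval R N u"
    have \<delta>F: "\<delta> u \<in> carrier F"
      unfolding \<delta>_def using cl[OF u] by (intro F.M.a_closed F.rsmult_closed) auto
    have "free_eval R N (\<delta> u) = free_eval R N (?m (s \<oplus>\<^bsub>S\<^esub> t) u) \<oplus>\<^bsub>N\<^esub>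
        (free_eval R N (?m s u) \<oplus>\<^bsub>N\<^esub> free_eval R N (?m t u)) \<star>\<^bsub>N\<^esub> (\<ominus> \<one>)"
      using cl[OF u] F.M.a_closed F.rsmult_closed[OF F.M.a_closed]
      by (simp add: \<delta>_def free_eval_add free_eval_rsmult)
    also have "\<dots> = \<zero>\<^bsub>N\<^esub>"
      using s t u by (simp add: free_eval_free_map free_eval_closed lact_closed add_lact
          rsmult_minus_one N.M.r_neg)
    finally show ?thesis using \<delta>F by simp
  qed
  have f\<delta>: "(\<lambda>u\<in>carrier K. f (\<delta> u)) \<in> extendable"
  proof (intro extendableI)
    fix u assume u: "u \<in> carrier F"
    note u' = free_rmod_memD(1)[OF cl(1)[OF u]] free_rmod_memD(1)[OF cl(2)[OF u]]
      free_rmod_memD(1)[OF cl(3)[OF u]]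
    show "f (\<delta> u) \<in> carrier M" by (rule D(1)[OF \<delta>K[OF u]])
    show "f (\<delta> (\<lambda>x. u x \<oplus> v x)) = f (\<delta> u) \<oplus>\<^bsub>M\<^esub> f (\<delta> v)" if v: "v \<in> carrier F" for v
    proof -
      note v' = free_rmod_memD(1)[OF cl(1)[OF v]] free_rmod_memD(1)[OF cl(2)[OF v]]
        free_rmod_memD(1)[OF cl(3)[OF v]]
      have "\<delta> (\<lambda>x. u x \<oplus> v x) = (\<lambda>x. \<delta> u x \<oplus> \<delta> v x)"
        using u' v' by (simp add: \<delta>_def R.free_map_add[OF u v] R.l_distr R.a_ac R.r_minus R.minus_add)
      then show ?thesis using D(2)[OF \<delta>K[OF u] \<delta>K[OF v]] by simp
    qed
    show "f (\<delta> (\<lambda>x. u x \<otimes> r)) = f (\<delta> u) \<star>\<^bsub>M\<^esub> r" if r: "r \<in> carrier R" for r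
    proof -
      have "\<delta> (\<lambda>x. u x \<otimes> r) = (\<lambda>x. \<delta> u x \<otimes> r)"
        using u' r by (simp add: \<delta>_def R.free_map_rsmult[OF u r] R.l_distr R.r_minus R.l_minus R.minus_add)
      then show ?thesis using D(3)[OF \<delta>K[OF u] r] by simp
    qed
  qed
  have "f (?m (s \<oplus>\<^bsub>S\<^esub> t) u) = f (\<delta> u) \<oplus>\<^bsub>M\<^esub> (f (?m s u) \<oplus>\<^bsub>M\<^esub> f (?m t u))" if u: "u \<in> carrier K" for u
  proof -
    have uF: "u \<in> carrier F" using u by simp
    note u' = free_rmod_memD(1)[OF cl(1)[OF uF]] free_rmod_memD(1)[OF cl(2)[OF uF]]
      free_rmod_memD(1)[OF cl(3)[OF uF]]
    have K2: "(\<lambda>x. ?m s u x \<oplus> ?m t u x) \<in> carrier K"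
      using abelian_groupE(1)[OF right_module.axioms(2)[OF right_module_syzygy]
          lact_syzygy_closed[OF s u] lact_syzygy_closed[OF t u]] by simp
    have "?m (s \<oplus>\<^bsub>S\<^esub> t) u = (\<lambda>x. \<delta> u x \<oplus> (?m s u x \<oplus> ?m t u x))"
      using u' by (simp add: \<delta>_def R.r_minus R.a_assoc R.l_neg)
    then show ?thesis
      using D(2)[OF \<delta>K[OF uF] K2] D(2)[OF lact_syzygy_closed[OF s u] lact_syzygy_closed[OF t u]]
      by simp
  qed
  then have "f \<star>\<^bsub>H\<^esub> (s \<oplus>\<^bsub>S\<^esub> t) =
      (\<lambda>u\<in>carrier K. f (\<delta> u)) \<oplus>\<^bsub>H\<^esub> (f \<star>\<^bsub>H\<^esub> s \<oplus>\<^bsub>H\<^esub> f \<star>\<^bsub>H\<^esub> t)"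
    by (auto simp: fun_eq_iff)
  with f\<delta> show "\<exists>h\<in>extendable. f \<star>\<^bsub>H\<^esub> (s \<oplus>\<^bsub>S\<^esub> t) =
      h \<oplus>\<^bsub>H\<^esub> (f \<star>\<^bsub>H\<^esub> s \<oplus>\<^bsub>H\<^esub> f \<star>\<^bsub>H\<^esub> t)"
    by blast
next
  fix h s assume "h \<in> extendable" "s \<in> carrier S"
  then show "h \<star>\<^bsub>H\<^esub> s \<in> extendable" by (rule extendable_rsmult)
next
  fix f assume f: "f \<in> carrier H"
  have "free_map R (lact \<one>\<^bsub>S\<^esub>) u = u" if "u \<in> carrier F" for u
    by (rule R.free_map_id[OF that]) (simp add: one_lact)
  then have "f \<star>\<^bsub>H\<^esub> \<one>\<^bsub>S\<^esub> = (\<lambda>u\<in>carrier K. f u)" by (auto intro!: restrict_ext)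
  then show "f \<star>\<^bsub>H\<^esub> \<one>\<^bsub>S\<^esub> = f" using hom_syzygyD(4)[OF f] by simp
qed

end

section \<open>Classes in \<open>Ext(R/P, X)\<close> of elements of an overmodule\<close>

lemma coset_regular_rmod [simp]:
  "a_r_coset (regular_rmod R) = a_r_coset R" "A_RCOSETS (regular_rmod R) = A_RCOSETS R"
  "set_add (regular_rmod R) = set_add R"
  by (simp_all add: fun_eq_iff a_r_coset_def' A_RCOSETS_def' set_add_def')

lemma FactRing_sel [simp]:
  "carrier (R Quot I) = a_rcosets\<^bsub>R\<^esub> I" "zero (R Quot I) = I" "add (R Quot I) = set_add R"
  "one (R Quot I) = I +>\<^bsub>R\<^esub> \<one>\<^bsub>R\<^esub>"
  by (simp_all add: FactRing_def)

context ideal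
begin

lemma right_ideal: "right_ideal R I"
  by (rule right_idealI) (auto simp: a_subset I_r_closed)

lemma abelian_subgroup_regular: "abelian_subgroup I (regular_rmod R)"
  using right_ideal right_module_regular
  by (auto intro!: abelian_subgroupI3 simp: rsubmodule_def right_module_def)

lemma rcosetsI: "x \<in> carrier R \<Longrightarrow> I +> x \<in> a_rcosets I"
  by (rule a_rcosetsI[OF a_subset])

lemma rcosetsE:
  assumes "C \<in> a_rcosets I"
  obtains x where "x \<in> carrier R" "C = I +> x"
  using assms by (auto simp: A_RCOSETS_def')

lemma mult_FactRing:
  "x \<in> carrier R \<Longrightarrow> y \<in> carrier R \<Longrightarrow> (I +> x) \<otimes>\<^bsub>R Quot I\<^esub> (I +> y) = I +> (x \<otimes> y)"
  by (simp add: FactRing_def rcoset_mult_add)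

lemma rsmult_quot_regular:
  "x \<in> carrier R \<Longrightarrow> r \<in> carrier R \<Longrightarrow>
    (I +> x) \<star>\<^bsub>quot_rmod (regular_rmod R) I\<^esub> r = I +> (x \<otimes> r)"
  using rsmult_quot_rmod[OF abelian_subgroup_regular, of x r] by (simp add: I_r_closed l_distr)

lemma right_module_quot_regular: "right_module R (quot_rmod (regular_rmod R) I)"
proof (rule right_module_quot_rmod[OF ring_axioms abelian_subgroup_regular])
  fix x s t assume "x \<in> carrier (regular_rmod R)" "s \<in> carrier R" "t \<in> carrier R"
  then show "\<exists>n\<in>I. x \<star>\<^bsub>regular_rmod R\<^esub> (s \<oplus> t) =
      n \<oplus>\<^bsub>regular_rmod R\<^esub> (x \<star>\<^bsub>regular_rmod R\<^esub> s \<oplus>\<^bsub>regular_rmod R\<^esub> x \<star>\<^bsub>regular_rmod R\<^esub> t)"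
    by (intro bexI[of _ \<zero>]) (simp_all add: r_distr)
qed (simp_all add: I_r_closed l_distr m_assoc)

lemma bimodule_quot_regular:
  "bimodule R (R Quot I) (quot_rmod (regular_rmod R) I) (mult (R Quot I))"
proof (intro bimodule.intro right_module_quot_regular quotient_is_ring bimodule_axioms.intro)
  interpret S: ring "R Quot I" by (rule quotient_is_ring)
  fix s x assume s: "s \<in> carrier (R Quot I)" and x: "x \<in> carrier (quot_rmod (regular_rmod R) I)"
  then have x': "x \<in> carrier (R Quot I)" by simp
  show "s \<otimes>\<^bsub>R Quot I\<^esub> x \<in> carrier (quot_rmod (regular_rmod R) I)"
    using S.m_closed[OF s x'] by simp
  show "s \<otimes>\<^bsub>R Quot I\<^esub> (x \<oplus>\<^bsub>quot_rmod (regular_rmod R) I\<^esub> y) =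
    s \<otimes>\<^bsub>R Quot I\<^esub> x \<oplus>\<^bsub>quot_rmod (regular_rmod R) I\<^esub> s \<otimes>\<^bsub>R Quot I\<^esub> y"
    if "y \<in> carrier (quot_rmod (regular_rmod R) I)" for y
    using S.r_distr[OF x' _ s] that by simp
  show "(s \<oplus>\<^bsub>R Quot I\<^esub> t) \<otimes>\<^bsub>R Quot I\<^esub> x =
    s \<otimes>\<^bsub>R Quot I\<^esub> x \<oplus>\<^bsub>quot_rmod (regular_rmod R) I\<^esub> t \<otimes>\<^bsub>R Quot I\<^esub> x"
    if "t \<in> carrier (R Quot I)" for t
    using S.l_distr[OF s that x'] by simp
  show "(s \<otimes>\<^bsub>R Quot I\<^esub> t) \<otimes>\<^bsub>R Quot I\<^esub> x = s \<otimes>\<^bsub>R Quot I\<^esub> (t \<otimes>\<^bsub>R Quot I\<^esub> x)"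
    if "t \<in> carrier (R Quot I)" for t
    using S.m_assoc[OF s that x'] .
  show "s \<otimes>\<^bsub>R Quot I\<^esub> (x \<star>\<^bsub>quot_rmod (regular_rmod R) I\<^esub> r) =
    (s \<otimes>\<^bsub>R Quot I\<^esub> x) \<star>\<^bsub>quot_rmod (regular_rmod R) I\<^esub> r" if r: "r \<in> carrier R" for r
  proof -
    obtain a where a: "a \<in> carrier R" "s = I +> a" using s by (auto elim: rcosetsE)
    obtain b where b: "b \<in> carrier R" "x = I +> b" using x by (auto elim: rcosetsE)
    show ?thesis using a b r by (simp add: rsmult_quot_regular mult_FactRing m_assoc)
  qed
next
  interpret S: ring "R Quot I" by (rule quotient_is_ring)
  fix x assume "x \<in> carrier (quot_rmod (regular_rmod R) I)"
  then show "\<one>\<^bsub>R Quot I\<^esub> \<otimes>\<^bsub>R Quot I\<^esub> x = x" using S.l_one[of x] by simp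
qed

definition rep :: "'a set \<Rightarrow> 'a"
  where "rep C = (SOME c. c \<in> C)"

lemma rep:
  assumes "C \<in> a_rcosets I"
  shows "rep C \<in> carrier R" "I +> rep C = C"
proof -
  obtain x where x: "x \<in> carrier R" "C = I +> x" using assms by (rule rcosetsE)
  then have "rep C \<in> C" using a_rcos_self[OF x(1)] by (auto simp: rep_def intro: someI)
  then show "rep C \<in> carrier R" "I +> rep C = C"
    using x a_elemrcos_carrier a_repr_independence' by auto
qed

text \<open>
  A homomorphism from the free module on the set \<open>R/I\<close> to \<open>R\<close> which lifts the evaluation map to
  \<open>R/I\<close>. It maps the syzygy into \<open>I\<close>, and so turns homomorphisms on \<open>I\<close> into homomorphisms on the
  syzygy. It depends on the choice of representatives, but only up to elements of \<open>I\<close>.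
\<close>

definition lift_eval :: "('a set \<Rightarrow> 'a) \<Rightarrow> 'a"
  where "lift_eval u = lin_comb R (regular_rmod R) rep u"

abbreviation "Free \<equiv> free_rmod R (quot_rmod (regular_rmod R) I)"
abbreviation "Syz \<equiv> syzygy R (quot_rmod (regular_rmod R) I)"

lemma rep_funcset: "rep \<in> carrier (quot_rmod (regular_rmod R) I) \<rightarrow> carrier (regular_rmod R)"
  by (auto simp: rep)

lemma lift_eval_closed: "u \<in> carrier Free \<Longrightarrow> lift_eval u \<in> carrier R"
  and lift_eval_add: "u \<in> carrier Free \<Longrightarrow> v \<in> carrier Free \<Longrightarrow>
    lift_eval (\<lambda>x. u x \<oplus> v x) = lift_eval u \<oplus> lift_eval v"
  and lift_eval_rsmult: "u \<in> carrier Free \<Longrightarrow> r \<in> carrier R \<Longrightarrow>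
    lift_eval (\<lambda>x. u x \<otimes> r) = lift_eval u \<otimes> r"
  unfolding lift_eval_def
  using right_module.lin_comb_closed[OF right_module_regular _ rep_funcset]
    right_module.lin_comb_add[OF right_module_regular _ _ rep_funcset]
    right_module.lin_comb_rsmult[OF right_module_regular _ rep_funcset] by simp_all

lemma coset_lift_eval:
  assumes u: "u \<in> carrier Free"
  shows "I +> lift_eval u = free_eval R (quot_rmod (regular_rmod R) I) u"
proof -
  interpret N: right_module R "quot_rmod (regular_rmod R) I" by (rule right_module_quot_regular)
  have "I +> lift_eval u = lin_comb R (quot_rmod (regular_rmod R) I) (\<lambda>C. I +> rep C) u"
    unfolding lift_eval_def
    by (rule right_module.hom_lin_comb[OF right_module_regular N.right_module_axioms _ _ _ u rep_funcset])
      (simp_all add: rcosetsI a_rcos_sum rsmult_quot_regular)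
  also have "\<dots> = lin_comb R (quot_rmod (regular_rmod R) I) (\<lambda>C. C) u"
    by (rule N.lin_comb_cong[OF u]) (auto simp: rep)
  finally show ?thesis by (simp add: free_eval_eq_lin_comb)
qed

lemma lift_eval_syzygy: "u \<in> carrier Syz \<Longrightarrow> lift_eval u \<in> I"
  using coset_lift_eval[of u] lift_eval_closed[of u] by (simp add: rcos_eq_self_iff)

lemma lift_eval_free_map:
  assumes u: "u \<in> carrier Free" and s: "s \<in> carrier R"
  shows "lift_eval (free_map R (mult (R Quot I) (I +> s)) u) \<ominus> s \<otimes> lift_eval u \<in> I"
proof -
  interpret bimodule R "R Quot I" "quot_rmod (regular_rmod R) I" "mult (R Quot I)"
    by (rule bimodule_quot_regular)
  have sS: "I +> s \<in> carrier (R Quot I)" using s by (simp add: rcosetsI)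
  have "I +> lift_eval (free_map R (mult (R Quot I) (I +> s)) u) =
      (I +> s) \<otimes>\<^bsub>R Quot I\<^esub> (I +> lift_eval u)"
    using coset_lift_eval[OF lact_free_closed[OF sS u]] free_eval_free_map[OF sS u]
      coset_lift_eval[OF u] by simp
  also have "\<dots> = I +> (s \<otimes> lift_eval u)" using s u by (simp add: mult_FactRing lift_eval_closed)
  finally have "I +> lift_eval (free_map R (mult (R Quot I) (I +> s)) u) = I +> (s \<otimes> lift_eval u)" .
  then show ?thesis
    using s u by (simp add: rcos_eq_iff lift_eval_closed lact_free_closed[OF sS])
qed

end

text \<open>
  The classes are defined relative to any submodule \<open>X\<close> of \<open>E\<close>. From the exact sequence
  \<open>0 \<rightarrow> X \<rightarrow> E \<rightarrow> E/X \<rightarrow> 0\<close> they are the image of the connecting map \<open>Hom(R/P, E/X) \<rightarrow> Ext\<^sup>1(R/P, X)\<close>.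
\<close>

locale quotient_ext = ideal P R + E: right_module R E + X: rsubmodule R X E
  for P and R :: "('a, 'm) ring_scheme" (structure) and E :: "('a, 'd, 'e) rmodule_scheme" and X
begin

abbreviation "N \<equiv> quot_rmod (regular_rmod R) P"
abbreviation "M \<equiv> E\<lparr>carrier := X\<rparr>"
abbreviation "Ext \<equiv> ext1 R (mult (R Quot P)) N M"

sublocale ext: ext_setting R "R Quot P" N "mult (R Quot P)" M
  by (intro ext_setting.intro bimodule_quot_regular X.right_module_restrict)

sublocale Ext: right_module "R Quot P" Ext
  by (rule ext.right_module_ext1)

definition transporter :: "'d set"
  where "transporter = {e \<in> carrier E. \<forall>p\<in>P. e \<star>\<^bsub>E\<^esub> p \<in> X}"

definition cocycle :: "'d \<Rightarrow> ('a set \<Rightarrow> 'a) \<Rightarrow> 'd"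
  where "cocycle e = (\<lambda>u\<in>carrier Syz. e \<star>\<^bsub>E\<^esub> lift_eval u)"

definition ext_class :: "'d \<Rightarrow> (('a set \<Rightarrow> 'a) \<Rightarrow> 'd) set"
  where "ext_class e = ext.extendable +>\<^bsub>ext.H\<^esub> cocycle e"

lemma cocycle_closed:
  assumes "e \<in> transporter"
  shows "cocycle e \<in> carrier ext.H"
  unfolding cocycle_def
proof (rule ext.hom_syzygyI)
  have e: "e \<in> carrier E" using assms by (simp add: transporter_def)
  fix u assume u: "u \<in> carrier Syz"
  show "e \<star>\<^bsub>E\<^esub> lift_eval u \<in> carrier M"
    using assms lift_eval_syzygy[OF u] by (simp add: transporter_def)
  show "e \<star>\<^bsub>E\<^esub> lift_eval (\<lambda>x. u x \<oplus> v x) = e \<star>\<^bsub>E\<^esub> lift_eval u \<oplus>\<^bsub>M\<^esub> e \<star>\<^bsub>E\<^esub> lift_eval v"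
    if "v \<in> carrier Syz" for v
    using u that e by (simp add: lift_eval_add lift_eval_closed E.rsmult_r_distr)
  show "e \<star>\<^bsub>E\<^esub> lift_eval (\<lambda>x. u x \<otimes> r) = (e \<star>\<^bsub>E\<^esub> lift_eval u) \<star>\<^bsub>M\<^esub> r" if "r \<in> carrier R" for r
    using u that e by (simp add: lift_eval_rsmult lift_eval_closed E.rsmult_assoc)
qed

lemma ext_class_closed: "e \<in> transporter \<Longrightarrow> ext_class e \<in> carrier Ext"
  using abelian_group.a_rcosetsI[OF abelian_subgroup.axioms(2)[OF ext.abelian_subgroup_extendable]
    additive_subgroup.a_subset[OF abelian_subgroup.axioms(1)[OF ext.abelian_subgroup_extendable]]
    cocycle_closed]
  by (simp add: ext.ext1_eq ext_class_def)

lemma zero_Ext: "\<zero>\<^bsub>Ext\<^esub> = ext.extendable"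
  by (simp add: ext.ext1_eq)

lemma transporter_rsmult:
  "e \<in> transporter \<Longrightarrow> r \<in> carrier R \<Longrightarrow> e \<star>\<^bsub>E\<^esub> r \<in> transporter"
  by (auto simp: transporter_def E.rsmult_closed E.rsmult_assoc[symmetric] I_l_closed)

lemma ext_class_add:
  assumes e: "e \<in> transporter" and e': "e' \<in> transporter"
  shows "ext_class e \<oplus>\<^bsub>Ext\<^esub> ext_class e' = ext_class (e \<oplus>\<^bsub>E\<^esub> e')"
proof -
  have "cocycle e \<oplus>\<^bsub>ext.H\<^esub> cocycle e' = cocycle (e \<oplus>\<^bsub>E\<^esub> e')"
    using e e' by (auto simp: cocycle_def transporter_def E.rsmult_l_distr lift_eval_closed)
  then show ?thesis
    unfolding ext.ext1_eq ext_class_def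
    using abelian_subgroup.a_rcos_sum[OF ext.abelian_subgroup_extendable
      cocycle_closed[OF e] cocycle_closed[OF e']] by simp
qed

text \<open>
  The coset of \<open>s\<close> moves the basis element at \<open>C\<close> to the one at \<open>sC\<close>, whereas \<open>es\<close> multiplies the
  representative of \<open>C\<close> by \<open>s\<close>. The two agree modulo \<open>P\<close>, so the cocycles differ by \<open>u \<mapsto> e\<delta>(u)\<close> with \<open>\<delta>\<close>
  defined on the whole free module and having values in \<open>P\<close>; this has values in \<open>X\<close> and extends.
\<close>

lemma ext_class_rsmult:
  assumes e: "e \<in> transporter" and s: "s \<in> carrier R"
  shows "ext_class e \<star>\<^bsub>Ext\<^esub> (P +> s) = ext_class (e \<star>\<^bsub>E\<^esub> s)"
proof -
  interpret H: abelian_subgroup ext.extendable ext.H by (rule ext.abelian_subgroup_extendable)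
  have sS: "P +> s \<in> carrier (R Quot P)" using s by (simp add: rcosetsI)
  have eE: "e \<in> carrier E" and eX: "\<And>p. p \<in> P \<Longrightarrow> e \<star>\<^bsub>E\<^esub> p \<in> X"
    using e by (auto simp: transporter_def)
  note D = ext.hom_syzygyD[OF cocycle_closed[OF e]]
  let ?m = "free_map R (mult (R Quot P) (P +> s))"
  define \<delta> where "\<delta> u = lift_eval (?m u) \<ominus> s \<otimes> lift_eval u" for u
  have m: "?m u \<in> carrier Free" if "u \<in> carrier Free" for u by (rule ext.lact_free_closed[OF sS that])
  have \<delta>P: "\<delta> u \<in> P" if "u \<in> carrier Free" for u
    unfolding \<delta>_def by (rule lift_eval_free_map[OF that s])
  have \<delta>: "(\<lambda>u\<in>carrier Syz. e \<star>\<^bsub>E\<^esub> \<delta> u) \<in> ext.extendable"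
  proof (rule ext.extendableI)
    fix u assume u: "u \<in> carrier Free"
    have \<delta>u: "\<delta> u \<in> carrier R" using \<delta>P[OF u] by simp
    show "e \<star>\<^bsub>E\<^esub> \<delta> u \<in> carrier M" using eX[OF \<delta>P[OF u]] by simp
    show "e \<star>\<^bsub>E\<^esub> \<delta> (\<lambda>x. u x \<oplus> v x) = e \<star>\<^bsub>E\<^esub> \<delta> u \<oplus>\<^bsub>M\<^esub> e \<star>\<^bsub>E\<^esub> \<delta> v" if v: "v \<in> carrier Free" for v
    proof -
      have "\<delta> (\<lambda>x. u x \<oplus> v x) = \<delta> u \<oplus> \<delta> v"
        using u v m s lift_eval_closed by (simp add: \<delta>_def free_map_add[OF u v] lift_eval_add r_distr
            minus_eq minus_add a_ac)
      moreover have "\<delta> v \<in> carrier R" using \<delta>P[OF v] by simp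
      ultimately show ?thesis using eE \<delta>u by (simp add: E.rsmult_r_distr)
    qed
    show "e \<star>\<^bsub>E\<^esub> \<delta> (\<lambda>x. u x \<otimes> r) = (e \<star>\<^bsub>E\<^esub> \<delta> u) \<star>\<^bsub>M\<^esub> r" if r: "r \<in> carrier R" for r
    proof -
      have "\<delta> (\<lambda>x. u x \<otimes> r) = \<delta> u \<otimes> r"
        using u m s r lift_eval_closed by (simp add: \<delta>_def free_map_rsmult[OF u r] lift_eval_rsmult
            minus_eq l_distr m_assoc l_minus)
      then show ?thesis using eE \<delta>u r by (simp add: E.rsmult_assoc)
    qed
  qed
  have "cocycle e \<star>\<^bsub>ext.H\<^esub> (P +> s) = (\<lambda>u\<in>carrier Syz. e \<star>\<^bsub>E\<^esub> \<delta> u) \<oplus>\<^bsub>ext.H\<^esub> cocycle (e \<star>\<^bsub>E\<^esub> s)"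
  proof -
    have "cocycle e (?m u) = e \<star>\<^bsub>E\<^esub> \<delta> u \<oplus>\<^bsub>E\<^esub> (e \<star>\<^bsub>E\<^esub> s) \<star>\<^bsub>E\<^esub> lift_eval u" if u: "u \<in> carrier Syz" for u
    proof -
      have uF: "u \<in> carrier Free" using u by simp
      have "?m u \<in> carrier Syz" by (rule ext.lact_syzygy_closed[OF sS u])
      then have "cocycle e (?m u) = e \<star>\<^bsub>E\<^esub> lift_eval (?m u)" by (simp add: cocycle_def)
      also have "lift_eval (?m u) = \<delta> u \<oplus> s \<otimes> lift_eval u"
        using lift_eval_closed[OF uF] lift_eval_closed[OF m[OF uF]] s
        by (simp add: \<delta>_def minus_eq a_assoc l_neg)
      also have "e \<star>\<^bsub>E\<^esub> \<dots> = e \<star>\<^bsub>E\<^esub> \<delta> u \<oplus>\<^bsub>E\<^esub> (e \<star>\<^bsub>E\<^esub> s) \<star>\<^bsub>E\<^esub> lift_eval u"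
        using eE s lift_eval_closed[OF uF] a_Hcarr[OF \<delta>P[OF uF]]
        by (simp add: E.rsmult_r_distr E.rsmult_assoc)
      finally show ?thesis .
    qed
    then show ?thesis by (auto simp: cocycle_def[of "e \<star>\<^bsub>E\<^esub> s"] intro!: restrict_ext)
  qed
  then have "ext.extendable +>\<^bsub>ext.H\<^esub> (cocycle e \<star>\<^bsub>ext.H\<^esub> (P +> s)) = ext_class (e \<star>\<^bsub>E\<^esub> s)"
    using H.rcos_add_absorb[OF \<delta> cocycle_closed[OF transporter_rsmult[OF e s]]]
    by (simp add: ext_class_def)
  moreover have "ext_class e \<star>\<^bsub>Ext\<^esub> (P +> s) = ext.extendable +>\<^bsub>ext.H\<^esub> (cocycle e \<star>\<^bsub>ext.H\<^esub> (P +> s))"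
    unfolding ext.ext1_eq ext_class_def
  proof (rule rsmult_quot_rmod[OF ext.abelian_subgroup_extendable cocycle_closed[OF e]
      ext.rsmult_closed_hom[OF cocycle_closed[OF e] sS] ext.extendable_rsmult[OF _ sS]])
    fix h assume "h \<in> ext.extendable"
    show "(h \<oplus>\<^bsub>ext.H\<^esub> cocycle e) \<star>\<^bsub>ext.H\<^esub> (P +> s) = h \<star>\<^bsub>ext.H\<^esub> (P +> s) \<oplus>\<^bsub>ext.H\<^esub> cocycle e \<star>\<^bsub>ext.H\<^esub> (P +> s)"
      using ext.lact_syzygy_closed[OF sS] by (auto intro!: restrict_ext)
  qed
  ultimately show ?thesis by simp
qed

lemma ext_class_eq_zero:
  assumes m: "m \<in> X"
  shows "ext_class m = \<zero>\<^bsub>Ext\<^esub>"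
proof -
  have mE: "m \<in> carrier E" using m by simp
  have "cocycle m \<in> ext.extendable"
    unfolding cocycle_def
    by (rule ext.extendableI) (use m mE in \<open>simp_all add: lift_eval_closed lift_eval_add lift_eval_rsmult
        X.rsmult_sub_closed E.rsmult_r_distr E.rsmult_assoc\<close>)
  then show ?thesis
    using abelian_subgroup.a_rcos_const[OF ext.abelian_subgroup_extendable]
    by (simp add: zero_Ext ext_class_def)
qed

text \<open>
  It suffices to evaluate at the element \<open>u\<close> of the syzygy which is \<open>p\<close> at the coset \<open>C\<close> of \<open>1\<close> and
  zero elsewhere. The representative of \<open>C\<close> is \<open>p\<^sub>0 + 1\<close> with \<open>p\<^sub>0 \<in> P\<close>, so the cocycle has the value
  \<open>ep\<^sub>0p + ep\<close>, while a map \<open>f\<close> extending it has the value \<open>f(b)p\<close>, \<open>b\<close> being the basis element at \<open>C\<close>.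
  Thus \<open>m = f(b) - ep\<^sub>0\<close>.
\<close>

lemma ext_class_zeroD:
  assumes e: "e \<in> transporter" and zero: "ext_class e = \<zero>\<^bsub>Ext\<^esub>"
  shows "\<exists>m\<in>X. \<forall>p\<in>P. e \<star>\<^bsub>E\<^esub> p = m \<star>\<^bsub>E\<^esub> p"
proof -
  have eE: "e \<in> carrier E" and eX: "\<And>p. p \<in> P \<Longrightarrow> e \<star>\<^bsub>E\<^esub> p \<in> X"
    using e by (auto simp: transporter_def)
  have "cocycle e \<in> ext.extendable"
    using zero abelian_subgroup.rcos_eq_self_iff[OF ext.abelian_subgroup_extendable cocycle_closed[OF e]]
    by (simp add: zero_Ext ext_class_def)
  then obtain f where ef: "cocycle e = (\<lambda>u\<in>carrier Syz. f u)" and f_hom: "f \<in> rmod_hom R Free M"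
    by (rule ext.extendableE)
  note f = ext.free_homD[OF f_hom]
  define C where "C = P +> \<one>"
  have C: "C \<in> carrier N" by (simp add: C_def rcosetsI)
  have C': "C \<in> a_rcosets P" using C by simp
  define p\<^sub>0 where "p\<^sub>0 = rep C \<ominus> \<one>"
  have p0: "p\<^sub>0 \<in> P" using rep[OF C'] by (simp add: p\<^sub>0_def C_def flip: rcos_eq_iff)
  have rep_eq: "rep C = p\<^sub>0 \<oplus> \<one>"
    using rep(1)[OF C'] by (simp add: p\<^sub>0_def minus_eq a_assoc l_neg)
  define m where "m = f (single R C \<one>) \<oplus>\<^bsub>E\<^esub> \<ominus>\<^bsub>E\<^esub> (e \<star>\<^bsub>E\<^esub> p\<^sub>0)"
  have b: "single R C \<one> \<in> carrier Free" by (rule single_closed[OF C]) simp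
  have fX: "f (single R C \<one>) \<in> X" using f(1)[OF b] by simp
  have "m \<in> X" using fX eX[OF p0] by (simp add: m_def)
  moreover have "e \<star>\<^bsub>E\<^esub> p = m \<star>\<^bsub>E\<^esub> p" if p: "p \<in> P" for p
  proof -
    have pR: "p \<in> carrier R" "p\<^sub>0 \<in> carrier R" using p p0 by simp_all
    have sF: "single R C p \<in> carrier Free" by (rule single_closed[OF C pR(1)])
    have "free_eval R N (single R C p) = C \<star>\<^bsub>N\<^esub> p"
      unfolding free_eval_eq_lin_comb 
      by (rule right_module.lin_comb_single[OF right_module_quot_regular]) (use C pR in simp_all)
    also have "\<dots> = \<zero>\<^bsub>N\<^esub>" using pR p by (simp add: C_def rsmult_quot_regular a_rcos_const)
    finally have sK: "single R C p \<in> carrier Syz" using sF by simp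
    have "cocycle e (single R C p) = f (single R C p)"
      using ef sK by simp
    moreover have "cocycle e (single R C p) = e \<star>\<^bsub>E\<^esub> (rep C \<otimes> p)"
      using sK right_module.lin_comb_single[OF right_module_regular, of rep C p] rep(1)[OF C'] pR by (simp add: cocycle_def lift_eval_def)
    moreover have "single R C p = (\<lambda>x. single R C \<one> x \<otimes> p)" using pR by (auto simp: single_def)
    then have "f (single R C p) = f (single R C \<one>) \<star>\<^bsub>E\<^esub> p" using f(3)[OF b pR(1)] by simp
    ultimately have "f (single R C \<one>) \<star>\<^bsub>E\<^esub> p = e \<star>\<^bsub>E\<^esub> (p\<^sub>0 \<otimes> p \<oplus> p)"
      using pR by (simp add: rep_eq l_distr)
    also have "\<dots> = (e \<star>\<^bsub>E\<^esub> p\<^sub>0) \<star>\<^bsub>E\<^esub> p \<oplus>\<^bsub>E\<^esub> e \<star>\<^bsub>E\<^esub> p"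
      using eE pR by (simp add: E.rsmult_r_distr E.rsmult_assoc)
    finally have fp: "f (single R C \<one>) \<star>\<^bsub>E\<^esub> p = (e \<star>\<^bsub>E\<^esub> p\<^sub>0) \<star>\<^bsub>E\<^esub> p \<oplus>\<^bsub>E\<^esub> e \<star>\<^bsub>E\<^esub> p" .
    have neg: "(\<ominus>\<^bsub>E\<^esub> (e \<star>\<^bsub>E\<^esub> p\<^sub>0)) \<star>\<^bsub>E\<^esub> p = \<ominus>\<^bsub>E\<^esub> ((e \<star>\<^bsub>E\<^esub> p\<^sub>0) \<star>\<^bsub>E\<^esub> p)"
      using E.rsmult_l_distr[of "\<ominus>\<^bsub>E\<^esub> (e \<star>\<^bsub>E\<^esub> p\<^sub>0)" "e \<star>\<^bsub>E\<^esub> p\<^sub>0" p] eE pR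
      by (intro E.M.minus_equality[symmetric])
        (simp_all add: E.rsmult_closed E.M.l_neg E.zero_rsmult)
    have "m \<star>\<^bsub>E\<^esub> p = f (single R C \<one>) \<star>\<^bsub>E\<^esub> p \<oplus>\<^bsub>E\<^esub> \<ominus>\<^bsub>E\<^esub> ((e \<star>\<^bsub>E\<^esub> p\<^sub>0) \<star>\<^bsub>E\<^esub> p)"
      unfolding m_def neg[symmetric] using fX eE pR by (simp add: E.rsmult_l_distr E.rsmult_closed)
    also have "\<dots> = e \<star>\<^bsub>E\<^esub> p"
      unfolding fp using eE pR by (simp add: E.rsmult_closed E.M.a_ac E.M.r_neg1 E.M.r_neg2 E.M.r_neg)
    finally show ?thesis by simp
  qed
  ultimately show ?thesis by blast
qed

end

section \<open>Prime factor rings and ideal factors\<close>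

text \<open>
  The definition of primeness speaks of ideals. In place of the ideals generated by \<open>a\<close> and \<open>b\<close>, take
  \<open>J = {y. aRy \<subseteq> P}\<close>, which contains \<open>b\<close>, and \<open>{x. xRJ \<subseteq> P}\<close>, which contains \<open>a\<close>; their product lies
  in \<open>P\<close>.
\<close>

lemma nc_prime_idealD:
  assumes "ring R" and P: "nc_prime_ideal R P" and ab: "a \<in> carrier R" "b \<in> carrier R"
    and asb: "\<And>s. s \<in> carrier R \<Longrightarrow> a \<otimes>\<^bsub>R\<^esub> s \<otimes>\<^bsub>R\<^esub> b \<in> P"
  shows "a \<in> P \<or> b \<in> P"
proof -
  interpret P: ideal P R using P by (simp add: nc_prime_ideal_def)
  define J where "J = {y \<in> carrier R. \<forall>s\<in>carrier R. a \<otimes>\<^bsub>R\<^esub> s \<otimes>\<^bsub>R\<^esub> y \<in> P}"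
  define I where "I = {x \<in> carrier R. \<forall>s\<in>carrier R. \<forall>y\<in>J. x \<otimes>\<^bsub>R\<^esub> s \<otimes>\<^bsub>R\<^esub> y \<in> P}"
  have J: "ideal J R"
  proof (rule idealI[OF P.ring_axioms])
    show "subgroup J (add_monoid R)"
      by (rule P.add.subgroupI) (use ab in \<open>auto simp: J_def P.r_distr P.r_minus\<close>)
    fix y x assume y: "y \<in> J" and x: "x \<in> carrier R"
    show "x \<otimes>\<^bsub>R\<^esub> y \<in> J"
    proof -
      have "a \<otimes>\<^bsub>R\<^esub> s \<otimes>\<^bsub>R\<^esub> (x \<otimes>\<^bsub>R\<^esub> y) = a \<otimes>\<^bsub>R\<^esub> (s \<otimes>\<^bsub>R\<^esub> x) \<otimes>\<^bsub>R\<^esub> y" if "s \<in> carrier R" for s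
        using that ab x y by (simp add: J_def P.m_assoc)
      then show ?thesis using x y by (simp add: J_def)
    qed
    show "y \<otimes>\<^bsub>R\<^esub> x \<in> J"
    proof -
      have "a \<otimes>\<^bsub>R\<^esub> s \<otimes>\<^bsub>R\<^esub> (y \<otimes>\<^bsub>R\<^esub> x) = a \<otimes>\<^bsub>R\<^esub> s \<otimes>\<^bsub>R\<^esub> y \<otimes>\<^bsub>R\<^esub> x" if "s \<in> carrier R" for s
        using that ab x y by (simp add: J_def P.m_assoc)
      then show ?thesis using x y by (simp add: J_def P.I_r_closed)
    qed
  qed
  interpret J: ideal J R by (rule J)
  have I: "ideal I R"
  proof (rule idealI[OF P.ring_axioms])
    show "subgroup I (add_monoid R)"
      by (rule P.add.subgroupI) (auto simp: I_def P.l_distr P.l_minus)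
    fix y x assume y: "y \<in> I" and x: "x \<in> carrier R"
    show "x \<otimes>\<^bsub>R\<^esub> y \<in> I"
    proof -
      have "x \<otimes>\<^bsub>R\<^esub> y \<otimes>\<^bsub>R\<^esub> s \<otimes>\<^bsub>R\<^esub> z = x \<otimes>\<^bsub>R\<^esub> (y \<otimes>\<^bsub>R\<^esub> s \<otimes>\<^bsub>R\<^esub> z)" if "s \<in> carrier R" "z \<in> J" for s z
        using that x y by (simp add: I_def P.m_assoc)
      then show ?thesis using x y by (simp add: I_def P.I_l_closed)
    qed
    show "y \<otimes>\<^bsub>R\<^esub> x \<in> I"
    proof -
      have "y \<otimes>\<^bsub>R\<^esub> x \<otimes>\<^bsub>R\<^esub> s \<otimes>\<^bsub>R\<^esub> z = y \<otimes>\<^bsub>R\<^esub> (x \<otimes>\<^bsub>R\<^esub> s) \<otimes>\<^bsub>R\<^esub> z" if "s \<in> carrier R" "z \<in> J" for s z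
        using that x y by (simp add: I_def P.m_assoc)
      then show ?thesis using x y by (simp add: I_def)
    qed
  qed
  have "ideal_prod R I J \<subseteq> P"
  proof
    fix z assume "z \<in> ideal_prod R I J"
    then show "z \<in> P"
    proof (induction rule: ideal_prod.induct)
      case (prod i j)
      then have "i \<otimes>\<^bsub>R\<^esub> \<one>\<^bsub>R\<^esub> \<otimes>\<^bsub>R\<^esub> j \<in> P" by (simp add: I_def del: P.r_one)
      then show ?case using prod by (simp add: I_def)
    qed simp
  qed
  then have "I \<subseteq> P \<or> J \<subseteq> P" using P I J by (simp add: nc_prime_ideal_def)
  moreover have "b \<in> J" unfolding J_def using ab(2) asb by blast
  moreover have "a \<in> I" unfolding I_def J_def using ab(1) by blast
  ultimately show ?thesis by blast
qed

context ideal
begin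

lemma right_ideal_coset_preimage:
  assumes J: "right_ideal (R Quot I) J"
  shows "right_ideal R {x \<in> carrier R. I +> x \<in> J}"
proof -
  interpret S: ring "R Quot I" by (rule quotient_is_ring)
  note D = S.right_idealD[OF J]
  show ?thesis
  proof (rule right_idealI)
    show "\<zero> \<in> {x \<in> carrier R. I +> x \<in> J}" using D(2) by (simp add: a_rcos_const)
    show "x \<oplus> y \<in> {x \<in> carrier R. I +> x \<in> J}"
      if "x \<in> {x \<in> carrier R. I +> x \<in> J}" "y \<in> {x \<in> carrier R. I +> x \<in> J}" for x y
      using that D(3)[of "I +> x" "I +> y"] by (simp add: a_rcos_sum)
    show "x \<otimes> r \<in> {x \<in> carrier R. I +> x \<in> J}"
      if "x \<in> {x \<in> carrier R. I +> x \<in> J}" "r \<in> carrier R" for x r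
      using that D(4)[of "I +> x" "I +> r"] by (simp add: mult_FactRing rcosetsI)
  qed auto
qed

lemma right_ideal_coset_image:
  assumes J: "right_ideal R J"
  shows "right_ideal (R Quot I) ((+>) I ` J)"
proof -
  interpret S: ring "R Quot I" by (rule quotient_is_ring)
  note D = right_idealD[OF J]
  have sub: "x \<in> carrier R" if "x \<in> J" for x using D(1) that by blast
  show ?thesis
  proof (rule S.right_idealI)
    show "(+>) I ` J \<subseteq> carrier (R Quot I)" using sub by (auto intro: rcosetsI)
    show "\<zero>\<^bsub>R Quot I\<^esub> \<in> (+>) I ` J"
      using D(2) by (intro image_eqI[of _ _ \<zero>]) (simp_all add: a_rcos_const)
    show "X \<oplus>\<^bsub>R Quot I\<^esub> Y \<in> (+>) I ` J" if "X \<in> (+>) I ` J" "Y \<in> (+>) I ` J" for X Y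
      using that sub D(3) by (auto simp: a_rcos_sum)
    show "X \<otimes>\<^bsub>R Quot I\<^esub> C \<in> (+>) I ` J" if X: "X \<in> (+>) I ` J" and C: "C \<in> carrier (R Quot I)" for X C
    proof -
      obtain r where r: "r \<in> carrier R" "C = I +> r" using C by (auto elim: rcosetsE)
      obtain x where x: "x \<in> J" "X = I +> x" using X by blast
      show ?thesis using r x sub D(4) by (simp add: mult_FactRing)
    qed
  qed
qed

lemma right_noetherian_FactRing:
  assumes "right_noetherian R"
  shows "right_noetherian (R Quot I)"
  unfolding right_noetherian_def
proof (intro conjI allI impI)
  interpret S: ring "R Quot I" by (rule quotient_is_ring)
  show "ring (R Quot I)" by (rule quotient_is_ring)
  fix J :: "nat \<Rightarrow> 'a set set"
  assume J: "(\<forall>n. right_ideal (R Quot I) (J n)) \<and> (\<forall>n. J n \<subseteq> J (Suc n))"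
  let ?p = "\<lambda>n. {x \<in> carrier R. I +> x \<in> J n}"
  have "\<forall>n. right_ideal R (?p n)" using J right_ideal_coset_preimage by blast
  moreover have "\<forall>n. ?p n \<subseteq> ?p (Suc n)" using J by blast
  ultimately obtain n where n: "\<forall>m\<ge>n. ?p m = ?p n"
    using assms unfolding right_noetherian_def by meson
  have Jeq: "J m = (+>) I ` ?p m" for m
  proof -
    have "J m \<subseteq> a_rcosets I" using S.right_idealD(1)[of "J m"] J by simp
    then show ?thesis by (auto simp: A_RCOSETS_def')
  qed
  show "\<exists>n. \<forall>m\<ge>n. J m = J n"
  proof (intro exI[of _ n] allI impI)
    fix m assume "n \<le> m"
    then have eq: "?p m = ?p n" using n by blast
    have "J m = (+>) I ` ?p m" by (rule Jeq)
    also have "\<dots> = (+>) I ` ?p n" by (simp only: eq)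
    also have "\<dots> = J n" by (rule Jeq[symmetric])
    finally show "J m = J n" .
  qed
qed

lemma prime_right_noetherian_FactRing:
  assumes R: "right_noetherian R" and prime: "nc_prime_ideal R I"
  shows "prime_right_noetherian_ring (R Quot I)"
proof (intro prime_right_noetherian_ring.intro quotient_is_ring prime_right_noetherian_ring_axioms.intro
    right_noetherian_FactRing R)
  fix X Y assume X: "X \<in> carrier (R Quot I)" and Y: "Y \<in> carrier (R Quot I)"
    and XY: "\<And>Z. Z \<in> carrier (R Quot I) \<Longrightarrow> X \<otimes>\<^bsub>R Quot I\<^esub> Z \<otimes>\<^bsub>R Quot I\<^esub> Y = \<zero>\<^bsub>R Quot I\<^esub>"
  obtain x where x: "x \<in> carrier R" "X = I +> x" using X by (auto elim: rcosetsE)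
  obtain y where y: "y \<in> carrier R" "Y = I +> y" using Y by (auto elim: rcosetsE)
  have "x \<otimes> s \<otimes> y \<in> I" if s: "s \<in> carrier R" for s
    using XY[of "I +> s"] x y s by (simp add: mult_FactRing rcosetsI rcos_eq_self_iff)
  then show "X = \<zero>\<^bsub>R Quot I\<^esub> \<or> Y = \<zero>\<^bsub>R Quot I\<^esub>"
    using nc_prime_idealD[OF ring_axioms prime x(1) y(1)] x y by (simp add: rcos_eq_self_iff)
qed

end

lemma (in ring) ring_opp_ring: "ring (opp_ring R)"
proof (rule ringI)
  show "abelian_group (opp_ring R)"
    by (rule abelian_groupI) (auto simp: opp_ring_def a_ac intro: l_neg)
  show "Group.monoid (opp_ring R)"
    by (rule monoidI) (auto simp: opp_ring_def m_assoc)
qed (auto simp: opp_ring_def l_distr r_distr)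

lemma opp_ring_simps [simp]:
  "carrier (opp_ring R) = carrier R" "zero (opp_ring R) = zero R" "add (opp_ring R) = add R"
  "mult (opp_ring R) x y = mult R y x"
  by (simp_all add: opp_ring_def)

lemma coset_opp_ring [simp]: "a_r_coset (opp_ring R) = a_r_coset R"
  by (simp add: fun_eq_iff a_r_coset_def')

text \<open>The action on \<open>I/A\<close> in terms of representatives, stated for right ideals so that it applies to
  the opposite ring as well.\<close>

lemma (in ring) ideal_quot_act:
  assumes I: "right_ideal R I" and A: "right_ideal R A" "A \<subseteq> I"
    and x: "x \<in> I" and c: "c \<in> carrier R"
    and J: "\<zero> \<in> J" "J \<subseteq> carrier R" "\<And>q. q \<in> J \<Longrightarrow> x \<otimes> q \<in> A"
  shows "A +> x \<in> carrier (factor_rmod (ideal_quot R I A))"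
    and "(A +> x) \<star>\<^bsub>factor_rmod (ideal_quot R I A)\<^esub> (J +> c) = A +> (x \<otimes> c)"
    and "X \<in> carrier (factor_rmod (ideal_quot R I A)) \<Longrightarrow> \<exists>y\<in>I. X = A +> y"
    and "\<zero>\<^bsub>factor_rmod (ideal_quot R I A)\<^esub> = A"
proof -
  note DI = right_idealD[OF I] and DA = right_idealD[OF A(1)]
  let ?M = "(regular_rmod R)\<lparr>carrier := I\<rparr>"
  have xR: "x \<in> carrier R" using x DI(1) by blast
  have coset: "a_r_coset ?M A = a_r_coset R A" by (simp add: fun_eq_iff a_r_coset_def')
  interpret M: right_module R ?M by (rule rsubmodule.right_module_restrict[OF I])
  have "rsubmodule R A ?M"
    by (rule M.rsubmoduleI) (use A(2) DA in auto)
  then have sub: "abelian_subgroup A ?M"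
    by (auto intro!: abelian_subgroupI3 M.M.abelian_group_axioms simp: rsubmodule_def)
  have sub': "abelian_subgroup A R"
    by (intro abelian_subgroupI3 additive_subgroup.intro add.subgroupI abelian_group_axioms)
      (use DA in blast)+
  show "A +> x \<in> carrier (factor_rmod (ideal_quot R I A))"
    using x by (auto simp: factor_rmod_def ideal_quot_def A_RCOSETS_def' coset)
  show "X \<in> carrier (factor_rmod (ideal_quot R I A)) \<Longrightarrow> \<exists>y\<in>I. X = A +> y"
    by (auto simp: factor_rmod_def ideal_quot_def A_RCOSETS_def' coset)
  show "\<zero>\<^bsub>factor_rmod (ideal_quot R I A)\<^esub> = A"
    by (simp add: factor_rmod_def ideal_quot_def)
  have act: "(A +> x) \<star>\<^bsub>ideal_quot R I A\<^esub> r = A +> (x \<otimes> r)" if r: "r \<in> carrier R" for r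
    unfolding ideal_quot_def coset[symmetric]
  proof (subst rsmult_quot_rmod[OF sub])
    show "x \<in> carrier ?M" using x by simp
    show "x \<star>\<^bsub>?M\<^esub> r \<in> carrier ?M" using DI(4)[OF x r] by simp
    fix y assume y: "y \<in> A"
    show "y \<star>\<^bsub>?M\<^esub> r \<in> A" using DA(4)[OF y r] by simp
    show "(y \<oplus>\<^bsub>?M\<^esub> x) \<star>\<^bsub>?M\<^esub> r = y \<star>\<^bsub>?M\<^esub> r \<oplus>\<^bsub>?M\<^esub> x \<star>\<^bsub>?M\<^esub> r"
      using l_distr xR r subsetD[OF DA(1) y] by simp
  qed simp
  have "(A +> x) \<star>\<^bsub>ideal_quot R I A\<^esub> r = A +> (x \<otimes> c)" if "r \<in> J +> c" for r
  proof -
    from that obtain q where q: "q \<in> J" "r = q \<oplus> c" by (auto simp: a_r_coset_def')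
    have qR: "q \<in> carrier R" using q J(2) by blast
    have "(A +> x) \<star>\<^bsub>ideal_quot R I A\<^esub> r = A +> (x \<otimes> q \<oplus> x \<otimes> c)"
      using act q qR c xR by (simp add: r_distr)
    also have "\<dots> = A +> (x \<otimes> c)"
      using abelian_subgroup.rcos_add_absorb[OF sub' J(3)[OF q(1)]] xR c by simp
    finally show ?thesis .
  qed
  moreover have "\<zero> \<oplus> c \<in> J +> c" using J(1) by (auto simp: a_r_coset_def')
  ultimately have "(\<lambda>r. (A +> x) \<star>\<^bsub>ideal_quot R I A\<^esub> r) ` (J +> c) = {A +> (x \<otimes> c)}" by blast
  then show "(A +> x) \<star>\<^bsub>factor_rmod (ideal_quot R I A)\<^esub> (J +> c) = A +> (x \<otimes> c)"
    by (simp add: factor_rmod_def)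
qed

section \<open>Separating elements of the injective hull\<close>

context ideal
begin

lemma right_ideal_of_rsubmodule:
  assumes "rsubmodule R U (quot_rmod (regular_rmod R) I)"
  shows "right_ideal (R Quot I) U"
proof -
  interpret U: rsubmodule R U "quot_rmod (regular_rmod R) I" by fact
  interpret S: ring "R Quot I" by (rule quotient_is_ring)
  show ?thesis
  proof (rule S.right_idealI)
    show sub: "U \<subseteq> carrier (R Quot I)" using U.a_subset by simp
    fix C D assume C: "C \<in> U" and D: "D \<in> carrier (R Quot I)"
    obtain r where r: "r \<in> carrier R" "D = I +> r" using D by (auto elim: rcosetsE)
    obtain x where x: "x \<in> carrier R" "C = I +> x" using C sub by (auto elim: rcosetsE)
    show "C \<otimes>\<^bsub>R Quot I\<^esub> D \<in> U"
      using U.rsmult_sub_closed[OF C r(1)] x r by (simp add: mult_FactRing rsmult_quot_regular)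
  next
    show "\<zero>\<^bsub>R Quot I\<^esub> \<in> U" using U.zero_closed by simp
    show "C \<oplus>\<^bsub>R Quot I\<^esub> D \<in> U" if "C \<in> U" "D \<in> U" for C D
      using U.a_closed[OF that] by simp
  qed
qed

text \<open>
  \<open>uniform_right_ideal_translate\<close> for the factor ring and the annihilator of \<open>x + A\<close> in it, expressed
  by representatives in \<open>R\<close>.
\<close>

lemma uniform_translate:
  assumes R: "right_noetherian R" and prime: "nc_prime_ideal R I"
    and U: "rsubmodule R U (quot_rmod (regular_rmod R) I)"
    and uniform: "uniform_rmod R ((quot_rmod (regular_rmod R) I)\<lparr>carrier := U\<rparr>)"
    and A: "right_ideal R A" and x: "x \<in> carrier R" "\<And>q. q \<in> I \<Longrightarrow> x \<otimes> q \<in> A"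
    and noreg: "\<And>c. c \<in> carrier R \<Longrightarrow> x \<otimes> c \<in> A \<Longrightarrow> \<not> regular_elem (R Quot I) (I +> c)"
  shows "\<exists>v\<in>carrier R. \<forall>r\<in>carrier R. I +> r \<in> U \<longrightarrow> x \<otimes> v \<otimes> r \<in> A \<longrightarrow> r \<in> I"
proof -
  interpret S: prime_right_noetherian_ring "R Quot I"
    by (rule prime_right_noetherian_FactRing[OF R prime])
  let ?U = "(quot_rmod (regular_rmod R) I)\<lparr>carrier := U\<rparr>"
  have U_mod: "right_module R ?U" and nz: "U \<noteq> {I}"
    and unif: "\<And>J J'. rsubmodule R J ?U \<Longrightarrow> rsubmodule R J' ?U \<Longrightarrow> J \<noteq> {I} \<Longrightarrow> J' \<noteq> {I} \<Longrightarrow> J \<inter> J' \<noteq> {I}"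
    using uniform by (auto simp: uniform_rmod_def)
  have sub: "rsubmodule R J ?U" if J: "right_ideal (R Quot I) J" "J \<subseteq> U" for J
  proof (rule right_module.rsubmoduleI[OF U_mod])
    note D = S.right_idealD[OF J(1)]
    show "C \<star>\<^bsub>?U\<^esub> r \<in> J" if C: "C \<in> J" and r: "r \<in> carrier R" for C r
    proof -
      obtain y where y: "y \<in> carrier R" "C = I +> y" using C D(1) by (auto elim: rcosetsE)
      show ?thesis using D(4)[OF C, of "I +> r"] y r
        by (simp add: mult_FactRing rsmult_quot_regular rcosetsI)
    qed
    show "C \<oplus>\<^bsub>?U\<^esub> C' \<in> J" if "C \<in> J" "C' \<in> J" for C C' using D(3)[OF that] by simp
    show "\<zero>\<^bsub>?U\<^esub> \<in> J" using D(2) by simp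
    show "J \<subseteq> carrier ?U" using J(2) by simp
  qed
  define L where "L = (+>) I ` {r \<in> carrier R. x \<otimes> r \<in> A}"
  have L: "right_ideal (R Quot I) L"
    unfolding L_def by (intro right_ideal_coset_image right_ideal_preimage A x)
  have in_L: "x \<otimes> r \<in> A" if r: "r \<in> carrier R" "I +> r \<in> L" for r
  proof -
    from r obtain r' where r': "r' \<in> carrier R" "x \<otimes> r' \<in> A" "I +> r = I +> r'" by (auto simp: L_def)
    then have "r \<ominus> r' \<in> I" using r by (simp add: rcos_eq_iff)
    then have "x \<otimes> (r \<ominus> r') \<oplus> x \<otimes> r' \<in> A" by (intro right_idealD(3)[OF A] x r')
    moreover have "x \<otimes> (r \<ominus> r') \<oplus> x \<otimes> r' = x \<otimes> r"
      using x r r' by (simp add: minus_eq a_assoc l_neg flip: r_distr)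
    ultimately show ?thesis by simp
  qed
  have noregL: "\<not> regular_elem (R Quot I) C" if "C \<in> L" for C
    using that noreg by (auto simp: L_def)
  obtain C where C: "C \<in> carrier (R Quot I)"
    and sep: "\<And>D. D \<in> U \<Longrightarrow> C \<otimes>\<^bsub>R Quot I\<^esub> D \<in> L \<Longrightarrow> D = \<zero>\<^bsub>R Quot I\<^esub>"
    by (rule S.uniform_right_ideal_translate[OF L noregL right_ideal_of_rsubmodule[OF U]])
      (use nz sub unif in auto)
  obtain v where v: "v \<in> carrier R" "C = I +> v" using C by (auto elim: rcosetsE)
  show ?thesis
  proof (intro bexI[OF _ v(1)] ballI impI)
    fix r assume r: "r \<in> carrier R" "I +> r \<in> U" "x \<otimes> v \<otimes> r \<in> A"
    then have "C \<otimes>\<^bsub>R Quot I\<^esub> (I +> r) \<in> L"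
      using v x by (auto simp: L_def mult_FactRing m_assoc)
    then have "I +> r = I" using sep[OF r(2)] by simp
    then show "r \<in> I" using r by (simp add: rcos_eq_self_iff)
  qed
qed

text \<open>
  On the right ideal of the elements \<open>wr + a\<close> with \<open>I + r \<in> U\<close>, the map \<open>wr + a \<mapsto> j(I + r)\<close> is well
  defined by the assumption on \<open>w\<close>. Its extension to \<open>R\<close> is left multiplication by the image of \<open>1\<close>.
\<close>

lemma exists_functional:
  assumes E: "injective_rmod R E"
    and U: "rsubmodule R U (quot_rmod (regular_rmod R) I)"
    and j: "j \<in> rmod_hom R ((quot_rmod (regular_rmod R) I)\<lparr>carrier := U\<rparr>) E"
    and A: "right_ideal R A" and w: "w \<in> carrier R"
    and sep: "\<And>r. r \<in> carrier R \<Longrightarrow> I +> r \<in> U \<Longrightarrow> w \<otimes> r \<in> A \<Longrightarrow> r \<in> I"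
  shows "\<exists>e\<in>carrier E. (\<forall>a\<in>A. e \<star>\<^bsub>E\<^esub> a = \<zero>\<^bsub>E\<^esub>) \<and>
    (\<forall>r\<in>carrier R. I +> r \<in> U \<longrightarrow> e \<star>\<^bsub>E\<^esub> (w \<otimes> r) = j (I +> r))"
proof -
  interpret E: right_module R E using E by (simp add: injective_rmod_def)
  interpret U: rsubmodule R U "quot_rmod (regular_rmod R) I" by fact
  define V where "V = {r \<in> carrier R. I +> r \<in> U}"
  have V: "right_ideal R V"
    unfolding V_def by (rule right_ideal_coset_preimage[OF right_ideal_of_rsubmodule[OF U]])
  note DV = right_idealD[OF V] and DA = right_idealD[OF A]
  have VR: "r \<in> carrier R" if "r \<in> V" for r using that by (simp add: V_def)
  have AR: "a \<in> carrier R" if "a \<in> A" for a using that DA(1) by blast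
  define X where "X = (\<lambda>r. w \<otimes> r) ` V <+>\<^bsub>R\<^esub> A"
  have X: "right_ideal R X"
    unfolding X_def by (intro right_ideal_sum right_ideal_lmult V A w)
  have Xmem: "w \<otimes> r \<oplus> a \<in> X" if "r \<in> V" "a \<in> A" for r a
    using that by (auto simp: X_def set_add_def')
  have XE: "\<exists>r\<in>V. \<exists>a\<in>A. y = w \<otimes> r \<oplus> a" if "y \<in> X" for y
    using that by (auto simp: X_def set_add_def')
  \<comment> \<open>the coset of \<open>r\<close> does not depend on how an element of \<open>X\<close> is written as \<open>wr + a\<close>\<close>
  have indep: "I +> r = I +> r'"
    if eq: "w \<otimes> r \<oplus> a = w \<otimes> r' \<oplus> a'" and mem: "r \<in> V" "r' \<in> V" "a \<in> A" "a' \<in> A" for r r' a a'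
  proof -
    note c = VR[OF mem(1)] VR[OF mem(2)] AR[OF mem(3)] AR[OF mem(4)]
    have "w \<otimes> (r \<ominus> r') = (w \<otimes> r \<oplus> a) \<oplus> \<ominus> a \<ominus> w \<otimes> r'"
      using c w by (simp add: minus_eq r_distr r_minus a_assoc r_neg)
    also have "\<dots> = a' \<ominus> a"
      unfolding eq using c w by (simp add: minus_eq a_ac r_neg1 r_neg2 r_neg)
    also have "\<dots> \<in> A" unfolding minus_eq by (intro DA(3) DA(5) mem)
    finally have "w \<otimes> (r \<ominus> r') \<in> A" .
    moreover have "r \<ominus> r' \<in> V" unfolding minus_eq by (intro DV(3) DV(5) mem)
    ultimately have "r \<ominus> r' \<in> I" using sep by (simp add: V_def)
    then show ?thesis using c by (simp add: rcos_eq_iff)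
  qed
  define c where "c y = (SOME r. r \<in> V \<and> (\<exists>a\<in>A. y = w \<otimes> r \<oplus> a))" for y
  have c: "I +> c (w \<otimes> r \<oplus> a) = I +> r" if mem: "r \<in> V" "a \<in> A" for r a
  proof -
    have "c (w \<otimes> r \<oplus> a) \<in> V \<and> (\<exists>a'\<in>A. w \<otimes> r \<oplus> a = w \<otimes> c (w \<otimes> r \<oplus> a) \<oplus> a')"
      unfolding c_def by (rule someI) (use mem in blast)
    then show ?thesis using indep mem by blast
  qed
  note Dj = rmod_homD[OF j]
  have jU: "j (I +> r) \<in> carrier E" if "r \<in> V" for r using Dj(1)[of "I +> r"] that by (simp add: V_def)
  have g: "(\<lambda>y\<in>X. j (I +> c y)) \<in> rmod_hom R ((regular_rmod R)\<lparr>carrier := X\<rparr>) E"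
  proof -
    interpret X: right_module R "(regular_rmod R)\<lparr>carrier := X\<rparr>"
      by (rule rsubmodule.right_module_restrict[OF X])
    have "restrict (\<lambda>y. j (I +> c y)) (carrier ((regular_rmod R)\<lparr>carrier := X\<rparr>))
        \<in> rmod_hom R ((regular_rmod R)\<lparr>carrier := X\<rparr>) E"
    proof (rule rmod_homI[OF X.right_module_axioms])
      fix y assume "y \<in> carrier ((regular_rmod R)\<lparr>carrier := X\<rparr>)"
      then have "y \<in> X" by simp
      then obtain r a where y: "r \<in> V" "a \<in> A" "y = w \<otimes> r \<oplus> a" using XE by blast
      note cr = VR[OF y(1)] AR[OF y(2)]
      show "j (I +> c y) \<in> carrier E" using y jU by (simp add: c)
      show "j (I +> c (y \<oplus>\<^bsub>(regular_rmod R)\<lparr>carrier := X\<rparr>\<^esub> z)) = j (I +> c y) \<oplus>\<^bsub>E\<^esub> j (I +> c z)"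
        if "z \<in> carrier ((regular_rmod R)\<lparr>carrier := X\<rparr>)" for z
      proof -
        from that have "z \<in> X" by simp
        then obtain s b where z: "s \<in> V" "b \<in> A" "z = w \<otimes> s \<oplus> b" using XE by blast
        note cs = VR[OF z(1)] AR[OF z(2)]
        have yz: "y \<oplus> z = w \<otimes> (r \<oplus> s) \<oplus> (a \<oplus> b)"
          using y z cr cs w by (simp add: r_distr a_ac)
        have "j (I +> (r \<oplus> s)) = j (I +> r) \<oplus>\<^bsub>E\<^esub> j (I +> s)"
          using Dj(2)[of "I +> r" "I +> s"] y z cr cs by (simp add: V_def a_rcos_sum)
        then show ?thesis
          using c[OF DV(3)[OF y(1) z(1)] DA(3)[OF y(2) z(2)]] yz y z by (simp add: c)
      qed
      show "j (I +> c (y \<star>\<^bsub>(regular_rmod R)\<lparr>carrier := X\<rparr>\<^esub> s)) = j (I +> c y) \<star>\<^bsub>E\<^esub> s"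
        if s: "s \<in> carrier R" for s
      proof -
        have ys: "y \<otimes> s = w \<otimes> (r \<otimes> s) \<oplus> a \<otimes> s"
          using y cr s w by (simp add: l_distr m_assoc)
        have "j (I +> (r \<otimes> s)) = j (I +> r) \<star>\<^bsub>E\<^esub> s"
          using Dj(3)[of "I +> r" s] y cr s by (simp add: V_def rsmult_quot_regular)
        then show ?thesis
          using c[OF DV(4)[OF y(1) s] DA(4)[OF y(2) s]] ys y by (simp add: c)
      qed
    qed
    then show ?thesis by simp
  qed
  have "\<exists>h \<in> rmod_hom R (regular_rmod R) E. \<forall>x \<in> X. h x = (\<lambda>y\<in>X. j (I +> c y)) x"
    using E X g unfolding injective_rmod_def by blast
  then obtain h where h: "h \<in> rmod_hom R (regular_rmod R) E"
    and hX: "\<And>x. x \<in> X \<Longrightarrow> h x = j (I +> c x)"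
    by auto
  note Dh = rmod_homD[OF h]
  have h1: "h x = h \<one> \<star>\<^bsub>E\<^esub> x" if "x \<in> carrier R" for x
    using Dh(3)[of \<one> x] that by simp
  have hwra: "h (w \<otimes> r \<oplus> a) = j (I +> r)" if "r \<in> V" "a \<in> A" for r a
    using hX[OF Xmem[OF that]] c[OF that] by simp
  show ?thesis
  proof (intro bexI[of _ "h \<one>"] conjI ballI impI)
    show "h \<one> \<in> carrier E" using Dh(1)[of \<one>] by simp
    show "h \<one> \<star>\<^bsub>E\<^esub> a = \<zero>\<^bsub>E\<^esub>" if a: "a \<in> A" for a
    proof -
      have IU: "I \<in> U" using U.zero_closed by simp
      have "j I = j (I +> \<zero>) \<star>\<^bsub>E\<^esub> \<zero>"
        using Dj(3)[of I \<zero>] IU rsmult_quot_regular[of \<zero> \<zero>] by (simp add: a_rcos_const)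
      also have "\<dots> = \<zero>\<^bsub>E\<^esub>" using jU[OF DV(2)] by (rule E.rsmult_zero)
      finally have "h (w \<otimes> \<zero> \<oplus> a) = \<zero>\<^bsub>E\<^esub>" using hwra[OF DV(2) a] by (simp add: a_rcos_const)
      then show ?thesis using h1[OF AR[OF a]] AR[OF a] w by simp
    qed
    fix r assume r: "r \<in> carrier R" "I +> r \<in> U"
    then show "h \<one> \<star>\<^bsub>E\<^esub> (w \<otimes> r) = j (I +> r)"
      using hwra[of r \<zero>] h1[of "w \<otimes> r"] w DA(2) by (simp add: V_def)
  qed
qed

end

text \<open>
  Take \<open>N \<subseteq> I\<close> maximal such that some finite \<open>B\<close> has its common annihilator in \<open>N\<close> contained
  in \<open>A\<close>. If \<open>x \<in> I - A\<close> is killed by \<open>B\<close>, then \<open>B\<close> kills all of \<open>Y \<subseteq> xR + A\<close>. Therefore \<open>B\<close> with \<open>e\<close>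
  added does the same for \<open>N + Y\<close>: on \<open>n + y\<close> the elements of \<open>B\<close> only see \<open>n\<close>, and once \<open>n \<in> A\<close>, \<open>e\<close> only
  sees \<open>y\<close>. This contradicts the maximality of \<open>N\<close>.
\<close>

lemma (in right_module) finite_separating_set:
  assumes R: "right_noetherian R" and A: "right_ideal R A" and I: "right_ideal R I" "A \<subseteq> I"
    and sep: "\<And>x. x \<in> I \<Longrightarrow> x \<notin> A \<Longrightarrow> \<exists>e\<in>ann_in M A. \<exists>Y. right_ideal R Y \<and> \<not> Y \<subseteq> A \<and>
      (\<forall>y\<in>Y. \<exists>r\<in>carrier R. \<exists>a\<in>A. y = x \<otimes>\<^bsub>R\<^esub> r \<oplus>\<^bsub>R\<^esub> a) \<and> (\<forall>y\<in>Y. e \<star>\<^bsub>M\<^esub> y = \<zero>\<^bsub>M\<^esub> \<longrightarrow> y \<in> A)"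
  shows "\<exists>B. finite B \<and> B \<subseteq> ann_in M A \<and> (\<forall>x\<in>I. (\<forall>e\<in>B. e \<star>\<^bsub>M\<^esub> x = \<zero>\<^bsub>M\<^esub>) \<longrightarrow> x \<in> A)"
proof -
  note DA = R.right_idealD[OF A] and DI = R.right_idealD[OF I(1)]
  have annD: "e \<in> carrier M" "\<And>a. a \<in> A \<Longrightarrow> e \<star>\<^bsub>M\<^esub> a = \<zero>\<^bsub>M\<^esub>" if "e \<in> ann_in M A" for e
    using that by (auto simp: ann_in_def)
  define sepby where "sepby B N \<longleftrightarrow> (\<forall>x\<in>N. (\<forall>e\<in>B. e \<star>\<^bsub>M\<^esub> x = \<zero>\<^bsub>M\<^esub>) \<longrightarrow> x \<in> A)" for B N
  define \<Phi> where "\<Phi> N \<longleftrightarrow> N \<subseteq> I \<and> (\<exists>B. finite B \<and> B \<subseteq> ann_in M A \<and> sepby B N)" for N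
  have "\<Phi> {\<zero>\<^bsub>R\<^esub>}"
    unfolding \<Phi>_def sepby_def using DA(2) DI(2) by (intro conjI exI[of _ "{}"]) auto
  then obtain N where N: "right_ideal R N" "\<Phi> N"
    and max: "\<forall>J. right_ideal R J \<and> \<Phi> J \<and> N \<subseteq> J \<longrightarrow> J = N"
    using right_noetherian_maximal[OF R R.right_ideal_zero, of \<Phi>] by blast
  from N(2) obtain B where B: "finite B" "B \<subseteq> ann_in M A" "sepby B N" and NI: "N \<subseteq> I"
    by (auto simp: \<Phi>_def)
  have "sepby B I"
  proof (rule ccontr)
    assume "\<not> sepby B I"
    then obtain x where x: "x \<in> I" "\<And>e. e \<in> B \<Longrightarrow> e \<star>\<^bsub>M\<^esub> x = \<zero>\<^bsub>M\<^esub>" "x \<notin> A"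
      by (auto simp: sepby_def)
    obtain e Y where e: "e \<in> ann_in M A" and Y: "right_ideal R Y" "\<not> Y \<subseteq> A"
      and Yx: "\<forall>y\<in>Y. \<exists>r\<in>carrier R. \<exists>a\<in>A. y = x \<otimes>\<^bsub>R\<^esub> r \<oplus>\<^bsub>R\<^esub> a"
      and eY: "\<forall>y\<in>Y. e \<star>\<^bsub>M\<^esub> y = \<zero>\<^bsub>M\<^esub> \<longrightarrow> y \<in> A"
      using sep[OF x(1,3)] by blast
    have xR: "x \<in> carrier R" using x(1) DI(1) by blast
    have YI: "Y \<subseteq> I"
    proof
      fix y assume "y \<in> Y"
      then obtain r a where "r \<in> carrier R" "a \<in> A" "y = x \<otimes>\<^bsub>R\<^esub> r \<oplus>\<^bsub>R\<^esub> a" using Yx by blast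
      then show "y \<in> I" using DI(3)[OF DI(4)[OF x(1)]] I(2) by blast
    qed
    have BY: "b \<star>\<^bsub>M\<^esub> y = \<zero>\<^bsub>M\<^esub>" if b: "b \<in> B" and y: "y \<in> Y" for b y
    proof -
      obtain r a where ra: "r \<in> carrier R" "a \<in> A" "y = x \<otimes>\<^bsub>R\<^esub> r \<oplus>\<^bsub>R\<^esub> a" using Yx y by blast
      have aR: "a \<in> carrier R" using ra DA(1) by blast
      have bA: "b \<in> ann_in M A" using b B(2) by blast
      show ?thesis
        using annD(1)[OF bA] annD(2)[OF bA ra(2)] x(2)[OF b] ra(1) aR xR unfolding ra(3)
        by (simp add: rsmult_r_distr rsmult_assoc zero_rsmult)
    qed
    let ?J = "N <+>\<^bsub>R\<^esub> Y"
    have NR: "n \<in> carrier R" if "n \<in> N" for n using that R.right_idealD(1)[OF N(1)] by blast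
    have YR: "y \<in> carrier R" if "y \<in> Y" for y using that R.right_idealD(1)[OF Y(1)] by blast
    have sepJ: "sepby (insert e B) ?J"
      unfolding sepby_def
    proof (intro ballI impI)
      fix z assume z: "z \<in> ?J" and zero: "\<forall>b\<in>insert e B. b \<star>\<^bsub>M\<^esub> z = \<zero>\<^bsub>M\<^esub>"
      from z obtain n y where ny: "n \<in> N" "y \<in> Y" "z = n \<oplus>\<^bsub>R\<^esub> y" by (auto simp: set_add_def')
      have bz: "b \<star>\<^bsub>M\<^esub> z = b \<star>\<^bsub>M\<^esub> n \<oplus>\<^bsub>M\<^esub> b \<star>\<^bsub>M\<^esub> y" if "b \<in> ann_in M A" for b
        using ny NR YR annD(1)[OF that] by (simp add: rsmult_r_distr)
      have "b \<star>\<^bsub>M\<^esub> n = \<zero>\<^bsub>M\<^esub>" if b: "b \<in> B" for b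
      proof -
        have bA: "b \<in> ann_in M A" using b B(2) by blast
        have "b \<star>\<^bsub>M\<^esub> z = \<zero>\<^bsub>M\<^esub>" using zero b by blast
        then show ?thesis
          using bz[OF bA] BY[OF b ny(2)] annD(1)[OF bA] NR[OF ny(1)] by (simp add: rsmult_closed)
      qed
      then have nA: "n \<in> A" using B(3) ny(1) by (simp add: sepby_def)
      have "e \<star>\<^bsub>M\<^esub> z = \<zero>\<^bsub>M\<^esub>" using zero by blast
      then have "e \<star>\<^bsub>M\<^esub> y = \<zero>\<^bsub>M\<^esub>"
        using bz[OF e] annD(2)[OF e nA] annD(1)[OF e] YR[OF ny(2)] by (simp add: rsmult_closed)
      then have "y \<in> A" using eY ny(2) by blast
      then show "z \<in> A" using DA(3) nA ny(3) by blast
    qed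
    have "\<Phi> ?J"
      unfolding \<Phi>_def
    proof (intro conjI exI[of _ "insert e B"])
      show "?J \<subseteq> I" using NI YI DI(3) by (auto simp: set_add_def')
    qed (use B e sepJ in auto)
    moreover have "N \<subseteq> ?J"
    proof
      fix n assume n: "n \<in> N"
      then have "n \<oplus>\<^bsub>R\<^esub> \<zero>\<^bsub>R\<^esub> \<in> ?J" using R.right_idealD(2)[OF Y(1)] unfolding set_add_def' by blast
      then show "n \<in> ?J" using NR[OF n] by simp
    qed
    ultimately have JN: "?J = N" using max R.right_ideal_sum[OF N(1) Y(1)] by blast
    have "y \<in> A" if y: "y \<in> Y" for y
    proof -
      have "\<zero>\<^bsub>R\<^esub> \<oplus>\<^bsub>R\<^esub> y \<in> ?J" using R.right_idealD(2)[OF N(1)] y unfolding set_add_def' by blast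
      then have "y \<in> N" using YR[OF y] JN by simp
      then show ?thesis using B(3) BY[OF _ y] by (simp add: sepby_def)
    qed
    then show False using Y(2) by blast
  qed
  then show ?thesis using B(1,2) unfolding sepby_def by blast
qed

section \<open>Torsionfree submodules of \<open>Ext\<close>\<close>

lemma (in right_module) rsubmodule_ann_in:
  assumes "ideal J R"
  shows "rsubmodule R (ann_in M J) M"
proof (rule rsubmoduleI)
  interpret J: ideal J R by fact
  show "x \<star>\<^bsub>M\<^esub> r \<in> ann_in M J" if x: "x \<in> ann_in M J" and r: "r \<in> carrier R" for x r
  proof -
    have "x \<star>\<^bsub>M\<^esub> r \<star>\<^bsub>M\<^esub> q = \<zero>\<^bsub>M\<^esub>" if "q \<in> J" for q
      using x r that rsmult_assoc[of x r q] J.I_l_closed[of q r] by (simp add: ann_in_def)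
    then show ?thesis using x r by (simp add: ann_in_def rsmult_closed)
  qed
  show "\<zero>\<^bsub>M\<^esub> \<in> ann_in M J" by (auto simp: ann_in_def zero_rsmult)
  show "x \<oplus>\<^bsub>M\<^esub> y \<in> ann_in M J" if "x \<in> ann_in M J" "y \<in> ann_in M J" for x y
    using that by (auto simp: ann_in_def rsmult_l_distr)
qed (auto simp: ann_in_def)

context quotient_ext
begin

lemma torsionfree_classes:
  assumes e: "e \<in> transporter" and V: "right_ideal R V"
    and sep: "\<And>v. v \<in> V \<Longrightarrow> ext_class (e \<star>\<^bsub>E\<^esub> v) = \<zero>\<^bsub>Ext\<^esub> \<Longrightarrow> v \<in> P"
  defines "T \<equiv> (\<lambda>v. ext_class (e \<star>\<^bsub>E\<^esub> v)) ` V"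
  shows "rsubmodule (R Quot P) T Ext"
    and "torsionfree (R Quot P) (Ext\<lparr>carrier := T\<rparr>)"
    and "\<not> V \<subseteq> P \<Longrightarrow> T \<noteq> {\<zero>\<^bsub>Ext\<^esub>}"
proof -
  note DV = right_idealD[OF V]
  have VR: "v \<in> carrier R" if "v \<in> V" for v using that DV(1) by blast
  have eE: "e \<in> carrier E" using e by (simp add: transporter_def)
  have ev: "e \<star>\<^bsub>E\<^esub> v \<in> transporter" if "v \<in> V" for v by (rule transporter_rsmult[OF e VR[OF that]])
  show "rsubmodule (R Quot P) T Ext"
  proof (rule Ext.rsubmoduleI)
    show "T \<subseteq> carrier Ext" using ext_class_closed ev by (auto simp: T_def)
    have "ext_class (e \<star>\<^bsub>E\<^esub> \<zero>) = \<zero>\<^bsub>Ext\<^esub>" by (rule ext_class_eq_zero) (simp add: E.rsmult_zero eE)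
    then show "\<zero>\<^bsub>Ext\<^esub> \<in> T" using DV(2) unfolding T_def by (metis image_eqI)
    show "x \<oplus>\<^bsub>Ext\<^esub> y \<in> T" if x: "x \<in> T" and y: "y \<in> T" for x y
    proof -
      obtain v where v: "v \<in> V" "x = ext_class (e \<star>\<^bsub>E\<^esub> v)" using x by (auto simp: T_def)
      obtain v' where v': "v' \<in> V" "y = ext_class (e \<star>\<^bsub>E\<^esub> v')" using y by (auto simp: T_def)
      have "x \<oplus>\<^bsub>Ext\<^esub> y = ext_class (e \<star>\<^bsub>E\<^esub> (v \<oplus> v'))"
        using v v' ev VR eE by (simp add: ext_class_add E.rsmult_r_distr)
      then show ?thesis using DV(3)[OF v(1) v'(1)] by (auto simp: T_def)
    qed
    show "x \<star>\<^bsub>Ext\<^esub> C \<in> T" if x: "x \<in> T" and C: "C \<in> carrier (R Quot P)" for x C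
    proof -
      obtain v where v: "v \<in> V" "x = ext_class (e \<star>\<^bsub>E\<^esub> v)" using x by (auto simp: T_def)
      obtain s where s: "s \<in> carrier R" "C = P +> s" using C by (auto elim: rcosetsE)
      have "x \<star>\<^bsub>Ext\<^esub> C = ext_class (e \<star>\<^bsub>E\<^esub> (v \<otimes> s))"
        using v s ev VR eE by (simp add: ext_class_rsmult E.rsmult_assoc)
      then show ?thesis using DV(4)[OF v(1) s(1)] by (auto simp: T_def)
    qed
  qed
  have zero: "ext_class (e \<star>\<^bsub>E\<^esub> v) = \<zero>\<^bsub>Ext\<^esub>" if "v \<in> P" for v
    using ext_class_eq_zero e that by (simp add: transporter_def)
  show "torsionfree (R Quot P) (Ext\<lparr>carrier := T\<rparr>)"
    unfolding torsionfree_def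
  proof (intro ballI allI impI)
    fix x C assume x: "x \<in> carrier (Ext\<lparr>carrier := T\<rparr>)"
      and C: "regular_elem (R Quot P) C \<and> x \<star>\<^bsub>Ext\<lparr>carrier := T\<rparr>\<^esub> C = \<zero>\<^bsub>Ext\<lparr>carrier := T\<rparr>\<^esub>"
    obtain v where v: "v \<in> V" "x = ext_class (e \<star>\<^bsub>E\<^esub> v)" using x by (auto simp: T_def)
    have "C \<in> carrier (R Quot P)" using C by (simp add: regular_elem_def)
    then obtain s where s: "s \<in> carrier R" "C = P +> s" by (auto elim: rcosetsE)
    have "ext_class (e \<star>\<^bsub>E\<^esub> (v \<otimes> s)) = \<zero>\<^bsub>Ext\<^esub>"
      using C v s ev VR eE by (simp add: ext_class_rsmult E.rsmult_assoc)
    then have "v \<otimes> s \<in> P" by (rule sep[OF DV(4)[OF v(1) s(1)]])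
    then have "(P +> v) \<otimes>\<^bsub>R Quot P\<^esub> C = \<zero>\<^bsub>R Quot P\<^esub>"
      using s VR[OF v(1)] by (simp add: mult_FactRing a_rcos_const)
    moreover have "P +> v \<in> carrier (R Quot P)" using VR[OF v(1)] by (simp add: rcosetsI)
    ultimately have "P +> v = \<zero>\<^bsub>R Quot P\<^esub>" using C by (simp add: regular_elem_def)
    then have "v \<in> P" using VR[OF v(1)] by (simp add: rcos_eq_self_iff)
    then show "x = \<zero>\<^bsub>Ext\<lparr>carrier := T\<rparr>\<^esub>" using zero v by simp
  qed
  show "T \<noteq> {\<zero>\<^bsub>Ext\<^esub>}" if "\<not> V \<subseteq> P"
  proof -
    obtain v where v: "v \<in> V" "v \<notin> P" using \<open>\<not> V \<subseteq> P\<close> by blast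
    then have "ext_class (e \<star>\<^bsub>E\<^esub> v) \<noteq> \<zero>\<^bsub>Ext\<^esub>" using sep[OF v(1)] by blast
    moreover have "ext_class (e \<star>\<^bsub>E\<^esub> v) \<in> T" using v(1) unfolding T_def by (rule imageI)
    ultimately show ?thesis by blast
  qed
qed

end

text \<open>
  If the claim fails, each \<open>L e\<close> has an element outside \<open>P\<close> in every right ideal not contained in \<open>P\<close>.
  Intersecting with one \<open>L e\<close> after the other, starting from \<open>R\<close>, yields \<open>v \<notin> P\<close> such that \<open>B\<close> kills
  \<open>vI\<close>. So \<open>vI \<subseteq> A\<close>, and faithfulness is violated.
\<close>

lemma exists_nonessential_annihilator:
  assumes E: "right_module R E" and P: "ideal P R" "P \<noteq> carrier R" and I: "ideal I R"
    and faithful: "\<And>s. s \<in> carrier R \<Longrightarrow> (\<And>y. y \<in> I \<Longrightarrow> s \<otimes>\<^bsub>R\<^esub> y \<in> A) \<Longrightarrow> s \<in> P"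
    and B: "finite B" "B \<subseteq> carrier E" "\<And>x. x \<in> I \<Longrightarrow> (\<And>e. e \<in> B \<Longrightarrow> e \<star>\<^bsub>E\<^esub> x = \<zero>\<^bsub>E\<^esub>) \<Longrightarrow> x \<in> A"
  shows "\<exists>e\<in>B. \<exists>V. right_ideal R V \<and> \<not> V \<subseteq> P \<and>
    (\<forall>v\<in>V. (\<forall>y\<in>I. e \<star>\<^bsub>E\<^esub> (v \<otimes>\<^bsub>R\<^esub> y) = \<zero>\<^bsub>E\<^esub>) \<longrightarrow> v \<in> P)"
proof (rule ccontr)
  assume neg: "\<not> ?thesis"
  interpret P: ideal P R by (rule P)
  interpret I: ideal I R by (rule I)
  interpret E: right_module R E by (rule E)
  define L where "L e = {r \<in> carrier R. \<forall>y\<in>I. e \<star>\<^bsub>E\<^esub> (r \<otimes>\<^bsub>R\<^esub> y) = \<zero>\<^bsub>E\<^esub>}" for e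
  have L: "right_ideal R (L e)" if e: "e \<in> carrier E" for e
  proof (rule P.right_idealI)
    show "r \<otimes>\<^bsub>R\<^esub> s \<in> L e" if r: "r \<in> L e" and s: "s \<in> carrier R" for r s
    proof -
      have "e \<star>\<^bsub>E\<^esub> (r \<otimes>\<^bsub>R\<^esub> s \<otimes>\<^bsub>R\<^esub> y) = \<zero>\<^bsub>E\<^esub>" if y: "y \<in> I" for y
        using r s y I.I_l_closed[OF y s] by (simp add: L_def P.m_assoc)
      then show ?thesis using r s by (simp add: L_def)
    qed
  qed (use e in \<open>auto simp: L_def P.l_distr E.rsmult_r_distr E.rsmult_zero\<close>)
  have meet: "\<exists>v\<in>V. v \<in> L e \<and> v \<notin> P" if "e \<in> B" "right_ideal R V" "\<not> V \<subseteq> P" for e V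
  proof -
    have "V \<subseteq> carrier R" by (rule P.right_idealD(1)[OF that(2)])
    then show ?thesis using neg that unfolding L_def by blast
  qed
  have "C \<subseteq> B \<Longrightarrow> right_ideal R V \<Longrightarrow> \<not> V \<subseteq> P \<Longrightarrow> \<exists>v\<in>V. v \<notin> P \<and> (\<forall>e\<in>C. v \<in> L e)"
    if "finite C" for C V
    using that
  proof (induction C arbitrary: V rule: finite_induct)
    case (insert e C)
    have e: "e \<in> B" "e \<in> carrier E" using insert.prems(1) B(2) by auto
    have "right_ideal R (V \<inter> L e)" by (intro P.right_ideal_Int insert.prems(2) L e)
    moreover have "\<not> V \<inter> L e \<subseteq> P" using meet[OF e(1) insert.prems(2,3)] by blast
    ultimately obtain v where "v \<in> V \<inter> L e" "v \<notin> P" "\<forall>e\<in>C. v \<in> L e"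
      using insert.IH insert.prems(1) by (metis insert_subset)
    then show ?case by blast
  qed auto
  from this[OF B(1) order_refl P.right_ideal_carrier]
  obtain v where v: "v \<in> carrier R" "v \<notin> P" "\<And>e. e \<in> B \<Longrightarrow> v \<in> L e"
    using P(2) P.a_subset by blast
  have "v \<otimes>\<^bsub>R\<^esub> y \<in> A" if y: "y \<in> I" for y
    by (rule B(3)[OF I.I_l_closed[OF y v(1)]]) (use v(3) y in \<open>auto simp: L_def\<close>)
  then show False using faithful v(1,2) by blast
qed

theorem theorem2p5:
  fixes R :: "('a, 'm) ring_scheme" and P Q :: "'a set"
    and U :: "'a set set" and E :: "('a, 'e) rmodule" and j :: "'a set \<Rightarrow> 'e"
  assumes "right_noetherian R"
    and "nc_prime_ideal R P"
    and "nc_prime_ideal R Q"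
    and "rsubmodule R U (quot_rmod (regular_rmod R) Q)"
    and "uniform_rmod R ((quot_rmod (regular_rmod R) Q)\<lparr>carrier := U\<rparr>)"
    and "injective_hull R ((quot_rmod (regular_rmod R) Q)\<lparr>carrier := U\<rparr>) E j"
    and "\<exists>A. ideal A R \<and> ideal_prod R P Q \<subseteq> A \<and> A \<subset> P \<inter> Q \<and>
      faithful (opp_ring (R Quot P)) (factor_rmod (ideal_quot (opp_ring R) (P \<inter> Q) A)) \<and>
      torsionfree (R Quot Q) (factor_rmod (ideal_quot R (P \<inter> Q) A))"
  shows "\<exists>T. rsubmodule (R Quot P) T
        (ext1 R (mult (R Quot P)) (quot_rmod (regular_rmod R) P) (E\<lparr>carrier := ann_in E Q\<rparr>)) \<and>
      T \<noteq> {\<zero>\<^bsub>ext1 R (mult (R Quot P)) (quot_rmod (regular_rmod R) P) (E\<lparr>carrier := ann_in E Q\<rparr>)\<^esub>} \<and>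
      torsionfree (R Quot P)
        ((ext1 R (mult (R Quot P)) (quot_rmod (regular_rmod R) P) (E\<lparr>carrier := ann_in E Q\<rparr>))\<lparr>carrier := T\<rparr>)"
proof -
  obtain A where A: "ideal A R" and PQA: "ideal_prod R P Q \<subseteq> A" and APQ: "A \<subset> P \<inter> Q"
    and faithful: "faithful (opp_ring (R Quot P)) (factor_rmod (ideal_quot (opp_ring R) (P \<inter> Q) A))"
    and torsionfree: "torsionfree (R Quot Q) (factor_rmod (ideal_quot R (P \<inter> Q) A))"
    using assms(7) by blast
  interpret P: ideal P R using assms(2) by (simp add: nc_prime_ideal_def)
  interpret Q: ideal Q R using assms(3) by (simp add: nc_prime_ideal_def)
  interpret A: ideal A R by (rule A)
  have PQ: "p \<otimes>\<^bsub>R\<^esub> q \<in> A" if "p \<in> P" "q \<in> Q" for p q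
    using PQA ideal_prod.prod[of p P q Q R] that by blast
  let ?I = "P \<inter> Q"
  interpret I: ideal ?I R
    by (rule idealI[OF P.ring_axioms]) (auto intro: P.add.subgroups_Inter_pair P.a_subgroup Q.a_subgroup
        simp: P.I_l_closed Q.I_l_closed P.I_r_closed Q.I_r_closed)
  have AI: "A \<subseteq> ?I" using APQ by blast
  \<comment> \<open>the two module hypotheses, in terms of representatives\<close>
  have tf: "x \<in> A" if x: "x \<in> ?I" and c: "c \<in> carrier R" "x \<otimes>\<^bsub>R\<^esub> c \<in> A"
    and reg: "regular_elem (R Quot Q) (Q +>\<^bsub>R\<^esub> c)" for x c
  proof -
    note act = P.ideal_quot_act[OF I.right_ideal A.right_ideal AI x c(1) Q.zero_closed Q.a_subset]
    have xq: "x \<otimes>\<^bsub>R\<^esub> q \<in> A" if "q \<in> Q" for q using x that PQ by blast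
    have "A +>\<^bsub>R\<^esub> x = A"
      using torsionfree reg act(1,2,4)[OF xq] A.a_rcos_const[OF c(2)] unfolding torsionfree_def by metis
    then show ?thesis using x by (simp add: A.rcos_eq_self_iff)
  qed
  have ff: "s \<in> P" if s: "s \<in> carrier R" "\<And>y. y \<in> ?I \<Longrightarrow> s \<otimes>\<^bsub>R\<^esub> y \<in> A" for s
  proof -
    interpret O: ring "opp_ring R" by (rule P.ring_opp_ring)
    have rI: "right_ideal (opp_ring R) ?I"
      by (rule O.right_idealI) (use I.a_subset I.I_l_closed in auto)
    have rA: "right_ideal (opp_ring R) A"
      by (rule O.right_idealI) (use A.a_subset A.I_l_closed in auto)
    have J: "\<zero>\<^bsub>opp_ring R\<^esub> \<in> P" "P \<subseteq> carrier (opp_ring R)" "s \<in> carrier (opp_ring R)"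
      using P.a_subset s by auto
    have zero: "X \<star>\<^bsub>factor_rmod (ideal_quot (opp_ring R) ?I A)\<^esub> (P +>\<^bsub>R\<^esub> s) =
        \<zero>\<^bsub>factor_rmod (ideal_quot (opp_ring R) ?I A)\<^esub>"
      if X: "X \<in> carrier (factor_rmod (ideal_quot (opp_ring R) ?I A))" for X
    proof -
      have sq: "y \<otimes>\<^bsub>opp_ring R\<^esub> q \<in> A" if "y \<in> ?I" "q \<in> P" for y q using that PQ by simp
      obtain y where y: "y \<in> ?I" "X = A +>\<^bsub>opp_ring R\<^esub> y"
        using O.ideal_quot_act(3)[OF rI rA AI I.zero_closed J(3,1,2) sq[OF I.zero_closed] X] by blast
      show ?thesis
        using O.ideal_quot_act(2,4)[OF rI rA AI y(1) J(3,1,2) sq[OF y(1)]] y s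
        by (simp add: A.a_rcos_const)
    qed
    have "P +>\<^bsub>R\<^esub> s \<in> carrier (opp_ring (R Quot P))" using s by (simp add: P.rcosetsI)
    then have "P +>\<^bsub>R\<^esub> s = \<zero>\<^bsub>opp_ring (R Quot P)\<^esub>"
      using faithful zero unfolding faithful_def by blast
    then show ?thesis using s by (simp add: P.rcos_eq_self_iff)
  qed
  have inj: "injective_rmod R E" and j: "j \<in> rmod_hom R ((quot_rmod (regular_rmod R) Q)\<lparr>carrier := U\<rparr>) E"
    and j_inj: "inj_on j U"
    using assms(6) by (auto simp: injective_hull_def)
  interpret E: right_module R E using inj by (simp add: injective_rmod_def)
  have rU: "right_ideal (R Quot Q) U" by (rule Q.right_ideal_of_rsubmodule[OF assms(4)])
  have QU: "Q \<in> U" using ring.right_idealD(2)[OF Q.quotient_is_ring rU] by simp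
  have jQ: "j Q = \<zero>\<^bsub>E\<^esub>"
    using rmod_homD(3)[OF j, of Q "\<zero>\<^bsub>R\<^esub>"] rmod_homD(1)[OF j, of Q] QU
      Q.rsmult_quot_regular[of "\<zero>\<^bsub>R\<^esub>" "\<zero>\<^bsub>R\<^esub>"] E.rsmult_zero[of "j Q"]
    by (simp add: Q.a_rcos_const)
  have sep: "\<exists>e\<in>ann_in E A. \<exists>Y. right_ideal R Y \<and> \<not> Y \<subseteq> A \<and>
      (\<forall>y\<in>Y. \<exists>r\<in>carrier R. \<exists>a\<in>A. y = x \<otimes>\<^bsub>R\<^esub> r \<oplus>\<^bsub>R\<^esub> a) \<and> (\<forall>y\<in>Y. e \<star>\<^bsub>E\<^esub> y = \<zero>\<^bsub>E\<^esub> \<longrightarrow> y \<in> A)"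
    if x: "x \<in> ?I" "x \<notin> A" for x
  proof -
    have xR: "x \<in> carrier R" using x(1) by simp
    have xq: "x \<otimes>\<^bsub>R\<^esub> q \<in> A" if "q \<in> Q" for q using x(1) that PQ by blast
    obtain v where v: "v \<in> carrier R"
      and vU: "\<And>r. r \<in> carrier R \<Longrightarrow> Q +>\<^bsub>R\<^esub> r \<in> U \<Longrightarrow> x \<otimes>\<^bsub>R\<^esub> v \<otimes>\<^bsub>R\<^esub> r \<in> A \<Longrightarrow> r \<in> Q"
      using Q.uniform_translate[OF assms(1,3,4,5) A.right_ideal xR xq] tf x by blast
    let ?w = "x \<otimes>\<^bsub>R\<^esub> v"
    have w: "?w \<in> carrier R" using xR v by simp
    obtain e where e: "e \<in> carrier E" "\<forall>a\<in>A. e \<star>\<^bsub>E\<^esub> a = \<zero>\<^bsub>E\<^esub>"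
      and ej: "\<And>r. r \<in> carrier R \<Longrightarrow> Q +>\<^bsub>R\<^esub> r \<in> U \<Longrightarrow> e \<star>\<^bsub>E\<^esub> (?w \<otimes>\<^bsub>R\<^esub> r) = j (Q +>\<^bsub>R\<^esub> r)"
      using Q.exists_functional[OF inj assms(4) j A.right_ideal w vU] by blast
    define Y where "Y = (\<lambda>r. ?w \<otimes>\<^bsub>R\<^esub> r) ` {r \<in> carrier R. Q +>\<^bsub>R\<^esub> r \<in> U}"
    have "right_ideal R Y"
      unfolding Y_def by (intro P.right_ideal_lmult Q.right_ideal_coset_preimage rU w)
    moreover have "\<not> Y \<subseteq> A"
    proof
      assume YA: "Y \<subseteq> A"
      obtain C where C: "C \<in> U" "C \<noteq> Q"
        using assms(5) QU by (auto simp: uniform_rmod_def)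
      have "C \<in> a_rcosets\<^bsub>R\<^esub> Q" using C(1) ring.right_idealD(1)[OF Q.quotient_is_ring rU] by auto
      then obtain r where r: "r \<in> carrier R" "C = Q +>\<^bsub>R\<^esub> r" by (rule Q.rcosetsE)
      then have "?w \<otimes>\<^bsub>R\<^esub> r \<in> A" using C YA by (auto simp: Y_def)
      then have "r \<in> Q" using vU r C by blast
      then show False using C r by (simp add: Q.a_rcos_const)
    qed
    moreover have "\<exists>r\<in>carrier R. \<exists>a\<in>A. y = x \<otimes>\<^bsub>R\<^esub> r \<oplus>\<^bsub>R\<^esub> a" if "y \<in> Y" for y
    proof -
      from that obtain r where r: "r \<in> carrier R" "y = ?w \<otimes>\<^bsub>R\<^esub> r" by (auto simp: Y_def)
      then show ?thesis using xR v
        by (intro bexI[of _ "v \<otimes>\<^bsub>R\<^esub> r"] bexI[of _ "\<zero>\<^bsub>R\<^esub>"]) (simp_all add: P.m_assoc)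
    qed
    moreover have "y \<in> A" if y: "y \<in> Y" and ey: "e \<star>\<^bsub>E\<^esub> y = \<zero>\<^bsub>E\<^esub>" for y
    proof -
      from y obtain r where r: "r \<in> carrier R" "Q +>\<^bsub>R\<^esub> r \<in> U" "y = ?w \<otimes>\<^bsub>R\<^esub> r" by (auto simp: Y_def)
      then have "j (Q +>\<^bsub>R\<^esub> r) = j Q" using ej ey jQ by simp
      then have "Q +>\<^bsub>R\<^esub> r = Q" using j_inj r(2) QU by (auto dest: inj_onD)
      then have "r \<in> Q" using r(1) by (simp add: Q.rcos_eq_self_iff)
      moreover have "?w \<in> P" using x(1) v by (simp add: P.I_r_closed)
      ultimately show ?thesis using PQ r(3) by simp
    qed
    moreover have "e \<in> ann_in E A" using e by (simp add: ann_in_def)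
    ultimately show ?thesis by blast
  qed
  have "\<exists>B. finite B \<and> B \<subseteq> ann_in E A \<and> (\<forall>x\<in>?I. (\<forall>e\<in>B. e \<star>\<^bsub>E\<^esub> x = \<zero>\<^bsub>E\<^esub>) \<longrightarrow> x \<in> A)"
    by (rule E.finite_separating_set[OF assms(1) A.right_ideal I.right_ideal AI sep])
  then obtain B where B: "finite B" "B \<subseteq> ann_in E A"
    and B_sep: "\<forall>x\<in>?I. (\<forall>e\<in>B. e \<star>\<^bsub>E\<^esub> x = \<zero>\<^bsub>E\<^esub>) \<longrightarrow> x \<in> A"
    by blast
  have Bsep: "x \<in> A" if "x \<in> ?I" "\<And>e. e \<in> B \<Longrightarrow> e \<star>\<^bsub>E\<^esub> x = \<zero>\<^bsub>E\<^esub>" for x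
    using B_sep that(1) that(2) by simp
  have BE: "B \<subseteq> carrier E" using B(2) by (auto simp: ann_in_def)
  have PR: "P \<noteq> carrier R" using assms(2) by (simp add: nc_prime_ideal_def)
  have "\<exists>e\<in>B. \<exists>V. right_ideal R V \<and> \<not> V \<subseteq> P \<and>
      (\<forall>v\<in>V. (\<forall>y\<in>?I. e \<star>\<^bsub>E\<^esub> (v \<otimes>\<^bsub>R\<^esub> y) = \<zero>\<^bsub>E\<^esub>) \<longrightarrow> v \<in> P)"
    by (rule exists_nonessential_annihilator[where A = A])
      (fact E.right_module_axioms P.is_ideal PR I.is_ideal ff B(1) BE Bsep)+
  then obtain e V where e: "e \<in> B" and V: "right_ideal R V" "\<not> V \<subseteq> P"
    and Vsep: "\<forall>v\<in>V. (\<forall>y\<in>?I. e \<star>\<^bsub>E\<^esub> (v \<otimes>\<^bsub>R\<^esub> y) = \<zero>\<^bsub>E\<^esub>) \<longrightarrow> v \<in> P"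
    by blast
  have e_ann: "e \<in> ann_in E A" using e B(2) by blast
  have eA: "e \<in> carrier E" and eA0: "e \<star>\<^bsub>E\<^esub> a = \<zero>\<^bsub>E\<^esub>" if "a \<in> A" for a
    using e_ann that unfolding ann_in_def by blast+
  have eE: "e \<in> carrier E" by (rule eA[OF A.zero_closed])
  have epq: "e \<star>\<^bsub>E\<^esub> p \<star>\<^bsub>E\<^esub> q = \<zero>\<^bsub>E\<^esub>" if "p \<in> P" "q \<in> Q" for p q
    using E.rsmult_assoc[OF eE P.a_Hcarr[OF that(1)] Q.a_Hcarr[OF that(2)]] eA0[OF PQ[OF that]]
    by metis
  have eP: "e \<star>\<^bsub>E\<^esub> p \<in> ann_in E Q" if "p \<in> P" for p
    unfolding ann_in_def
    by (rule CollectI, intro conjI ballI epq[OF that] E.rsmult_closed[OF eE P.a_Hcarr[OF that]])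
  interpret quotient_ext P R E "ann_in E Q"
    by (rule quotient_ext.intro[OF P.is_ideal E.right_module_axioms E.rsubmodule_ann_in[OF Q.is_ideal]])
  have et: "e \<in> transporter"
    unfolding transporter_def by (rule CollectI, intro conjI ballI eP eE)
  have "v \<in> P" if v: "v \<in> V" and zero: "ext_class (e \<star>\<^bsub>E\<^esub> v) = \<zero>\<^bsub>Ext\<^esub>" for v
  proof (rule Vsep[rule_format, OF v])
    have vR: "v \<in> carrier R" using P.right_idealD(1)[OF V(1)] v by (rule subsetD)
    fix y assume y: "y \<in> ?I"
    obtain m where m: "m \<in> ann_in E Q" "\<forall>p\<in>P. e \<star>\<^bsub>E\<^esub> v \<star>\<^bsub>E\<^esub> p = m \<star>\<^bsub>E\<^esub> p"
      using ext_class_zeroD[OF transporter_rsmult[OF et vR] zero] by blast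
    have yP: "y \<in> P" and yQ: "y \<in> Q" using y by blast+
    have "m \<star>\<^bsub>E\<^esub> y = \<zero>\<^bsub>E\<^esub>" using m(1) yQ unfolding ann_in_def by blast
    then show "e \<star>\<^bsub>E\<^esub> (v \<otimes>\<^bsub>R\<^esub> y) = \<zero>\<^bsub>E\<^esub>"
      unfolding E.rsmult_assoc[OF eE vR P.a_Hcarr[OF yP]] using m(2) yP by metis
  qed
  from torsionfree_classes[OF et V(1) this] V(2) show ?thesis by blast
qed

end
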